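(* Let $\mathcal G$ be a topologically principal, Hausdorff, étale groupoid with compact unit space, and let $p\in[1,\infty)\setminus\{2\}$. Then there is a natural isomorphism of topological groupoids \[ \mathcal G_{F^p_\lambda(\mathcal G)}\cong\mathcal G, \] where $\mathcal G_{F^p_\lambda(\mathcal G)}$ denotes the Weyl groupoid of the unital $L^p$-operator algebra $F^p_\lambda(\mathcal G)$.
   Context: Groupoids: for a topological groupoid $\mathcal G$ with unit space $\mathcal G^{(0)}$, $\mathrm{dom}(\gamma)=\gamma^{-1}\gamma$, $\mathrm{ran}(\gamma)=\gamma\gamma^{-1}$; $\mathcal G$ is étale if $\mathrm{dom},\mathrm{ran}\colon\mathcal G\to\mathcal G^{(0)}$ are local homeomorphisms. It is topologically principal if the set of $x\in\mathcal G^{(0)}$ whose isotropy group $\{\gamma:\mathrm{dom}(\gamma)=\mathrm{ran}(\gamma)=x\}$ is trivial is dense in $\mathcal G^{(0)}$. Reduced groupoid algebra: $C_c(\mathcal G)$ carries the convolution $(f*g)(\gamma)=\sum_{\sigma\in\mathcal G\mathrm{dom}(\gamma)}f(\gamma\sigma^{-1})g(\sigma)$, where $\mathcal Gx=\{\sigma:\mathrm{dom}(\sigma)=x\}$. For $x\in\mathcal G^{(0)}$, $\lambda_x\colon C_c(\mathcal G)\to\mathcal B(\ell^p(\mathcal Gx))$ is given by left convolution, $(\lambda_x(f)\xi)(\gamma)=\sum_{\sigma\in\mathcal Gx}f(\gamma\sigma^{-1})\xi(\sigma)$. $F^p_\lambda(\mathcal G)$ is the completion of $C_c(\mathcal G)$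 in the norm $\|f\|_\lambda=\sup_{x\in\mathcal G^{(0)}}\|\lambda_x(f)\|$. An $L^p$-operator algebra is a Banach algebra that admits an isometric representation on some $L^p(\mu)$; $F^p_\lambda(\mathcal G)$ is one, and it is unital when $\mathcal G^{(0)}$ is compact. Weyl groupoid: let $A$ be a unital $L^p$-operator algebra, $p\ne 2$. An element $a$ is hermitian if $\|e^{ita}\|=1$ for all $t\in\mathbb R$; with $A_{\mathrm h}$ the set of hermitian elements, $\mathrm{core}(A)=A_{\mathrm h}+iA_{\mathrm h}$ is a commutative unital $C^*$-algebra (with involution $x+iy\mapsto x-iy$, $x,y\in A_{\mathrm h}$), so $\mathrm{core}(A)=C(X_A)$ for a compact Hausdorff space $X_A$. $C(X_A)_+$ denotes the functions with values in $[0,\infty)$, and for open $V\subseteq X_A$ we regard $C_0(V)\subseteq C(X_A)$ by extending by zero. A homeomorphism $\alpha\colon U\to V$ between open subsets of $X_A$ is realizable if there are $a,b\in A$ such that: (1) $afb,bfa\in C(X_A)_+$ for all $f\in C(X_A)_+$; (2) $U=\{x:(ba)(x)>0\}$ and $V=\{x:(ab)(x)>0\}$; (3) for all $x\in U$, $y\in V$, $f\in C_0(V)$, $g\in C_0(U)$: $f(\alpha(x))\,(ba)(x)=(bfa)(x)$ and $g(\alpha^{-1}(y))\,(ab)(y)=(agb)(y)$. The realizable partial homeomorphisms form an inverse subsemigroup $S$ of the partial homeomorphisms of $X_A$. The Weyl groupoid $\mathcal G_A$ is the groupoid of germs of $S$: its elements are classes $[s,x]$ with $s\in S$, $x\in\mathrm{dom}(s)$,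 where $[s,x]=[t,y]$ iff $x=y$ and $s,t$ agree on a neighborhood of $x$; $\mathrm{dom}[s,x]=x$, $\mathrm{ran}[s,x]=s(x)$, $[s,t(y)][t,y]=[st,y]$, $[s,x]^{-1}=[s^{-1},s(x)]$; basic open sets are $\{[s,x]:x\in U',s(x)\in V'\}$ for $s\in S$ and $U',V'\subseteq X_A$ open. *)

theory Defs
  imports "HOL-Analysis.Analysis" "HOL-Algebra.Module"
begin

section \<open>Topological groupoids\<close>

text \<open>
  The arrows of a groupoid form the underlying set of the topology \<open>gtop\<close>; the unit space is a
  subset of the arrows. Only the values of \<open>gmult\<close> on composable pairs matter.
\<close>

record 'g topgroupoid =
  gtop :: "'g topology"
  gmult :: "'g \<Rightarrow> 'g \<Rightarrow> 'g"
  ginv :: "'g \<Rightarrow> 'g"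

abbreviation arrows :: "'g topgroupoid \<Rightarrow> 'g set" where
  "arrows G \<equiv> topspace (gtop G)"

definition gdom :: "'g topgroupoid \<Rightarrow> 'g \<Rightarrow> 'g" where
  "gdom G \<gamma> = gmult G (ginv G \<gamma>) \<gamma>"

definition gran :: "'g topgroupoid \<Rightarrow> 'g \<Rightarrow> 'g" where
  "gran G \<gamma> = gmult G \<gamma> (ginv G \<gamma>)"

definition units :: "'g topgroupoid \<Rightarrow> 'g set" where
  "units G = gdom G ` arrows G"

definition composable :: "'g topgroupoid \<Rightarrow> ('g \<times> 'g) set" where
  "composable G = {(\<gamma>, \<eta>). \<gamma> \<in> arrows G \<and> \<eta> \<in> arrows G \<and> gdom G \<gamma> = gran G \<eta>}"

locale topological_groupoid =
  fixes G :: "'g topgroupoid"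
  assumes inv_closed: "\<gamma> \<in> arrows G \<Longrightarrow> ginv G \<gamma> \<in> arrows G"
    and inv_inv: "\<gamma> \<in> arrows G \<Longrightarrow> ginv G (ginv G \<gamma>) = \<gamma>"
    and dom_closed: "\<gamma> \<in> arrows G \<Longrightarrow> gdom G \<gamma> \<in> arrows G"
    and mult_closed: "(\<gamma>, \<eta>) \<in> composable G \<Longrightarrow> gmult G \<gamma> \<eta> \<in> arrows G"
    and dom_mult: "(\<gamma>, \<eta>) \<in> composable G \<Longrightarrow> gdom G (gmult G \<gamma> \<eta>) = gdom G \<eta>"
    and ran_mult: "(\<gamma>, \<eta>) \<in> composable G \<Longrightarrow> gran G (gmult G \<gamma> \<eta>) = gran G \<gamma>"
    and assoc: "(\<gamma>, \<eta>) \<in> composable G \<Longrightarrow> (\<eta>, \<theta>) \<in> composable G \<Longrightarrow>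
      gmult G (gmult G \<gamma> \<eta>) \<theta> = gmult G \<gamma> (gmult G \<eta> \<theta>)"
    and mult_dom: "\<gamma> \<in> arrows G \<Longrightarrow> gmult G \<gamma> (gdom G \<gamma>) = \<gamma>"
    and ran_mult_self: "\<gamma> \<in> arrows G \<Longrightarrow> gmult G (gran G \<gamma>) \<gamma> = \<gamma>"
    and continuous_mult:
      "continuous_map (subtopology (prod_topology (gtop G) (gtop G)) (composable G)) (gtop G)
        (\<lambda>(\<gamma>, \<eta>). gmult G \<gamma> \<eta>)"
    and continuous_inv: "continuous_map (gtop G) (gtop G) (ginv G)"

definition local_homeomorphism :: "'a topology \<Rightarrow> 'b topology \<Rightarrow> ('a \<Rightarrow> 'b) \<Rightarrow> bool" where
  "local_homeomorphism X Y f \<longleftrightarrow>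
    f ` topspace X \<subseteq> topspace Y \<and>
    (\<forall>x\<in>topspace X. \<exists>U. openin X U \<and> x \<in> U \<and> openin Y (f ` U) \<and>
      homeomorphic_map (subtopology X U) (subtopology Y (f ` U)) f)"

definition unit_space :: "'g topgroupoid \<Rightarrow> 'g topology" where
  "unit_space G = subtopology (gtop G) (units G)"

definition etale :: "'g topgroupoid \<Rightarrow> bool" where
  "etale G \<longleftrightarrow> local_homeomorphism (gtop G) (unit_space G) (gdom G) \<and>
    local_homeomorphism (gtop G) (unit_space G) (gran G)"

definition isotropy :: "'g topgroupoid \<Rightarrow> 'g \<Rightarrow> 'g set" where
  "isotropy G x = {\<gamma> \<in> arrows G. gdom G \<gamma> = x \<and> gran G \<gamma> = x}"

definition topologically_principal :: "'g topgroupoid \<Rightarrow> bool" where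
  "topologically_principal G \<longleftrightarrow>
    unit_space G closure_of {x \<in> units G. isotropy G x = {x}} = units G"

definition topgroupoid_iso ::
  "'g topgroupoid \<Rightarrow> 'h topgroupoid \<Rightarrow> ('g \<Rightarrow> 'h) \<Rightarrow> bool" where
  "topgroupoid_iso G H \<Phi> \<longleftrightarrow>
    homeomorphic_map (gtop G) (gtop H) \<Phi> \<and>
    (\<forall>\<gamma>\<in>arrows G. \<Phi> (ginv G \<gamma>) = ginv H (\<Phi> \<gamma>)) \<and>
    (\<forall>\<gamma>\<in>arrows G. \<forall>\<eta>\<in>arrows G. (\<gamma>, \<eta>) \<in> composable G \<longleftrightarrow> (\<Phi> \<gamma>, \<Phi> \<eta>) \<in> composable H) \<and>
    (\<forall>(\<gamma>, \<eta>)\<in>composable G. \<Phi> (gmult G \<gamma> \<eta>) = gmult H (\<Phi> \<gamma>) (\<Phi> \<eta>))"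

section \<open>Normed algebras and their completion\<close>

record 'a normed_algebra = "(complex, 'a) module" +
  nrm :: "'a \<Rightarrow> real"

definition cauchy_seqs :: "'a normed_algebra \<Rightarrow> (nat \<Rightarrow> 'a) set" where
  "cauchy_seqs N = {X. range X \<subseteq> carrier N \<and>
    (\<forall>e>0. \<exists>M. \<forall>m\<ge>M. \<forall>n\<ge>M. nrm N (X m \<ominus>\<^bsub>N\<^esub> X n) < e)}"

definition null_rel :: "'a normed_algebra \<Rightarrow> ((nat \<Rightarrow> 'a) \<times> (nat \<Rightarrow> 'a)) set" where
  "null_rel N = {(X, Y) \<in> cauchy_seqs N \<times> cauchy_seqs N.
    (\<lambda>n. nrm N (X n \<ominus>\<^bsub>N\<^esub> Y n)) \<longlonglongrightarrow> 0}"

definition cauchy_class :: "'a normed_algebra \<Rightarrow> (nat \<Rightarrow> 'a) \<Rightarrow> (nat \<Rightarrow> 'a) set" where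
  "cauchy_class N X = null_rel N `` {X}"

definition rep :: "'a set \<Rightarrow> 'a" where
  "rep P = (SOME X. X \<in> P)"

definition completion :: "'a normed_algebra \<Rightarrow> (nat \<Rightarrow> 'a) set normed_algebra" where
  "completion N =
    \<lparr> carrier = cauchy_seqs N // null_rel N,
      monoid.mult = (\<lambda>P Q. cauchy_class N (\<lambda>n. rep P n \<otimes>\<^bsub>N\<^esub> rep Q n)),
      one = cauchy_class N (\<lambda>n. \<one>\<^bsub>N\<^esub>),
      zero = cauchy_class N (\<lambda>n. \<zero>\<^bsub>N\<^esub>),
      add = (\<lambda>P Q. cauchy_class N (\<lambda>n. rep P n \<oplus>\<^bsub>N\<^esub> rep Q n)),
      smult = (\<lambda>c P. cauchy_class N (\<lambda>n. c \<odot>\<^bsub>N\<^esub> rep P n)),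
      nrm = (\<lambda>P. lim (\<lambda>n. nrm N (rep P n))) \<rparr>"

definition completion_embed :: "'a normed_algebra \<Rightarrow> 'a \<Rightarrow> (nat \<Rightarrow> 'a) set" where
  "completion_embed N a = cauchy_class N (\<lambda>n. a)"

section \<open>The reduced groupoid \<open>L\<^sup>p\<close>-operator algebra\<close>

text \<open>Functions on the groupoid and vectors in \<open>\<ell>\<^sup>p\<close> are extended by zero to the whole type.\<close>

definition Cc :: "'g topgroupoid \<Rightarrow> ('g \<Rightarrow> complex) set" where
  "Cc G = {f. continuous_map (gtop G) euclidean f \<and> (\<forall>\<gamma>. \<gamma> \<notin> arrows G \<longrightarrow> f \<gamma> = 0) \<and>
    compactin (gtop G) (gtop G closure_of {\<gamma> \<in> arrows G. f \<gamma> \<noteq> 0})}"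

definition dom_fibre :: "'g topgroupoid \<Rightarrow> 'g \<Rightarrow> 'g set" where
  "dom_fibre G x = {\<sigma> \<in> arrows G. gdom G \<sigma> = x}"

text \<open>
  For an etale Hausdorff groupoid, all but finitely many summands of the two infinite sums below
  vanish whenever \<open>f, g \<in> Cc G\<close>.
\<close>

definition convolution ::
  "'g topgroupoid \<Rightarrow> ('g \<Rightarrow> complex) \<Rightarrow> ('g \<Rightarrow> complex) \<Rightarrow> 'g \<Rightarrow> complex" where
  "convolution G f g \<gamma> =
    (if \<gamma> \<in> arrows G
     then \<Sum>\<^sub>\<infinity>\<sigma>\<in>dom_fibre G (gdom G \<gamma>). f (gmult G \<gamma> (ginv G \<sigma>)) * g \<sigma> else 0)"

definition left_reg ::
  "'g topgroupoid \<Rightarrow> 'g \<Rightarrow> ('g \<Rightarrow> complex) \<Rightarrow> ('g \<Rightarrow> complex) \<Rightarrow> 'g \<Rightarrow> complex" where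
  "left_reg G x f \<xi> \<gamma> =
    (if \<gamma> \<in> dom_fibre G x
     then \<Sum>\<^sub>\<infinity>\<sigma>\<in>dom_fibre G x. f (gmult G \<gamma> (ginv G \<sigma>)) * \<xi> \<sigma> else 0)"

definition lp_space :: "real \<Rightarrow> 'b set \<Rightarrow> ('b \<Rightarrow> complex) set" where
  "lp_space p I = {\<xi>. (\<forall>i. i \<notin> I \<longrightarrow> \<xi> i = 0) \<and> (\<lambda>i. norm (\<xi> i) powr p) summable_on I}"

definition lp_norm :: "real \<Rightarrow> 'b set \<Rightarrow> ('b \<Rightarrow> complex) \<Rightarrow> real" where
  "lp_norm p I \<xi> = (\<Sum>\<^sub>\<infinity>i\<in>I. norm (\<xi> i) powr p) powr (1 / p)"

definition lp_opnorm ::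
  "real \<Rightarrow> 'b set \<Rightarrow> (('b \<Rightarrow> complex) \<Rightarrow> 'b \<Rightarrow> complex) \<Rightarrow> real" where
  "lp_opnorm p I T = (SUP \<xi>\<in>{\<xi> \<in> lp_space p I. lp_norm p I \<xi> \<le> 1}. lp_norm p I (T \<xi>))"

text \<open>Inserting 0 changes the supremum only for the empty groupoid.\<close>

definition reduced_norm :: "real \<Rightarrow> 'g topgroupoid \<Rightarrow> ('g \<Rightarrow> complex) \<Rightarrow> real" where
  "reduced_norm p G f =
    Sup (insert 0 ((\<lambda>x. lp_opnorm p (dom_fibre G x) (left_reg G x f)) ` units G))"

text \<open>
  The unit below belongs to \<open>Cc G\<close> because the unit space is compact and, for etale Hausdorff
  groupoids, clopen.
\<close>

definition Cc_algebra :: "real \<Rightarrow> 'g topgroupoid \<Rightarrow> ('g \<Rightarrow> complex) normed_algebra" where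
  "Cc_algebra p G =
    \<lparr> carrier = Cc G,
      monoid.mult = convolution G,
      one = (\<lambda>\<gamma>. if \<gamma> \<in> units G then 1 else 0),
      zero = (\<lambda>\<gamma>. 0),
      add = (\<lambda>f g \<gamma>. f \<gamma> + g \<gamma>),
      smult = (\<lambda>c f \<gamma>. c * f \<gamma>),
      nrm = reduced_norm p G \<rparr>"

definition Fp_lambda ::
  "real \<Rightarrow> 'g topgroupoid \<Rightarrow> (nat \<Rightarrow> 'g \<Rightarrow> complex) set normed_algebra" where
  "Fp_lambda p G = completion (Cc_algebra p G)"

definition Fp_embed ::
  "real \<Rightarrow> 'g topgroupoid \<Rightarrow> ('g \<Rightarrow> complex) \<Rightarrow> (nat \<Rightarrow> 'g \<Rightarrow> complex) set" where
  "Fp_embed p G = completion_embed (Cc_algebra p G)"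

section \<open>The \<open>C\<^sup>*\<close>-core and its spectrum\<close>

definition alg_exp :: "'a normed_algebra \<Rightarrow> 'a \<Rightarrow> 'a" where
  "alg_exp A a = (THE e. e \<in> carrier A \<and>
    (\<lambda>n. nrm A ((\<Oplus>\<^bsub>A\<^esub>k\<in>{..n}. (1 / fact k) \<odot>\<^bsub>A\<^esub> (a [^]\<^bsub>A\<^esub> k)) \<ominus>\<^bsub>A\<^esub> e)) \<longlonglongrightarrow> 0)"

definition hermitians :: "'a normed_algebra \<Rightarrow> 'a set" where
  "hermitians A = {a \<in> carrier A.
    \<forall>t::real. nrm A (alg_exp A ((\<i> * complex_of_real t) \<odot>\<^bsub>A\<^esub> a)) = 1}"

definition core :: "'a normed_algebra \<Rightarrow> 'a set" where
  "core A = {x \<oplus>\<^bsub>A\<^esub> (\<i> \<odot>\<^bsub>A\<^esub> y) | x y. x \<in> hermitians A \<and> y \<in> hermitians A}"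

text \<open>
  \<open>X\<^sub>A\<close> is realised as the Gelfand spectrum of the core, with the topology of pointwise convergence,
  and an element \<open>a\<close> of the core is identified with the function \<open>\<phi> \<mapsto> \<phi> a\<close> on it.
\<close>

definition characters :: "'a normed_algebra \<Rightarrow> ('a \<Rightarrow> complex) set" where
  "characters A = {\<phi> \<in> extensional (core A).
    (\<forall>a\<in>core A. \<forall>b\<in>core A. \<phi> (a \<oplus>\<^bsub>A\<^esub> b) = \<phi> a + \<phi> b \<and> \<phi> (a \<otimes>\<^bsub>A\<^esub> b) = \<phi> a * \<phi> b) \<and>
    (\<forall>c. \<forall>a\<in>core A. \<phi> (c \<odot>\<^bsub>A\<^esub> a) = c * \<phi> a) \<and>
    (\<exists>a\<in>core A. \<phi> a \<noteq> 0)}"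

definition core_spectrum :: "'a normed_algebra \<Rightarrow> ('a \<Rightarrow> complex) topology" where
  "core_spectrum A = subtopology (product_topology (\<lambda>a. euclidean) (core A)) (characters A)"

definition core_pos :: "'a normed_algebra \<Rightarrow> 'a set" where
  "core_pos A = {a \<in> core A. \<forall>\<phi>\<in>characters A. \<phi> a \<in> \<real>\<^sub>\<ge>\<^sub>0}"

text \<open>
  The copy of \<open>C\<^sub>0(V)\<close> in \<open>C(X\<^sub>A)\<close>: as \<open>X\<^sub>A\<close> is compact, the extensions by zero of functions in
  \<open>C\<^sub>0(V)\<close> are the continuous functions on \<open>X\<^sub>A\<close> that vanish outside the open set \<open>V\<close>.
\<close>

definition core_C0 :: "'a normed_algebra \<Rightarrow> ('a \<Rightarrow> complex) set \<Rightarrow> 'a set" where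
  "core_C0 A V = {a \<in> core A. \<forall>\<phi>\<in>characters A - V. \<phi> a = 0}"

section \<open>Partial homeomorphisms, germs and the Weyl groupoid\<close>

definition partial_homeos :: "'x topology \<Rightarrow> ('x \<rightharpoonup> 'x) set" where
  "partial_homeos X = {s. openin X (dom s) \<and> openin X (ran s) \<and>
    homeomorphic_map (subtopology X (dom s)) (subtopology X (ran s)) (the \<circ> s)}"

definition pinv :: "('x \<rightharpoonup> 'x) \<Rightarrow> ('x \<rightharpoonup> 'x)" where
  "pinv s = (\<lambda>y. if y \<in> ran s then Some (THE x. s x = Some y) else None)"

text \<open>By the first condition, \<open>\<phi> (b \<otimes> a)\<close> and \<open>\<phi> (a \<otimes> b)\<close> are real and nonnegative.\<close>

definition realized_by :: "'a normed_algebra \<Rightarrow> (('a \<Rightarrow> complex) \<rightharpoonup> ('a \<Rightarrow> complex)) \<Rightarrow> 'a \<Rightarrow> 'a \<Rightarrow> bool" where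
  "realized_by A \<alpha> a b \<longleftrightarrow>
    (\<forall>f\<in>core_pos A. a \<otimes>\<^bsub>A\<^esub> f \<otimes>\<^bsub>A\<^esub> b \<in> core_pos A \<and> b \<otimes>\<^bsub>A\<^esub> f \<otimes>\<^bsub>A\<^esub> a \<in> core_pos A) \<and>
    dom \<alpha> = {x \<in> characters A. Re (x (b \<otimes>\<^bsub>A\<^esub> a)) > 0} \<and>
    ran \<alpha> = {x \<in> characters A. Re (x (a \<otimes>\<^bsub>A\<^esub> b)) > 0} \<and>
    (\<forall>x\<in>dom \<alpha>. \<forall>f\<in>core_C0 A (ran \<alpha>).
      the (\<alpha> x) f * x (b \<otimes>\<^bsub>A\<^esub> a) = x (b \<otimes>\<^bsub>A\<^esub> f \<otimes>\<^bsub>A\<^esub> a)) \<and>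
    (\<forall>y\<in>ran \<alpha>. \<forall>g\<in>core_C0 A (dom \<alpha>).
      the (pinv \<alpha> y) g * y (a \<otimes>\<^bsub>A\<^esub> b) = y (a \<otimes>\<^bsub>A\<^esub> g \<otimes>\<^bsub>A\<^esub> b))"

definition realizable_homeos ::
  "'a normed_algebra \<Rightarrow> (('a \<Rightarrow> complex) \<rightharpoonup> ('a \<Rightarrow> complex)) set" where
  "realizable_homeos A = {\<alpha> \<in> partial_homeos (core_spectrum A).
    \<exists>a\<in>carrier A. \<exists>b\<in>carrier A. realized_by A \<alpha> a b}"

text \<open>
  The class \<open>[s, x]\<close>. The formula also makes sense for a partial map \<open>s\<close> outside of \<open>S\<close>; the class is
  nonempty iff \<open>s\<close> agrees near \<open>x\<close> with a member of \<open>S\<close> defined at \<open>x\<close>.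
\<close>

definition germ ::
  "'x topology \<Rightarrow> ('x \<rightharpoonup> 'x) set \<Rightarrow> ('x \<rightharpoonup> 'x) \<Rightarrow> 'x \<Rightarrow> (('x \<rightharpoonup> 'x) \<times> 'x) set" where
  "germ X S s x = {(t, y). t \<in> S \<and> y = x \<and> x \<in> dom t \<and>
    (\<exists>W. openin X W \<and> x \<in> W \<and> (\<forall>w\<in>W. s w = t w))}"

definition germ_groupoid ::
  "'x topology \<Rightarrow> ('x \<rightharpoonup> 'x) set \<Rightarrow> (('x \<rightharpoonup> 'x) \<times> 'x) set topgroupoid" where
  "germ_groupoid X S =
    \<lparr> gtop = topology_generated_by
        {{germ X S s x | x. x \<in> dom s \<and> x \<in> U \<and> the (s x) \<in> V} | s U V.
          s \<in> S \<and> openin X U \<and> openin X V},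
      gmult = (\<lambda>P Q. case (rep P, rep Q) of ((s, x), (t, y)) \<Rightarrow> germ X S (s \<circ>\<^sub>m t) y),
      ginv = (\<lambda>P. case rep P of (s, x) \<Rightarrow> germ X S (pinv s) (the (s x))) \<rparr>"

definition weyl_groupoid ::
  "'a normed_algebra \<Rightarrow>
    ((('a \<Rightarrow> complex) \<rightharpoonup> ('a \<Rightarrow> complex)) \<times> ('a \<Rightarrow> complex)) set topgroupoid" where
  "weyl_groupoid A = germ_groupoid (core_spectrum A) (realizable_homeos A)"

section \<open>Naturality\<close>

definition open_bisection :: "'g topgroupoid \<Rightarrow> 'g set \<Rightarrow> bool" where
  "open_bisection G B \<longleftrightarrow> openin (gtop G) B \<and> inj_on (gdom G) B \<and> inj_on (gran G) B"

text \<open>The partial homeomorphism \<open>gdom \<beta> \<mapsto> gran \<beta>\<close> (\<open>\<beta> \<in> B\<close>) of the unit space.\<close>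

definition bisection_map :: "'g topgroupoid \<Rightarrow> 'g set \<Rightarrow> ('g \<rightharpoonup> 'g)" where
  "bisection_map G B =
    (\<lambda>x. if x \<in> gdom G ` B then Some (gran G (inv_into B (gdom G) x)) else None)"

definition transport :: "'y set \<Rightarrow> ('y \<Rightarrow> 'x) \<Rightarrow> ('y \<rightharpoonup> 'y) \<Rightarrow> ('x \<rightharpoonup> 'x)" where
  "transport Y h s =
    (\<lambda>x. if x \<in> h ` Y then map_option h (s (inv_into Y h x)) else None)"

text \<open>
  The canonical identification of the unit space with the spectrum of the core of \<open>F\<^sup>p\<^sub>\<lambda>(G)\<close>: a unit
  \<open>x\<close> corresponds to the evaluation at \<open>x\<close> of the functions in \<open>C(units G) \<subseteq> Cc G\<close>.
\<close>

definition unit_space_identification ::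
  "real \<Rightarrow> 'g topgroupoid \<Rightarrow> ('g \<Rightarrow> (nat \<Rightarrow> 'g \<Rightarrow> complex) set \<Rightarrow> complex) \<Rightarrow> bool" where
  "unit_space_identification p G h \<longleftrightarrow>
    homeomorphic_map (unit_space G) (core_spectrum (Fp_lambda p G)) h \<and>
    (\<forall>x\<in>units G. \<forall>f\<in>Cc G. (\<forall>\<gamma>. f \<gamma> \<noteq> 0 \<longrightarrow> \<gamma> \<in> units G) \<longrightarrow> h x (Fp_embed p G f) = f x)"

text \<open>
  An isomorphism from \<open>G\<close> to the Weyl groupoid of \<open>F\<^sup>p\<^sub>\<lambda>(G)\<close> is natural if, under this
  identification, it sends \<open>\<gamma>\<close> to the germ at \<open>gdom \<gamma>\<close> of the partial homeomorphism given by any open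
  bisection containing \<open>\<gamma>\<close>. This determines it uniquely.
\<close>

definition natural_weyl_map ::
  "real \<Rightarrow> 'g topgroupoid \<Rightarrow>
    ('g \<Rightarrow> ((((nat \<Rightarrow> 'g \<Rightarrow> complex) set \<Rightarrow> complex) \<rightharpoonup> ((nat \<Rightarrow> 'g \<Rightarrow> complex) set \<Rightarrow> complex))
      \<times> ((nat \<Rightarrow> 'g \<Rightarrow> complex) set \<Rightarrow> complex)) set) \<Rightarrow> bool" where
  "natural_weyl_map p G \<Phi> \<longleftrightarrow>
    (\<exists>h. unit_space_identification p G h \<and>
      (\<forall>\<gamma> B. open_bisection G B \<and> \<gamma> \<in> B \<longrightarrow>
        \<Phi> \<gamma> = germ (core_spectrum (Fp_lambda p G)) (realizable_homeos (Fp_lambda p G))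
          (transport (units G) h (bisection_map G B)) (h (gdom G \<gamma>))))"

end

theory Submission
  imports Defs
begin

text \<open>
  Write \<open>A\<close> for the reduced algebra. Elements of \<open>A\<close> are functions on \<open>G\<close>, since an operator on \<open>\<ell>\<^sup>p\<close> is
  determined by its matrix entries. If \<open>a\<close> is hermitian, then the isometries \<open>exp(ita)\<close> fix the norm of
  vectors supported at two points to first order, and for \<open>p \<noteq> 2\<close> this forces the off-diagonal
  entries of \<open>a\<close> to vanish; hence the core of \<open>A\<close> is \<open>C(units G)\<close> and its spectrum is the unit space.

  If \<open>\<alpha>\<close> is realized by \<open>a, b\<close>, then for \<open>x\<close> in the domain of \<open>\<alpha>\<close> the measure
  \<open>\<Sum>\<^sub>\<sigma> b(\<sigma>\<^sup>-\<^sup>1) a(\<sigma>) \<delta>\<^bsub>ran \<sigma>\<^esub>\<close> over the arrows \<open>\<sigma>\<close> with domain \<open>x\<close> is, on the range of \<open>\<alpha>\<close>, a multiple of the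
  point mass at \<open>\<alpha>(x)\<close>. So some \<open>\<sigma>\<close> ends at \<open>\<alpha>(x)\<close> with \<open>b(\<sigma>\<^sup>-\<^sup>1) a(\<sigma>) \<noteq> 0\<close>, and an open bisection through
  \<open>\<sigma>\<close> on which this product does not vanish agrees with \<open>\<alpha>\<close> at the units with trivial isotropy, hence, by
  density, on its whole domain. Conversely, a bump function \<open>a\<close> on a bisection and
  \<open>b(\<gamma>) = a(\<gamma>\<^sup>-\<^sup>1)\<close> realize the partial homeomorphism of the bisection. Therefore the germs of realizable
  partial homeomorphisms are the germs of bisections, and these are the arrows of \<open>G\<close>, again because
  \<open>G\<close> is topologically principal and Hausdorff.
\<close>

section \<open>Completions of normed algebras\<close>

text \<open>An element of the completion is only a class of Cauchy sequences, not an operator. What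
  survives the limit are its matrix entries, together with a bound on all finite sections of the
  matrix; hence norms are read off finite sections throughout, and the functionals applied to
  exponentials are matrix entries. The condition p \<noteq> 2 enters through a single number:
  comparing test vectors with moduli (1, 1) and (1, 2) yields the factor
  \<open>2 powr (p - 2)\<close>, which differs from 1 exactly when p \<noteq> 2. Elements a, b that
  realize a partial homeomorphism can have large support, and then their convolution is an infinite
  sum. Pairing a row of b with a column of a still converges absolutely, which gives meaning to the
  measure of the overview; bump functions isolate its atoms. The realizing condition places b f a in
  the core for positive f, so these test functions are taken positive. The empty groupoid has the
  zero algebra, in which nothing is hermitian; this is why several facts assume that there are
  units.\<close>

locale nonassoc_normed_algebra = abelian_group N for N :: "'a normed_algebra" (structure) +
  assumes mult_closed: "x \<in> carrier N \<Longrightarrow> y \<in> carrier N \<Longrightarrow> x \<otimes> y \<in> carrier N"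
    and one_closed: "\<one> \<in> carrier N"
    and smult_closed: "x \<in> carrier N \<Longrightarrow> c \<odot>\<^bsub>N\<^esub> x \<in> carrier N"
    and l_one: "x \<in> carrier N \<Longrightarrow> \<one> \<otimes> x = x"
    and r_one: "x \<in> carrier N \<Longrightarrow> x \<otimes> \<one> = x"
    and l_distr: "x \<in> carrier N \<Longrightarrow> y \<in> carrier N \<Longrightarrow> z \<in> carrier N \<Longrightarrow>
      (x \<oplus> y) \<otimes> z = x \<otimes> z \<oplus> y \<otimes> z"
    and r_distr: "x \<in> carrier N \<Longrightarrow> y \<in> carrier N \<Longrightarrow> z \<in> carrier N \<Longrightarrow>
      z \<otimes> (x \<oplus> y) = z \<otimes> x \<oplus> z \<otimes> y"
    and smult_r_distr: "x \<in> carrier N \<Longrightarrow> y \<in> carrier N \<Longrightarrow>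
      c \<odot>\<^bsub>N\<^esub> (x \<oplus> y) = c \<odot>\<^bsub>N\<^esub> x \<oplus> c \<odot>\<^bsub>N\<^esub> y"
    and smult_l_distr: "x \<in> carrier N \<Longrightarrow> (c + d) \<odot>\<^bsub>N\<^esub> x = c \<odot>\<^bsub>N\<^esub> x \<oplus> d \<odot>\<^bsub>N\<^esub> x"
    and smult_one: "x \<in> carrier N \<Longrightarrow> 1 \<odot>\<^bsub>N\<^esub> x = x"
    and nrm_nonneg: "x \<in> carrier N \<Longrightarrow> 0 \<le> nrm N x"
    and nrm_triangle: "x \<in> carrier N \<Longrightarrow> y \<in> carrier N \<Longrightarrow> nrm N (x \<oplus> y) \<le> nrm N x + nrm N y"
    and nrm_smult: "x \<in> carrier N \<Longrightarrow> nrm N (c \<odot>\<^bsub>N\<^esub> x) = norm c * nrm N x"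
    and nrm_mult: "x \<in> carrier N \<Longrightarrow> y \<in> carrier N \<Longrightarrow> nrm N (x \<otimes> y) \<le> nrm N x * nrm N y"
begin

lemma smult_zero:
  assumes "x \<in> carrier N" shows "0 \<odot>\<^bsub>N\<^esub> x = \<zero>"
proof -
  have "0 \<odot>\<^bsub>N\<^esub> x \<oplus> 0 \<odot>\<^bsub>N\<^esub> x = 0 \<odot>\<^bsub>N\<^esub> x"
    using smult_l_distr[OF assms, of 0 0] by simp
  then show ?thesis
    using add.l_cancel_one[OF smult_closed[OF assms] smult_closed[OF assms]] by blast
qed

lemma smult_minus_one:
  assumes "x \<in> carrier N" shows "(-1) \<odot>\<^bsub>N\<^esub> x = \<ominus> x"
proof -
  have "(-1) \<odot>\<^bsub>N\<^esub> x \<oplus> x = \<zero>"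
    using smult_l_distr[OF assms, of "-1" 1] smult_one[OF assms] smult_zero[OF assms] by simp
  then show ?thesis
    using minus_equality[OF _ assms smult_closed[OF assms]] by metis
qed

lemma nrm_zero: "nrm N \<zero> = 0"
  using nrm_smult[OF zero_closed, of 0] smult_zero[OF zero_closed] by simp

lemma nrm_minus: "x \<in> carrier N \<Longrightarrow> nrm N (\<ominus> x) = nrm N x"
  using nrm_smult[of x "-1"] smult_minus_one by simp

section \<open>The distance given by the norm\<close>

definition "gap x y = nrm N (x \<ominus> y)"

lemma gap_nonneg: "x \<in> carrier N \<Longrightarrow> y \<in> carrier N \<Longrightarrow> 0 \<le> gap x y"
  by (simp add: gap_def nrm_nonneg)

lemma gap_self: "x \<in> carrier N \<Longrightarrow> gap x x = 0"
  by (simp add: gap_def a_minus_def r_neg nrm_zero)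

lemma gap_commute:
  assumes "x \<in> carrier N" "y \<in> carrier N" shows "gap x y = gap y x"
proof -
  have "x \<ominus> y = \<ominus> (y \<ominus> x)"
    using assms by (simp add: a_minus_def minus_add a_comm)
  then show ?thesis
    using nrm_minus[of "y \<ominus> x"] assms by (simp add: gap_def)
qed

lemma gap_triangle:
  assumes "x \<in> carrier N" "y \<in> carrier N" "z \<in> carrier N"
  shows "gap x z \<le> gap x y + gap y z"
proof -
  have "x \<ominus> z = (x \<ominus> y) \<oplus> (y \<ominus> z)"
    using assms by (simp add: a_minus_def a_assoc) (simp add: r_neg1)
  then show ?thesis
    using nrm_triangle[of "x \<ominus> y" "y \<ominus> z"] assms by (simp add: gap_def)
qed

lemma gap_zero: "x \<in> carrier N \<Longrightarrow> gap x \<zero> = nrm N x"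
  by (metis gap_def a_minus_def r_neg l_zero r_zero zero_closed a_inv_closed)

lemma nrm_diff_le:
  assumes "x \<in> carrier N" "y \<in> carrier N" shows "\<bar>nrm N x - nrm N y\<bar> \<le> gap x y"
  using gap_triangle[of x y \<zero>] gap_triangle[of y x \<zero>] gap_commute[of x y] assms
  by (simp add: gap_zero)

lemma gap_add:
  assumes "x \<in> carrier N" "y \<in> carrier N" "x' \<in> carrier N" "y' \<in> carrier N"
  shows "gap (x \<oplus> x') (y \<oplus> y') \<le> gap x y + gap x' y'"
proof -
  have "(x \<oplus> x') \<ominus> (y \<oplus> y') = (x \<ominus> y) \<oplus> (x' \<ominus> y')"
    using assms by (simp add: a_minus_def minus_add a_ac)
  then show ?thesis
    using nrm_triangle[of "x \<ominus> y" "x' \<ominus> y'"] assms by (simp add: gap_def)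
qed

lemma smult_minus_right:
  assumes "x \<in> carrier N" shows "c \<odot>\<^bsub>N\<^esub> (\<ominus> x) = \<ominus> (c \<odot>\<^bsub>N\<^esub> x)"
proof -
  have "c \<odot>\<^bsub>N\<^esub> (\<ominus> x) \<oplus> c \<odot>\<^bsub>N\<^esub> x = c \<odot>\<^bsub>N\<^esub> \<zero>"
    using smult_r_distr[of "\<ominus> x" x c] assms by (simp add: l_neg)
  moreover have "c \<odot>\<^bsub>N\<^esub> \<zero> = \<zero>"
    using smult_r_distr[of \<zero> \<zero> c] add.l_cancel_one[of "c \<odot>\<^bsub>N\<^esub> \<zero>" "c \<odot>\<^bsub>N\<^esub> \<zero>"]
    by (simp add: smult_closed)
  ultimately show ?thesis
    using minus_equality assms by (metis a_inv_closed smult_closed)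
qed

lemma mult_minus_left:
  assumes "x \<in> carrier N" "y \<in> carrier N" shows "(\<ominus> x) \<otimes> y = \<ominus> (x \<otimes> y)"
proof -
  have "\<zero> \<otimes> y = \<zero>"
    using l_distr[of \<zero> \<zero> y] assms add.l_cancel_one[of "\<zero> \<otimes> y" "\<zero> \<otimes> y"]
    by (simp add: mult_closed)
  then have "(\<ominus> x) \<otimes> y \<oplus> x \<otimes> y = \<zero>"
    using l_distr[of "\<ominus> x" x y] assms by (simp add: l_neg)
  then show ?thesis
    using minus_equality assms by (metis a_inv_closed mult_closed)
qed

lemma mult_minus_right:
  assumes "x \<in> carrier N" "y \<in> carrier N" shows "y \<otimes> (\<ominus> x) = \<ominus> (y \<otimes> x)"
proof -
  have "y \<otimes> \<zero> = \<zero>"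
    using r_distr[of \<zero> \<zero> y] assms add.l_cancel_one[of "y \<otimes> \<zero>" "y \<otimes> \<zero>"]
    by (simp add: mult_closed)
  then have "y \<otimes> (\<ominus> x) \<oplus> y \<otimes> x = \<zero>"
    using r_distr[of "\<ominus> x" x y] assms by (simp add: l_neg)
  then show ?thesis
    using minus_equality assms by (metis a_inv_closed mult_closed)
qed

lemma gap_smult:
  assumes "x \<in> carrier N" "y \<in> carrier N"
  shows "gap (c \<odot>\<^bsub>N\<^esub> x) (c \<odot>\<^bsub>N\<^esub> y) = norm c * gap x y"
proof -
  have "c \<odot>\<^bsub>N\<^esub> x \<ominus> c \<odot>\<^bsub>N\<^esub> y = c \<odot>\<^bsub>N\<^esub> (x \<ominus> y)"
    using assms by (simp add: a_minus_def smult_r_distr smult_minus_right)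
  then show ?thesis
    using nrm_smult assms by (simp add: gap_def)
qed

text \<open>Split \<open>x \<otimes> x' \<ominus> y \<otimes> y'\<close> as \<open>(x \<ominus> y)
  \<otimes> x' \<oplus> y \<otimes> (x' \<ominus> y')\<close>. The asymmetric bound lets each
  difference be multiplied by a norm that stays bounded along Cauchy sequences.\<close>

lemma gap_mult:
  assumes "x \<in> carrier N" "y \<in> carrier N" "x' \<in> carrier N" "y' \<in> carrier N"
  shows "gap (x \<otimes> x') (y \<otimes> y') \<le> gap x y * nrm N x' + nrm N y * gap x' y'"
proof -
  have "gap (x \<otimes> x') (y \<otimes> y') \<le> gap (x \<otimes> x') (y \<otimes> x') + gap (y \<otimes> x') (y \<otimes> y')"
    by (intro gap_triangle mult_closed assms)
  moreover have "x \<otimes> x' \<ominus> y \<otimes> x' = (x \<ominus> y) \<otimes> x'"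
    using assms by (simp add: a_minus_def l_distr mult_minus_left)
  moreover have "y \<otimes> x' \<ominus> y \<otimes> y' = y \<otimes> (x' \<ominus> y')"
    using assms by (simp add: a_minus_def r_distr mult_minus_right)
  ultimately show ?thesis
    using nrm_mult[of "x \<ominus> y" x'] nrm_mult[of y "x' \<ominus> y'"] assms by (simp add: gap_def)
qed

section \<open>Cauchy sequences modulo null sequences\<close>

lemma cauchy_seqs_iff:
  "X \<in> cauchy_seqs N \<longleftrightarrow> (\<forall>n. X n \<in> carrier N) \<and> (\<forall>e>0. \<exists>M. \<forall>m\<ge>M. \<forall>n\<ge>M. gap (X m) (X n) < e)"
  by (auto simp: cauchy_seqs_def gap_def)

lemma null_rel_iff:
  "(X, Y) \<in> null_rel N \<longleftrightarrow>
    X \<in> cauchy_seqs N \<and> Y \<in> cauchy_seqs N \<and> (\<lambda>n. gap (X n) (Y n)) \<longlonglongrightarrow> 0"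
  by (auto simp: null_rel_def gap_def)

lemma cauchy_seqs_carrier: "X \<in> cauchy_seqs N \<Longrightarrow> X n \<in> carrier N"
  by (simp add: cauchy_seqs_iff)

lemma cauchy_seqsI:
  assumes "\<And>n. X n \<in> carrier N"
    and "\<And>e. e > 0 \<Longrightarrow> \<exists>M. \<forall>m\<ge>M. \<forall>n\<ge>M. gap (X m) (X n) < e"
  shows "X \<in> cauchy_seqs N"
  using assms by (simp add: cauchy_seqs_iff)

lemma cauchy_seqsD:
  assumes "X \<in> cauchy_seqs N" "e > 0"
  obtains M where "\<And>m n. m \<ge> M \<Longrightarrow> n \<ge> M \<Longrightarrow> gap (X m) (X n) < e"
  using assms unfolding cauchy_seqs_iff by blast

lemma cauchy_seqs_const: "a \<in> carrier N \<Longrightarrow> (\<lambda>n. a) \<in> cauchy_seqs N"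
  by (rule cauchy_seqsI) (auto simp: gap_self)

lemma cauchy_seqs_add:
  assumes X: "X \<in> cauchy_seqs N" and Y: "Y \<in> cauchy_seqs N"
  shows "(\<lambda>n. X n \<oplus> Y n) \<in> cauchy_seqs N"
proof (rule cauchy_seqsI)
  fix e :: real assume "e > 0"
  obtain M1 where M1: "\<And>m n. m \<ge> M1 \<Longrightarrow> n \<ge> M1 \<Longrightarrow> gap (X m) (X n) < e / 2"
    using cauchy_seqsD[OF X, of "e/2"] \<open>e > 0\<close> by auto
  obtain M2 where M2: "\<And>m n. m \<ge> M2 \<Longrightarrow> n \<ge> M2 \<Longrightarrow> gap (Y m) (Y n) < e / 2"
    using cauchy_seqsD[OF Y, of "e/2"] \<open>e > 0\<close> by auto
  have "gap (X m \<oplus> Y m) (X n \<oplus> Y n) < e" if "m \<ge> max M1 M2" "n \<ge> max M1 M2" for m n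
    using gap_add[of "X m" "X n" "Y m" "Y n"] M1[of m n] M2[of m n] that
      cauchy_seqs_carrier[OF X] cauchy_seqs_carrier[OF Y] by fastforce
  then show "\<exists>M. \<forall>m\<ge>M. \<forall>n\<ge>M. gap (X m \<oplus> Y m) (X n \<oplus> Y n) < e" by blast
qed (use cauchy_seqs_carrier[OF X] cauchy_seqs_carrier[OF Y] in auto)

lemma cauchy_seqs_smult:
  assumes X: "X \<in> cauchy_seqs N"
  shows "(\<lambda>n. c \<odot>\<^bsub>N\<^esub> X n) \<in> cauchy_seqs N"
proof (rule cauchy_seqsI)
  fix e :: real assume "e > 0"
  then obtain M where M: "\<And>m n. m \<ge> M \<Longrightarrow> n \<ge> M \<Longrightarrow> gap (X m) (X n) < e / (norm c + 1)"
    using cauchy_seqsD[OF X, of "e / (norm c + 1)"] by (auto simp: add_nonneg_pos)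
  have "gap (c \<odot>\<^bsub>N\<^esub> X m) (c \<odot>\<^bsub>N\<^esub> X n) < e" if "m \<ge> M" "n \<ge> M" for m n
  proof -
    have "norm c * gap (X m) (X n) \<le> (norm c + 1) * gap (X m) (X n)"
      using gap_nonneg[of "X m" "X n"] cauchy_seqs_carrier[OF X] by (simp add: algebra_simps)
    also have "\<dots> < e"
      using M[OF that] by (simp add: pos_less_divide_eq add_nonneg_pos mult.commute)
    finally show ?thesis
      using cauchy_seqs_carrier[OF X] by (simp add: gap_smult)
  qed
  then show "\<exists>M. \<forall>m\<ge>M. \<forall>n\<ge>M. gap (c \<odot>\<^bsub>N\<^esub> X m) (c \<odot>\<^bsub>N\<^esub> X n) < e" by blast
qed (use cauchy_seqs_carrier[OF X] smult_closed in auto)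

lemma cauchy_seqs_minus:
  assumes X: "X \<in> cauchy_seqs N"
  shows "(\<lambda>n. \<ominus> X n) \<in> cauchy_seqs N"
  using cauchy_seqs_smult[OF X, of "-1"] smult_minus_one cauchy_seqs_carrier[OF X] by simp

lemma cauchy_seqs_nrm_convergent:
  assumes X: "X \<in> cauchy_seqs N"
  shows "convergent (\<lambda>n. nrm N (X n))"
proof -
  have "Cauchy (\<lambda>n. nrm N (X n))"
  proof (rule CauchyI)
    fix e :: real assume "e > 0"
    then obtain M where M: "\<And>m n. m \<ge> M \<Longrightarrow> n \<ge> M \<Longrightarrow> gap (X m) (X n) < e"
      using cauchy_seqsD[OF X, of e] by blast
    then have "norm (nrm N (X m) - nrm N (X n)) < e" if "m \<ge> M" "n \<ge> M" for m n
      using nrm_diff_le[of "X m" "X n"] cauchy_seqs_carrier[OF X] that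
      by (metis le_less_trans real_norm_def)
    then show "\<exists>M. \<forall>m\<ge>M. \<forall>n\<ge>M. norm (nrm N (X m) - nrm N (X n)) < e" by blast
  qed
  then show ?thesis by (rule Cauchy_convergent)
qed

lemma cauchy_seqs_bounded:
  assumes X: "X \<in> cauchy_seqs N"
  obtains B where "B > 0" "\<And>n. nrm N (X n) \<le> B"
proof -
  have "Bseq (\<lambda>n. nrm N (X n))"
    using cauchy_seqs_nrm_convergent[OF X] by (rule convergent_imp_Bseq)
  then obtain B where B: "B > 0" "\<forall>n. norm (nrm N (X n)) \<le> B"
    unfolding Bseq_def by blast
  show thesis using that[OF B(1)] B(2) by (metis abs_le_D1 real_norm_def)
qed

lemma cauchy_seqs_mult:
  assumes X: "X \<in> cauchy_seqs N" and Y: "Y \<in> cauchy_seqs N"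
  shows "(\<lambda>n. X n \<otimes> Y n) \<in> cauchy_seqs N"
proof (rule cauchy_seqsI)
  obtain B1 where B1: "B1 > 0" "\<And>n. nrm N (X n) \<le> B1" using cauchy_seqs_bounded[OF X] by blast
  obtain B2 where B2: "B2 > 0" "\<And>n. nrm N (Y n) \<le> B2" using cauchy_seqs_bounded[OF Y] by blast
  fix e :: real assume "e > 0"
  obtain M1 where M1: "\<And>m n. m \<ge> M1 \<Longrightarrow> n \<ge> M1 \<Longrightarrow> gap (X m) (X n) < e / (2 * B2)"
    using cauchy_seqsD[OF X, of "e / (2 * B2)"] \<open>e > 0\<close> B2 by auto
  obtain M2 where M2: "\<And>m n. m \<ge> M2 \<Longrightarrow> n \<ge> M2 \<Longrightarrow> gap (Y m) (Y n) < e / (2 * B1)"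
    using cauchy_seqsD[OF Y, of "e / (2 * B1)"] \<open>e > 0\<close> B1 by auto
  have "gap (X m \<otimes> Y m) (X n \<otimes> Y n) < e" if "m \<ge> max M1 M2" "n \<ge> max M1 M2" for m n
  proof -
    note c = cauchy_seqs_carrier[OF X] cauchy_seqs_carrier[OF Y]
    have "gap (X m) (X n) * nrm N (Y m) \<le> gap (X m) (X n) * B2"
      using B2 gap_nonneg c by (intro mult_left_mono) auto
    moreover have "gap (X m) (X n) * B2 < e / 2"
      using M1[of m n] that B2 by (simp add: pos_less_divide_eq)
    moreover have "nrm N (X n) * gap (Y m) (Y n) \<le> B1 * gap (Y m) (Y n)"
      using B1 gap_nonneg c by (intro mult_right_mono) auto
    moreover have "B1 * gap (Y m) (Y n) < e / 2"
      using M2[of m n] that B1 by (simp add: pos_less_divide_eq mult.commute)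
    ultimately show ?thesis
      using gap_mult[of "X m" "X n" "Y m" "Y n"] c by fastforce
  qed
  then show "\<exists>M. \<forall>m\<ge>M. \<forall>n\<ge>M. gap (X m \<otimes> Y m) (X n \<otimes> Y n) < e" by blast
qed (use cauchy_seqs_carrier[OF X] cauchy_seqs_carrier[OF Y] mult_closed in auto)

lemma null_relI:
  assumes "X \<in> cauchy_seqs N" "Y \<in> cauchy_seqs N" "\<And>n. gap (X n) (Y n) \<le> f n" "f \<longlonglongrightarrow> 0"
  shows "(X, Y) \<in> null_rel N"
  unfolding null_rel_iff
proof (intro conjI assms(1,2))
  show "(\<lambda>n. gap (X n) (Y n)) \<longlonglongrightarrow> 0"
    by (rule tendsto_sandwich[OF _ _ tendsto_const assms(4)])
      (auto intro!: always_eventually assms(3) gap_nonneg cauchy_seqs_carrier assms(1,2))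
qed

lemma null_rel_refl: "X \<in> cauchy_seqs N \<Longrightarrow> (X, X) \<in> null_rel N"
  by (simp add: null_rel_iff gap_self cauchy_seqs_carrier)

lemma equiv_null_rel: "equiv (cauchy_seqs N) (null_rel N)"
proof (rule equivI)
  show "null_rel N \<subseteq> cauchy_seqs N \<times> cauchy_seqs N" by (auto simp: null_rel_iff)
  show "refl_on (cauchy_seqs N) (null_rel N)"
    by (auto simp: refl_on_def null_rel_refl)
  show "sym (null_rel N)"
    by (rule symI) (auto simp: null_rel_iff gap_commute cauchy_seqs_carrier)
  show "trans (null_rel N)"
  proof (rule transI)
    fix X Y Z assume XY: "(X, Y) \<in> null_rel N" and YZ: "(Y, Z) \<in> null_rel N"
    show "(X, Z) \<in> null_rel N"
    proof (rule null_relI)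
      show "(\<lambda>n. gap (X n) (Y n) + gap (Y n) (Z n)) \<longlonglongrightarrow> 0"
        using XY YZ tendsto_add[of "\<lambda>n. gap (X n) (Y n)" 0 _ "\<lambda>n. gap (Y n) (Z n)" 0]
        by (simp add: null_rel_iff)
    qed (use XY YZ in \<open>auto simp: null_rel_iff intro: gap_triangle cauchy_seqs_carrier\<close>)
  qed
qed

abbreviation cls where "cls \<equiv> cauchy_class N"

lemma cls_eq_iff:
  "X \<in> cauchy_seqs N \<Longrightarrow> Y \<in> cauchy_seqs N \<Longrightarrow> cls X = cls Y \<longleftrightarrow> (X, Y) \<in> null_rel N"
  unfolding cauchy_class_def by (rule eq_equiv_class_iff[OF equiv_null_rel])

lemma cls_eqI: "(X, Y) \<in> null_rel N \<Longrightarrow> cls X = cls Y"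
  using cls_eq_iff by (auto simp: null_rel_iff)

lemma carrier_completion: "carrier (completion N) = cls ` cauchy_seqs N"
  by (auto simp: completion_def quotient_def cauchy_class_def)

lemma cls_carrier: "X \<in> cauchy_seqs N \<Longrightarrow> cls X \<in> carrier (completion N)"
  by (simp add: carrier_completion)

lemma completion_cases:
  assumes "P \<in> carrier (completion N)"
  obtains X where "X \<in> cauchy_seqs N" "P = cls X"
  using assms by (auto simp: carrier_completion)

text \<open>The operations of \<open>completion\<close> act on a representative picked by
  \<open>SOME\<close>. All that is known of it is that it differs from the given one by a null
  sequence, so every formula for \<open>cls\<close> below is a proof of independence of
  representatives.\<close>

lemma rep_cls:
  assumes "X \<in> cauchy_seqs N" shows "(rep (cls X), X) \<in> null_rel N"
proof -
  have "X \<in> cls X" using null_rel_refl[OF assms] by (simp add: cauchy_class_def)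
  then have "rep (cls X) \<in> cls X" unfolding rep_def by (rule someI[of "\<lambda>Y. Y \<in> cls X"])
  then have "(X, rep (cls X)) \<in> null_rel N" by (simp add: cauchy_class_def)
  then show ?thesis using equiv_null_rel by (meson equivE symD)
qed

lemma cls_add:
  assumes X: "X \<in> cauchy_seqs N" and Y: "Y \<in> cauchy_seqs N"
  shows "cls X \<oplus>\<^bsub>completion N\<^esub> cls Y = cls (\<lambda>n. X n \<oplus> Y n)"
proof -
  let ?X = "rep (cls X)" and ?Y = "rep (cls Y)"
  have r: "(?X, X) \<in> null_rel N" "(?Y, Y) \<in> null_rel N" using rep_cls X Y by auto
  then have c: "?X \<in> cauchy_seqs N" "?Y \<in> cauchy_seqs N" by (auto simp: null_rel_iff)
  have "(\<lambda>n. ?X n \<oplus> ?Y n, \<lambda>n. X n \<oplus> Y n) \<in> null_rel N"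
  proof (rule null_relI)
    show "(\<lambda>n. gap (?X n) (X n) + gap (?Y n) (Y n)) \<longlonglongrightarrow> 0"
      using r by (auto simp: null_rel_iff intro: tendsto_add_zero)
  qed (use c X Y in \<open>auto intro: cauchy_seqs_add gap_add cauchy_seqs_carrier\<close>)
  then show ?thesis using cls_eqI by (simp add: completion_def)
qed

text \<open>Independence of representatives: in \<open>gap_mult\<close> each summand is a null
  sequence times a sequence of norms, and the norms of a Cauchy sequence converge.\<close>

lemma cls_mult:
  assumes X: "X \<in> cauchy_seqs N" and Y: "Y \<in> cauchy_seqs N"
  shows "cls X \<otimes>\<^bsub>completion N\<^esub> cls Y = cls (\<lambda>n. X n \<otimes> Y n)"
proof -
  let ?X = "rep (cls X)" and ?Y = "rep (cls Y)"
  have r: "(?X, X) \<in> null_rel N" "(?Y, Y) \<in> null_rel N" using rep_cls X Y by auto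
  then have c: "?X \<in> cauchy_seqs N" "?Y \<in> cauchy_seqs N" by (auto simp: null_rel_iff)
  obtain L1 where L1: "(\<lambda>n. nrm N (?Y n)) \<longlonglongrightarrow> L1"
    using cauchy_seqs_nrm_convergent[OF c(2)] by (auto simp: convergent_def)
  obtain L2 where L2: "(\<lambda>n. nrm N (X n)) \<longlonglongrightarrow> L2"
    using cauchy_seqs_nrm_convergent[OF X] by (auto simp: convergent_def)
  have "(\<lambda>n. ?X n \<otimes> ?Y n, \<lambda>n. X n \<otimes> Y n) \<in> null_rel N"
  proof (rule null_relI)
    have "(\<lambda>n. gap (?X n) (X n)) \<longlonglongrightarrow> 0" "(\<lambda>n. gap (?Y n) (Y n)) \<longlonglongrightarrow> 0"
      using r by (auto simp: null_rel_iff)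
    then show "(\<lambda>n. gap (?X n) (X n) * nrm N (?Y n) + nrm N (X n) * gap (?Y n) (Y n)) \<longlonglongrightarrow> 0"
      using tendsto_add[OF tendsto_mult[OF _ L1] tendsto_mult[OF L2]] by fastforce
  qed (use c X Y in \<open>auto intro: cauchy_seqs_mult gap_mult cauchy_seqs_carrier\<close>)
  then show ?thesis using cls_eqI by (simp add: completion_def)
qed

lemma cls_smult:
  assumes X: "X \<in> cauchy_seqs N"
  shows "c \<odot>\<^bsub>completion N\<^esub> cls X = cls (\<lambda>n. c \<odot>\<^bsub>N\<^esub> X n)"
proof -
  let ?X = "rep (cls X)"
  have r: "(?X, X) \<in> null_rel N" using rep_cls X by auto
  then have c: "?X \<in> cauchy_seqs N" by (auto simp: null_rel_iff)
  have "(\<lambda>n. c \<odot>\<^bsub>N\<^esub> ?X n, \<lambda>n. c \<odot>\<^bsub>N\<^esub> X n) \<in> null_rel N"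
  proof (rule null_relI)
    show "(\<lambda>n. norm c * gap (?X n) (X n)) \<longlonglongrightarrow> 0"
      using r by (auto simp: null_rel_iff intro: tendsto_mult_right_zero)
  qed (use c X in \<open>auto simp: gap_smult cauchy_seqs_carrier intro: cauchy_seqs_smult\<close>)
  then show ?thesis using cls_eqI by (simp add: completion_def)
qed

text \<open>By the reverse triangle inequality, equivalent sequences have the same limit of norms,
  so the chosen representative in \<open>nrm\<close> may be exchanged for X.\<close>

lemma cls_nrm:
  assumes X: "X \<in> cauchy_seqs N"
  shows "(\<lambda>n. nrm N (X n)) \<longlonglongrightarrow> nrm (completion N) (cls X)"
proof -
  let ?X = "rep (cls X)"
  have r: "(?X, X) \<in> null_rel N" using rep_cls X by auto
  then have c: "?X \<in> cauchy_seqs N" by (auto simp: null_rel_iff)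
  have "(\<lambda>n. nrm N (?X n)) \<longlonglongrightarrow> nrm (completion N) (cls X)"
    using cauchy_seqs_nrm_convergent[OF c] by (simp add: completion_def convergent_LIMSEQ_iff)
  moreover have "(\<lambda>n. nrm N (X n) - nrm N (?X n)) \<longlonglongrightarrow> 0"
  proof (rule Lim_null_comparison)
    show "(\<lambda>n. gap (?X n) (X n)) \<longlonglongrightarrow> 0" using r by (simp add: null_rel_iff)
    have "norm (nrm N (X n) - nrm N (?X n)) \<le> gap (?X n) (X n)" for n
      using nrm_diff_le[of "X n" "?X n"] cauchy_seqs_carrier[OF X] cauchy_seqs_carrier[OF c]
      by (simp add: gap_commute)
    then show "\<forall>\<^sub>F n in sequentially. norm (nrm N (X n) - nrm N (?X n)) \<le> gap (?X n) (X n)"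
      by simp
  qed
  ultimately show ?thesis using tendsto_add by fastforce
qed

lemma nrm_cls_const: "a \<in> carrier N \<Longrightarrow> nrm (completion N) (cls (\<lambda>n. a)) = nrm N a"
  using cls_nrm[OF cauchy_seqs_const] LIMSEQ_unique tendsto_const by blast

lemma completion_zero: "\<zero>\<^bsub>completion N\<^esub> = cls (\<lambda>n. \<zero>)"
  and completion_one: "\<one>\<^bsub>completion N\<^esub> = cls (\<lambda>n. \<one>)"
  by (simp_all add: completion_def)

lemma completion_abelian_group: "abelian_group (completion N)"
proof (rule abelian_groupI)
  fix P assume "P \<in> carrier (completion N)"
  then obtain X where X: "X \<in> cauchy_seqs N" "P = cls X" by (rule completion_cases)
  then show "\<exists>Q\<in>carrier (completion N). Q \<oplus>\<^bsub>completion N\<^esub> P = \<zero>\<^bsub>completion N\<^esub>"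
    using cls_add[OF cauchy_seqs_minus[OF X(1)] X(1)] cauchy_seqs_carrier[OF X(1)]
      cls_carrier[OF cauchy_seqs_minus[OF X(1)]]
    by (auto simp: completion_zero l_neg)
next
  fix P assume "P \<in> carrier (completion N)"
  then obtain X where X: "X \<in> cauchy_seqs N" "P = cls X" by (rule completion_cases)
  then show "\<zero>\<^bsub>completion N\<^esub> \<oplus>\<^bsub>completion N\<^esub> P = P"
    using cls_add[OF cauchy_seqs_const[OF zero_closed] X(1)] cauchy_seqs_carrier[OF X(1)]
    by (simp add: completion_zero)
next
  fix P Q assume "P \<in> carrier (completion N)" "Q \<in> carrier (completion N)"
  then show "P \<oplus>\<^bsub>completion N\<^esub> Q = Q \<oplus>\<^bsub>completion N\<^esub> P"
    by (auto elim!: completion_cases simp: cls_add a_comm cauchy_seqs_carrier)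
qed (auto simp: carrier_completion completion_zero cls_add cauchy_seqs_add a_assoc
     cauchy_seqs_carrier cauchy_seqs_const)

lemma completion_normed: "nonassoc_normed_algebra (completion N)"
proof -
  interpret C: abelian_group "completion N" by (rule completion_abelian_group)
  show ?thesis
  proof
    fix P assume "P \<in> carrier (completion N)"
    then obtain X where X: "X \<in> cauchy_seqs N" "P = cls X" by (rule completion_cases)
    note c = cauchy_seqs_carrier[OF X(1)]
    show "c \<odot>\<^bsub>completion N\<^esub> P \<in> carrier (completion N)" for c
      by (simp add: X cls_smult cls_carrier cauchy_seqs_smult)
    show "\<one>\<^bsub>completion N\<^esub> \<otimes>\<^bsub>completion N\<^esub> P = P" "P \<otimes>\<^bsub>completion N\<^esub> \<one>\<^bsub>completion N\<^esub> = P"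
      by (simp_all add: X completion_one cls_mult cauchy_seqs_const one_closed l_one r_one c)
    show "(c + d) \<odot>\<^bsub>completion N\<^esub> P
       = c \<odot>\<^bsub>completion N\<^esub> P \<oplus>\<^bsub>completion N\<^esub> d \<odot>\<^bsub>completion N\<^esub> P" for c d
      by (simp add: X cls_smult cauchy_seqs_smult cls_add smult_l_distr c)
    show "1 \<odot>\<^bsub>completion N\<^esub> P = P"
      by (simp add: X cls_smult smult_one c)
    show "0 \<le> nrm (completion N) P"
      using LIMSEQ_le_const[OF cls_nrm[OF X(1)]] nrm_nonneg[OF c] X by blast
    show "nrm (completion N) (k \<odot>\<^bsub>completion N\<^esub> P) = norm k * nrm (completion N) P" for k
    proof (rule LIMSEQ_unique)
      show "(\<lambda>n. nrm N (k \<odot>\<^bsub>N\<^esub> X n)) \<longlonglongrightarrow> nrm (completion N) (k \<odot>\<^bsub>completion N\<^esub> P)"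
        using cls_nrm[OF cauchy_seqs_smult[OF X(1)]] X by (simp add: cls_smult)
      show "(\<lambda>n. nrm N (k \<odot>\<^bsub>N\<^esub> X n)) \<longlonglongrightarrow> norm k * nrm (completion N) P"
        using tendsto_mult_left[OF cls_nrm[OF X(1)], of "norm k"] X by (simp add: nrm_smult c)
    qed
    fix Q assume "Q \<in> carrier (completion N)"
    then obtain Y where Y: "Y \<in> cauchy_seqs N" "Q = cls Y" by (rule completion_cases)
    note d = cauchy_seqs_carrier[OF Y(1)]
    show "P \<otimes>\<^bsub>completion N\<^esub> Q \<in> carrier (completion N)"
      by (simp add: X Y cls_mult cls_carrier cauchy_seqs_mult)
    show "k \<odot>\<^bsub>completion N\<^esub> (P \<oplus>\<^bsub>completion N\<^esub> Q)
       = k \<odot>\<^bsub>completion N\<^esub> P \<oplus>\<^bsub>completion N\<^esub> k \<odot>\<^bsub>completion N\<^esub> Q" for k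
      by (simp add: X Y cls_smult cauchy_seqs_smult cauchy_seqs_add cls_add smult_r_distr c d)
    show "nrm (completion N) (P \<oplus>\<^bsub>completion N\<^esub> Q) \<le> nrm (completion N) P + nrm (completion N) Q"
    proof (rule LIMSEQ_le)
      show "(\<lambda>n. nrm N (X n \<oplus> Y n)) \<longlonglongrightarrow> nrm (completion N) (P \<oplus>\<^bsub>completion N\<^esub> Q)"
        using cls_nrm[OF cauchy_seqs_add[OF X(1) Y(1)]] X Y by (simp add: cls_add)
      show "(\<lambda>n. nrm N (X n) + nrm N (Y n)) \<longlonglongrightarrow> nrm (completion N) P + nrm (completion N) Q"
        using tendsto_add[OF cls_nrm[OF X(1)] cls_nrm[OF Y(1)]] X Y by simp
    qed (auto intro: nrm_triangle c d)
    show "nrm (completion N) (P \<otimes>\<^bsub>completion N\<^esub> Q) \<le> nrm (completion N) P * nrm (completion N) Q"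
    proof (rule LIMSEQ_le)
      show "(\<lambda>n. nrm N (X n \<otimes> Y n)) \<longlonglongrightarrow> nrm (completion N) (P \<otimes>\<^bsub>completion N\<^esub> Q)"
        using cls_nrm[OF cauchy_seqs_mult[OF X(1) Y(1)]] X Y by (simp add: cls_mult)
      show "(\<lambda>n. nrm N (X n) * nrm N (Y n)) \<longlonglongrightarrow> nrm (completion N) P * nrm (completion N) Q"
        using tendsto_mult[OF cls_nrm[OF X(1)] cls_nrm[OF Y(1)]] X Y by simp
    qed (auto intro: nrm_mult c d)
    fix R assume "R \<in> carrier (completion N)"
    then obtain Z where Z: "Z \<in> cauchy_seqs N" "R = cls Z" by (rule completion_cases)
    note e = cauchy_seqs_carrier[OF Z(1)]
    show "(P \<oplus>\<^bsub>completion N\<^esub> Q) \<otimes>\<^bsub>completion N\<^esub> R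
       = P \<otimes>\<^bsub>completion N\<^esub> R \<oplus>\<^bsub>completion N\<^esub> Q \<otimes>\<^bsub>completion N\<^esub> R"
      "R \<otimes>\<^bsub>completion N\<^esub> (P \<oplus>\<^bsub>completion N\<^esub> Q)
       = R \<otimes>\<^bsub>completion N\<^esub> P \<oplus>\<^bsub>completion N\<^esub> R \<otimes>\<^bsub>completion N\<^esub> Q"
      by (simp_all add: X Y Z cls_mult cls_add cauchy_seqs_mult cauchy_seqs_add l_distr r_distr c d e)
  next
    show "\<one>\<^bsub>completion N\<^esub> \<in> carrier (completion N)"
      by (simp add: completion_one cls_carrier cauchy_seqs_const one_closed)
  qed
qed

lemma completion_minus:
  assumes X: "X \<in> cauchy_seqs N" and Y: "Y \<in> cauchy_seqs N"
  shows "cls X \<ominus>\<^bsub>completion N\<^esub> cls Y = cls (\<lambda>n. X n \<ominus> Y n)"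
proof -
  interpret C: nonassoc_normed_algebra "completion N" by (rule completion_normed)
  have "\<ominus>\<^bsub>completion N\<^esub> cls Y = cls (\<lambda>n. (-1) \<odot>\<^bsub>N\<^esub> Y n)"
    using C.smult_minus_one[OF cls_carrier[OF Y]] cls_smult[OF Y] by metis
  also have "\<dots> = cls (\<lambda>n. \<ominus> Y n)"
    using cauchy_seqs_carrier[OF Y] by (simp add: smult_minus_one)
  finally show ?thesis
    using cls_add[OF X cauchy_seqs_minus[OF Y]] by (simp add: a_minus_def)
qed

lemma completion_nrm_zero:
  assumes "P \<in> carrier (completion N)" "nrm (completion N) P = 0"
  shows "P = \<zero>\<^bsub>completion N\<^esub>"
proof -
  obtain X where X: "X \<in> cauchy_seqs N" "P = cls X" using assms(1) by (rule completion_cases)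
  have "(X, \<lambda>n. \<zero>) \<in> null_rel N"
    using cls_nrm[OF X(1)] X assms(2)
    by (simp add: null_rel_iff cauchy_seqs_const gap_zero cauchy_seqs_carrier)
  then show ?thesis using X cls_eqI by (simp add: completion_zero)
qed

lemma completion_dense:
  assumes "P \<in> carrier (completion N)" "e > 0"
  obtains a where "a \<in> carrier N" "nrm (completion N) (P \<ominus>\<^bsub>completion N\<^esub> cls (\<lambda>n. a)) < e"
proof -
  obtain X where X: "X \<in> cauchy_seqs N" "P = cls X" using assms(1) by (rule completion_cases)
  obtain M where M: "\<And>m n. m \<ge> M \<Longrightarrow> n \<ge> M \<Longrightarrow> gap (X m) (X n) < e / 2"
    using cauchy_seqsD[OF X(1), of "e/2"] assms(2) by auto
  note c = cauchy_seqs_const[OF cauchy_seqs_carrier[OF X(1)]]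
  have "(\<lambda>n. gap (X n) (X M)) \<longlonglongrightarrow> nrm (completion N) (P \<ominus>\<^bsub>completion N\<^esub> cls (\<lambda>n. X M))"
    using cls_nrm[OF cauchy_seqs_add[OF X(1) cauchy_seqs_minus[OF c[of M]]]]
      completion_minus[OF X(1) c[of M]] X(2)
    by (simp add: a_minus_def gap_def)
  then have "nrm (completion N) (P \<ominus>\<^bsub>completion N\<^esub> cls (\<lambda>n. X M)) \<le> e / 2"
    by (rule LIMSEQ_le_const2) (use M in \<open>auto intro!: exI[of _ M] less_imp_le\<close>)
  then show thesis
    using that[of "X M"] cauchy_seqs_carrier[OF X(1)] assms(2) by fastforce
qed

end

locale nonassoc_banach_algebra = nonassoc_normed_algebra A for A :: "'a normed_algebra" (structure) +
  assumes nrm_eq_zero: "x \<in> carrier A \<Longrightarrow> nrm A x = 0 \<Longrightarrow> x = \<zero>"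
    and complete: "X \<in> cauchy_seqs A \<Longrightarrow> \<exists>x\<in>carrier A. (\<lambda>n. nrm A (X n \<ominus> x)) \<longlonglongrightarrow> 0"

text \<open>Diagonal argument: replace the n-th member of a Cauchy sequence of classes by a constant
  class \<open>a n\<close> at distance below 1/(n+1). The sequence a is then itself Cauchy in N, and
  its class is the limit.\<close>

lemma (in nonassoc_normed_algebra) completion_banach: "nonassoc_banach_algebra (completion N)"
proof -
  interpret C: nonassoc_normed_algebra "completion N" by (rule completion_normed)
  show ?thesis
  proof
    fix P assume "P \<in> carrier (completion N)" "nrm (completion N) P = 0"
    then show "P = \<zero>\<^bsub>completion N\<^esub>" by (rule completion_nrm_zero)
  next
    fix P assume P: "P \<in> cauchy_seqs (completion N)"
    note Pc = C.cauchy_seqs_carrier[OF P]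
    have "\<exists>a. a \<in> carrier N \<and> C.gap (P n) (cls (\<lambda>_. a)) < 1 / real (Suc n)" for n
      using completion_dense[OF Pc, of "1 / real (Suc n)" n] by (auto simp: C.gap_def)
    then obtain a where a: "\<And>n. a n \<in> carrier N"
      and Pa: "\<And>n. C.gap (P n) (cls (\<lambda>_. a n)) < 1 / real (Suc n)"
      by metis
    have ac: "cls (\<lambda>_. a n) \<in> carrier (completion N)" for n
      by (simp add: cls_carrier cauchy_seqs_const a)
    have gap_a: "gap (a m) (a n) = C.gap (cls (\<lambda>_. a m)) (cls (\<lambda>_. a n))" for m n
      using a by (simp add: C.gap_def gap_def completion_minus cauchy_seqs_const nrm_cls_const)
    have inv: "\<exists>K. \<forall>n\<ge>K. 1 / real (Suc n) < e" if "e > 0" for e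
      using LIMSEQ_D[OF LIMSEQ_inverse_real_of_nat that] by (simp add: divide_inverse)
    have aC: "a \<in> cauchy_seqs N"
    proof (rule cauchy_seqsI[OF a])
      fix e :: real assume "e > 0"
      then obtain M where M: "\<And>m n. m \<ge> M \<Longrightarrow> n \<ge> M \<Longrightarrow> C.gap (P m) (P n) < e / 3"
        using C.cauchy_seqsD[OF P, of "e/3"] by auto
      obtain K where K: "\<And>n. n \<ge> K \<Longrightarrow> 1 / real (Suc n) < e / 3"
        using inv[of "e/3"] \<open>e > 0\<close> by auto
      have "gap (a m) (a n) < e" if "m \<ge> max M K" "n \<ge> max M K" for m n
      proof -
        have "gap (a m) (a n) \<le> C.gap (cls (\<lambda>_. a m)) (P m) + C.gap (P m) (cls (\<lambda>_. a n))"
          unfolding gap_a by (intro C.gap_triangle ac Pc)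
        moreover have "C.gap (P m) (cls (\<lambda>_. a n)) \<le> C.gap (P m) (P n) + C.gap (P n) (cls (\<lambda>_. a n))"
          by (intro C.gap_triangle ac Pc)
        ultimately show ?thesis
          using M[of m n] K[of m] K[of n] Pa[of m] Pa[of n] that
            C.gap_commute[OF ac Pc, of m m] by linarith
      qed
      then show "\<exists>M. \<forall>m\<ge>M. \<forall>n\<ge>M. gap (a m) (a n) < e" by blast
    qed
    let ?Q = "cls a"
    have Q: "?Q \<in> carrier (completion N)" by (rule cls_carrier[OF aC])
    have "(\<lambda>n. C.gap (P n) ?Q) \<longlonglongrightarrow> 0"
    proof (rule LIMSEQ_I)
      fix e :: real assume "e > 0"
      obtain M where M: "\<And>m n. m \<ge> M \<Longrightarrow> n \<ge> M \<Longrightarrow> gap (a m) (a n) < e / 3"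
        using cauchy_seqsD[OF aC, of "e/3"] \<open>e > 0\<close> by auto
      obtain K where K: "\<And>n. n \<ge> K \<Longrightarrow> 1 / real (Suc n) < e / 3"
        using inv[of "e/3"] \<open>e > 0\<close> by auto
      have "norm (C.gap (P n) ?Q - 0) < e" if n: "n \<ge> max M K" for n
      proof -
        have "(\<lambda>k. gap (a n) (a k)) \<longlonglongrightarrow> C.gap (cls (\<lambda>_. a n)) ?Q"
          using cls_nrm[OF cauchy_seqs_add[OF cauchy_seqs_const[OF a[of n]] cauchy_seqs_minus[OF aC]]]
            completion_minus[OF cauchy_seqs_const[OF a[of n]] aC]
          by (simp add: C.gap_def gap_def a_minus_def)
        then have "C.gap (cls (\<lambda>_. a n)) ?Q \<le> e / 3"
          by (rule LIMSEQ_le_const2) (use M n in \<open>auto intro!: exI[of _ M] less_imp_le\<close>)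
        then show ?thesis
          using C.gap_triangle[OF Pc ac Q, of n n] Pa[of n] K[of n] n C.gap_nonneg[OF Pc Q] \<open>e > 0\<close>
          by fastforce
      qed
      then show "\<exists>M. \<forall>n\<ge>M. norm (C.gap (P n) ?Q - 0) < e" by blast
    qed
    then show "\<exists>Q\<in>carrier (completion N). (\<lambda>n. nrm (completion N) (P n \<ominus>\<^bsub>completion N\<^esub> Q)) \<longlonglongrightarrow> 0"
      using Q by (auto simp: C.gap_def)
  qed
qed

section \<open>The exponential series\<close>

context nonassoc_banach_algebra
begin

definition "exp_sum a n = (\<Oplus>k\<in>{..n}. (1 / fact k) \<odot>\<^bsub>A\<^esub> (a [^] k))"

lemma power_closed: "a \<in> carrier A \<Longrightarrow> a [^] (k::nat) \<in> carrier A"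
  by (induction k) (auto simp: nat_pow_def one_closed mult_closed)

text \<open>The factor \<open>nrm A \<one>\<close> is carried along because it is not assumed to be
  1: in the algebra of the empty groupoid it is 0.\<close>

lemma nrm_power:
  assumes "a \<in> carrier A" shows "nrm A (a [^] (k::nat)) \<le> nrm A \<one> * nrm A a ^ k"
proof (induction k)
  case (Suc k)
  have "nrm A (a [^] Suc k) \<le> nrm A (a [^] k) * nrm A a"
    using nrm_mult[OF power_closed[OF assms] assms, of k] by (simp add: nat_pow_def)
  also have "\<dots> \<le> (nrm A \<one> * nrm A a ^ k) * nrm A a"
    using Suc nrm_nonneg[OF assms] by (intro mult_right_mono)
  finally show ?case by (simp add: mult_ac)
qed (simp add: nat_pow_def)

lemma exp_term_closed: "a \<in> carrier A \<Longrightarrow> c \<odot>\<^bsub>A\<^esub> (a [^] (k::nat)) \<in> carrier A"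
  by (simp add: smult_closed power_closed)

lemma exp_sum_closed: "a \<in> carrier A \<Longrightarrow> exp_sum a n \<in> carrier A"
  unfolding exp_sum_def by (intro finsum_closed) (auto simp: exp_term_closed)

lemma exp_sum_Suc:
  "a \<in> carrier A \<Longrightarrow> exp_sum a (Suc n) = (1 / fact (Suc n)) \<odot>\<^bsub>A\<^esub> (a [^] Suc n) \<oplus> exp_sum a n"
  unfolding exp_sum_def by (subst finsum_Suc) (auto simp: exp_term_closed)

lemma exp_sum_0: "a \<in> carrier A \<Longrightarrow> exp_sum a 0 = \<one>"
  unfolding exp_sum_def by (simp add: nat_pow_def one_closed smult_one smult_closed)

lemma nrm_exp_term:
  assumes "a \<in> carrier A"
  shows "nrm A ((1 / fact k) \<odot>\<^bsub>A\<^esub> (a [^] (k::nat))) \<le> nrm A \<one> * (nrm A a ^ k / fact k)"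
proof -
  have "nrm A ((1 / fact k) \<odot>\<^bsub>A\<^esub> (a [^] k)) = (1 / fact k) * nrm A (a [^] k)"
    using assms by (simp add: nrm_smult power_closed norm_divide)
  also have "\<dots> \<le> (1 / fact k) * (nrm A \<one> * nrm A a ^ k)"
    by (intro mult_left_mono nrm_power assms) auto
  finally show ?thesis by simp
qed

text \<open>Termwise comparison with the scalar series of \<open>exp (nrm A a)\<close>; convergence
  of the latter makes the partial sums Cauchy.\<close>

lemma gap_exp_sum:
  assumes a: "a \<in> carrier A" and "m \<ge> n"
  shows "gap (exp_sum a m) (exp_sum a n) \<le>
    nrm A \<one> * ((\<Sum>k\<le>m. nrm A a ^ k / fact k) - (\<Sum>k\<le>n. nrm A a ^ k / fact k))"
  using assms(2)
proof (induction m rule: dec_induct)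
  case base
  then show ?case by (simp add: gap_self exp_sum_closed a)
next
  case (step m)
  let ?t = "(1 / fact (Suc m)) \<odot>\<^bsub>A\<^esub> (a [^] Suc m)"
  have "gap (exp_sum a (Suc m)) (exp_sum a n) = gap (?t \<oplus> exp_sum a m) (\<zero> \<oplus> exp_sum a n)"
    using a by (simp only: exp_sum_Suc l_zero exp_sum_closed)
  also have "\<dots> \<le> gap ?t \<zero> + gap (exp_sum a m) (exp_sum a n)"
    by (intro gap_add) (auto simp del: nat_pow_Suc simp: a exp_term_closed exp_sum_closed)
  also have "gap ?t \<zero> = nrm A ?t" by (rule gap_zero[OF exp_term_closed[OF a]])
  also have "\<dots> \<le> nrm A \<one> * (nrm A a ^ Suc m / fact (Suc m))" by (rule nrm_exp_term[OF a])
  finally show ?case using step.IH by (simp add: algebra_simps del: fact_Suc power_Suc)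
qed

lemma exp_sum_cauchy:
  assumes a: "a \<in> carrier A"
  shows "exp_sum a \<in> cauchy_seqs A"
proof (rule cauchy_seqsI[OF exp_sum_closed[OF a]])
  fix e :: real assume "e > 0"
  let ?E = "\<lambda>n. \<Sum>k\<le>n. nrm A a ^ k / fact k"
  have "(\<lambda>k. nrm A a ^ k / fact k) sums exp (nrm A a)"
    using exp_converges[of "nrm A a"] by (simp add: divide_inverse mult.commute)
  then have "?E \<longlonglongrightarrow> exp (nrm A a)" by (simp add: sums_def_le)
  then have "Cauchy ?E" by (rule LIMSEQ_imp_Cauchy)
  moreover have pos: "nrm A \<one> + 1 > 0" using nrm_nonneg[OF one_closed] by simp
  ultimately obtain M where M: "\<And>m n. m \<ge> M \<Longrightarrow> n \<ge> M \<Longrightarrow> norm (?E m - ?E n) < e / (nrm A \<one> + 1)"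
    using \<open>e > 0\<close> CauchyD[of ?E "e / (nrm A \<one> + 1)"] by auto
  have main: "gap (exp_sum a m) (exp_sum a n) < e" if "m \<ge> M" "n \<ge> M" "m \<ge> n" for m n
  proof -
    have "gap (exp_sum a m) (exp_sum a n) \<le> nrm A \<one> * (?E m - ?E n)"
      by (rule gap_exp_sum[OF a that(3)])
    also have "\<dots> \<le> nrm A \<one> * norm (?E m - ?E n)"
      using nrm_nonneg[OF one_closed] by (intro mult_left_mono) auto
    also have "\<dots> \<le> (nrm A \<one> + 1) * norm (?E m - ?E n)"
      by (simp add: algebra_simps)
    also have "\<dots> < e"
      using M[OF that(1,2)] pos by (simp add: pos_less_divide_eq mult.commute)
    finally show ?thesis .
  qed
  have "gap (exp_sum a m) (exp_sum a n) < e" if "m \<ge> M" "n \<ge> M" for m n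
    using main[of m n] main[of n m] gap_commute[OF exp_sum_closed[OF a] exp_sum_closed[OF a], of m n] that
    by (cases "m \<ge> n") auto
  then show "\<exists>M. \<forall>m\<ge>M. \<forall>n\<ge>M. gap (exp_sum a m) (exp_sum a n) < e" by blast
qed

lemma limit_unique:
  assumes "\<And>n. X n \<in> carrier A" "x \<in> carrier A" "y \<in> carrier A"
    and "(\<lambda>n. nrm A (X n \<ominus> x)) \<longlonglongrightarrow> 0" "(\<lambda>n. nrm A (X n \<ominus> y)) \<longlonglongrightarrow> 0"
  shows "x = y"
proof -
  have "(\<lambda>n. gap (X n) x + gap (X n) y) \<longlonglongrightarrow> 0"
    using assms(4,5) unfolding gap_def by (rule tendsto_add_zero)
  moreover have "gap x y \<le> gap (X n) x + gap (X n) y" for n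
    using gap_triangle[OF assms(2) assms(1) assms(3), of n] gap_commute[OF assms(2) assms(1)] by simp
  ultimately have "gap x y \<le> 0" using LIMSEQ_le_const[of _ 0 "gap x y"] by blast
  then have "nrm A (x \<ominus> y) = 0" using gap_nonneg[OF assms(2,3)] by (simp add: gap_def)
  then have "x \<ominus> y = \<zero>" using nrm_eq_zero assms(2,3) by blast
  then show ?thesis using assms(2,3) by (metis a_minus_def a_inv_closed minus_equality minus_minus)
qed

text \<open>\<open>alg_exp\<close> is a definite description, so it denotes the limit only once
  uniqueness is known. That is \<open>limit_unique\<close>, which rests on the norm separating
  points; existence is completeness.\<close>

lemma alg_exp_equality:
  assumes "a \<in> carrier A" "e \<in> carrier A" "(\<lambda>n. nrm A (exp_sum a n \<ominus> e)) \<longlonglongrightarrow> 0"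
  shows "alg_exp A a = e"
  unfolding alg_exp_def exp_sum_def[symmetric]
proof (rule the_equality)
  fix x assume "x \<in> carrier A \<and> (\<lambda>n. nrm A (exp_sum a n \<ominus> x)) \<longlonglongrightarrow> 0"
  then show "x = e"
    using limit_unique[of "exp_sum a" x e] exp_sum_closed[OF assms(1)] assms(2,3) by blast
qed (use assms in blast)

lemma alg_exp:
  assumes "a \<in> carrier A"
  shows "alg_exp A a \<in> carrier A" "(\<lambda>n. nrm A (exp_sum a n \<ominus> alg_exp A a)) \<longlonglongrightarrow> 0"
proof -
  obtain e where "e \<in> carrier A" "(\<lambda>n. nrm A (exp_sum a n \<ominus> e)) \<longlonglongrightarrow> 0"
    using complete[OF exp_sum_cauchy[OF assms]] by blast
  moreover from this have "alg_exp A a = e" using alg_exp_equality assms by blast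
  ultimately show "alg_exp A a \<in> carrier A" "(\<lambda>n. nrm A (exp_sum a n \<ominus> alg_exp A a)) \<longlonglongrightarrow> 0"
    by simp_all
qed

text \<open>The terms of order 0 and 1 cancel, and the remaining ones are dominated by the tail of
  the scalar exponential. With \<phi> a matrix entry and a replaced by \<open>ita\<close>, this
  yields the derivative at t = 0 of the entries of \<open>exp(ita)\<close>.\<close>

lemma functional_exp_second_order:
  fixes \<phi> :: "'a \<Rightarrow> complex"
  assumes a: "a \<in> carrier A"
    and add: "\<And>x y. x \<in> carrier A \<Longrightarrow> y \<in> carrier A \<Longrightarrow> \<phi> (x \<oplus> y) = \<phi> x + \<phi> y"
    and smult: "\<And>c x. x \<in> carrier A \<Longrightarrow> \<phi> (c \<odot>\<^bsub>A\<^esub> x) = c * \<phi> x"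
    and bounded: "\<And>x. x \<in> carrier A \<Longrightarrow> norm (\<phi> x) \<le> nrm A x"
  shows "norm (\<phi> (alg_exp A a) - \<phi> \<one> - \<phi> a) \<le> nrm A \<one> * (exp (nrm A a) - 1 - nrm A a)"
proof (rule LIMSEQ_le)
  have diff: "\<phi> (x \<ominus> y) = \<phi> x - \<phi> y" if "x \<in> carrier A" "y \<in> carrier A" for x y
    using that add[of x "\<ominus> y"] smult[of y "-1"] by (simp add: a_minus_def smult_minus_one)
  have "(\<lambda>n. \<phi> (exp_sum a n) - \<phi> (alg_exp A a)) \<longlonglongrightarrow> 0"
  proof (rule Lim_null_comparison[OF _ alg_exp(2)[OF a]])
    show "\<forall>\<^sub>F n in sequentially. norm (\<phi> (exp_sum a n) - \<phi> (alg_exp A a))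
        \<le> nrm A (exp_sum a n \<ominus> alg_exp A a)"
      using bounded diff a by (metis (no_types, lifting) alg_exp(1) always_eventually exp_sum_closed minus_closed)
  qed
  then have "(\<lambda>n. \<phi> (exp_sum a n)) \<longlonglongrightarrow> \<phi> (alg_exp A a)"
    using LIM_zero_iff by blast
  \<comment> \<open>The index is shifted by one so that both subtracted terms, of order 0 and 1, are
    present in every partial sum.\<close>
  then show "(\<lambda>n. norm (\<phi> (exp_sum a (Suc n)) - \<phi> \<one> - \<phi> a)) \<longlonglongrightarrow> norm (\<phi> (alg_exp A a) - \<phi> \<one> - \<phi> a)"
    by (intro tendsto_intros LIMSEQ_Suc)
  have "(\<lambda>k. nrm A a ^ k / fact k) sums exp (nrm A a)"
    using exp_converges[of "nrm A a"] by (simp add: divide_inverse mult.commute)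
  then have "(\<lambda>n. \<Sum>k\<le>n. nrm A a ^ k / fact k) \<longlonglongrightarrow> exp (nrm A a)" by (simp add: sums_def_le)
  then show "(\<lambda>n. nrm A \<one> * ((\<Sum>k\<le>Suc n. nrm A a ^ k / fact k) - 1 - nrm A a))
      \<longlonglongrightarrow> nrm A \<one> * (exp (nrm A a) - 1 - nrm A a)"
    by (intro tendsto_intros LIMSEQ_Suc)
  have "norm (\<phi> (exp_sum a (Suc n)) - \<phi> \<one> - \<phi> a) \<le> nrm A \<one> * ((\<Sum>k\<le>Suc n. nrm A a ^ k / fact k) - 1 - nrm A a)" for n
  proof (induction n)
    case 0
    have "exp_sum a (Suc 0) = a \<oplus> \<one>"
      unfolding exp_sum_Suc[OF a] exp_sum_0[OF a] using a
      by (simp add: nat_pow_def l_one smult_one)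
    then show ?case using add[OF a one_closed] by simp
  next
    case (Suc n)
    let ?t = "(1 / fact (Suc (Suc n))) \<odot>\<^bsub>A\<^esub> (a [^] (Suc (Suc n)))"
    have "\<phi> (exp_sum a (Suc (Suc n))) = \<phi> ?t + \<phi> (exp_sum a (Suc n))"
      unfolding exp_sum_Suc[OF a, of "Suc n"] by (rule add[OF exp_term_closed[OF a] exp_sum_closed[OF a]])
    then have "norm (\<phi> (exp_sum a (Suc (Suc n))) - \<phi> \<one> - \<phi> a)
        \<le> norm (\<phi> ?t) + norm (\<phi> (exp_sum a (Suc n)) - \<phi> \<one> - \<phi> a)"
      using norm_triangle_ineq[of "\<phi> ?t" "\<phi> (exp_sum a (Suc n)) - \<phi> \<one> - \<phi> a"]
      by (simp only: add_diff_eq)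
    also have "norm (\<phi> ?t) \<le> nrm A \<one> * (nrm A a ^ Suc (Suc n) / fact (Suc (Suc n)))"
      using bounded[OF exp_term_closed[OF a]] nrm_exp_term[OF a] by (rule order_trans)
    also note Suc.IH
    finally show ?case by (simp add: algebra_simps del: fact_Suc power_Suc)
  qed
  then show "\<exists>M. \<forall>n\<ge>M. norm (\<phi> (exp_sum a (Suc n)) - \<phi> \<one> - \<phi> a)
      \<le> nrm A \<one> * ((\<Sum>k\<le>Suc n. nrm A a ^ k / fact k) - 1 - nrm A a)" by blast
qed

end

section \<open>Operators on \<open>\<ell>\<^sup>p\<close>\<close>

lemma powr_convex_nonneg:
  fixes p x y l :: real
  assumes p: "1 \<le> p" and "0 \<le> x" "0 \<le> y" "0 \<le> l" "l \<le> 1"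
  shows "(l * x + (1 - l) * y) powr p \<le> l * x powr p + (1 - l) * y powr p"
proof -
  \<comment> \<open>When one of x, y is 0, the claim reduces to \<open>c powr p \<le> c\<close> for
    c between 0 and 1; the other case is convexity on the positive reals.\<close>
  have scale: "(c * z) powr p \<le> c * z powr p" if "0 \<le> c" "c \<le> 1" "0 \<le> z" for c z :: real
  proof -
    have "c powr p \<le> c"
      using powr_mono'[OF p that(1,2)] that(1) by simp
    then show ?thesis using that by (simp add: powr_mult mult_right_mono)
  qed
  consider "x = 0" | "y = 0" | "x > 0" "y > 0" using assms by linarith
  then show ?thesis
  proof cases
    case 3
    then show ?thesis
      using convex_onD[OF powr_convex[OF p], of "1 - l" x y] assms by (simp add: algebra_simps)
  qed (use scale[of "1 - l" y] scale[of l x] assms in auto)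
qed

lemma sum_norm_powr_eq_0_iff:
  fixes u :: "'b \<Rightarrow> complex"
  assumes "finite I"
  shows "(\<Sum>i\<in>I. norm (u i) powr p) = 0 \<longleftrightarrow> (\<forall>i\<in>I. u i = 0)"
  using assms by (subst sum_nonneg_eq_0_iff) auto

text \<open>Both hypotheses share the factor s because it will be the p-th power sum of an input
  vector: in this form the inequality adds operator bounds without taking p-th roots.\<close>

lemma Minkowski_powr_sum:
  fixes u v :: "'b \<Rightarrow> complex"
  assumes p: "1 \<le> p" and I: "finite I" and "0 \<le> C" "0 \<le> D" "0 \<le> s"
    and u: "(\<Sum>i\<in>I. norm (u i) powr p) \<le> C powr p * s"
    and v: "(\<Sum>i\<in>I. norm (v i) powr p) \<le> D powr p * s"
  shows "(\<Sum>i\<in>I. norm (u i + v i) powr p) \<le> (C + D) powr p * s"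
proof -
  have zero: "w i = 0" if "(\<Sum>i\<in>I. norm (w i) powr p) \<le> 0" "i \<in> I" for w :: "'b \<Rightarrow> complex" and i
  proof -
    have "(\<Sum>i\<in>I. norm (w i) powr p) = 0" using that(1) by (intro antisym sum_nonneg) auto
    then show ?thesis using sum_norm_powr_eq_0_iff[OF I] that(2) by blast
  qed
  consider "C = 0" | "D = 0" | "C > 0" "D > 0" using assms by linarith
  then show ?thesis
  proof cases
    case 1
    then have "\<And>i. i \<in> I \<Longrightarrow> u i = 0" using u zero by auto
    then show ?thesis using v 1 by simp
  next
    case 2
    then have "\<And>i. i \<in> I \<Longrightarrow> v i = 0" using v zero by auto
    then show ?thesis using u 2 by simp
  next
    case 3
    \<comment> \<open>The weight for which \<open>norm (u i) + norm (v i)\<close> is (C + D) times a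
      convex combination of \<open>norm (u i) / C\<close> and \<open>norm (v i) / D\<close>.\<close>
    define l where "l = C / (C + D)"
    have l: "0 \<le> l" "l \<le> 1" and l': "1 - l = D / (C + D)" using 3 by (auto simp: l_def field_simps)
    have pt: "norm (u i + v i) powr p \<le>
        (C + D) powr p * (l * (norm (u i) powr p / C powr p) + (1 - l) * (norm (v i) powr p / D powr p))" for i
    proof -
      have "norm (u i + v i) powr p \<le> (norm (u i) + norm (v i)) powr p"
        using p by (intro powr_mono2 norm_triangle_ineq) auto
      also have "norm (u i) + norm (v i) = (C + D) * (l * (norm (u i) / C) + (1 - l) * (norm (v i) / D))"
        using 3 unfolding l' by (simp add: distrib_left l_def)
      also have "\<dots> powr p = (C + D) powr p * (l * (norm (u i) / C) + (1 - l) * (norm (v i) / D)) powr p"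
        by (rule powr_mult)
      also have "\<dots> \<le> (C + D) powr p * (l * (norm (u i) / C) powr p + (1 - l) * (norm (v i) / D) powr p)"
        using 3 l p by (intro mult_left_mono powr_convex_nonneg) auto
      finally show ?thesis using 3 by (simp add: powr_divide)
    qed
    have "(\<Sum>i\<in>I. norm (u i + v i) powr p) \<le> (\<Sum>i\<in>I. (C + D) powr p *
        (l * (norm (u i) powr p / C powr p) + (1 - l) * (norm (v i) powr p / D powr p)))"
      by (intro sum_mono pt)
    also have "\<dots> = (C + D) powr p * (l * ((\<Sum>i\<in>I. norm (u i) powr p) / C powr p)
        + (1 - l) * ((\<Sum>i\<in>I. norm (v i) powr p) / D powr p))"
      by (simp only: sum_distrib_left[symmetric] sum.distrib sum_divide_distrib)
    also have "\<dots> \<le> (C + D) powr p * (l * s + (1 - l) * s)"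
    proof (intro mult_left_mono add_mono l)
      show "(\<Sum>i\<in>I. norm (u i) powr p) / C powr p \<le> s" "(\<Sum>i\<in>I. norm (v i) powr p) / D powr p \<le> s"
        using u v 3 by (simp_all add: pos_divide_le_eq mult.commute)
    qed (use l in auto)
    finally show ?thesis by (simp add: algebra_simps)
  qed
qed

section \<open>Differentiating p-th power sums\<close>

lemma has_derivative_norm_powr:
  fixes u :: "real \<Rightarrow> complex"
  assumes u: "(u has_vector_derivative u') (at 0)" and "u 0 \<noteq> 0"
  shows "((\<lambda>t. norm (u t) powr p) has_real_derivative
    p * norm (u 0) powr (p - 2) * Re (cnj (u 0) * u')) (at 0)"
proof -
  have "((\<lambda>t. norm (u t)) has_derivative (\<lambda>t. (t *\<^sub>R u') \<bullet> sgn (u 0))) (at 0)"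
    using has_derivative_compose[OF u[unfolded has_vector_derivative_def] has_derivative_norm[OF assms(2)]]
    by (simp add: inner_commute)
  then have "((\<lambda>t. norm (u t)) has_real_derivative (u' \<bullet> sgn (u 0))) (at 0)"
    by (simp add: has_field_derivative_def mult_commute_abs)
  from DERIV_fun_powr[OF this, of p]
  have *: "((\<lambda>t. norm (u t) powr p) has_real_derivative
      p * norm (u 0) powr (p - 1) * (u' \<bullet> sgn (u 0))) (at 0)"
    using assms(2) by simp
  have "norm (u 0) powr (p - 1) = norm (u 0) powr (p - 2) * norm (u 0)"
    using powr_add[of "norm (u 0)" "p - 2" 1] assms(2) by simp
  moreover have "norm (u 0) * (u' \<bullet> sgn (u 0)) = Re (cnj (u 0) * u')"
    using assms(2) by (simp add: sgn_div_norm inner_complex_def field_simps)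
  ultimately show ?thesis using * by (metis (no_types, lifting) mult.assoc)
qed

text \<open>A differentiable function with a maximum at 0 has derivative 0 there. The entries are
  nonzero at 0 since the norm is not differentiable at the origin and p may be 1.\<close>

lemma sum_norm_powr_max_derivative:
  fixes u :: "'b \<Rightarrow> real \<Rightarrow> complex"
  assumes I: "finite I" and "0 < p"
    and u: "\<And>i. i \<in> I \<Longrightarrow> (u i has_vector_derivative u' i) (at 0)"
    and nz: "\<And>i. i \<in> I \<Longrightarrow> u i 0 \<noteq> 0"
    and max: "\<And>t. (\<Sum>i\<in>I. norm (u i t) powr p) \<le> (\<Sum>i\<in>I. norm (u i 0) powr p)"
  shows "(\<Sum>i\<in>I. norm (u i 0) powr (p - 2) * Re (cnj (u i 0) * u' i)) = 0"
proof -
  have "((\<lambda>t. \<Sum>i\<in>I. norm (u i t) powr p) has_real_derivative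
      (\<Sum>i\<in>I. p * norm (u i 0) powr (p - 2) * Re (cnj (u i 0) * u' i))) (at 0)"
    by (intro DERIV_sum has_derivative_norm_powr u nz)
  from DERIV_local_max[OF this, of 1] max
  have "(\<Sum>i\<in>I. p * norm (u i 0) powr (p - 2) * Re (cnj (u i 0) * u' i)) = 0" by simp
  then show ?thesis using \<open>0 < p\<close> by (simp add: mult.assoc sum_distrib_left[symmetric])
qed

text \<open>For s in [0, 1] the remainder \<open>exp s - 1 - s\<close> is at most
  \<open>s\<^sup>2\<close>, so the error is quadratic in t. The bound has the shape produced by
  \<open>functional_exp_second_order\<close>.\<close>

lemma has_vector_derivative_second_order:
  fixes u :: "real \<Rightarrow> complex"
  assumes m: "m \<ge> 0" and K: "K \<ge> 0"
    and bd: "\<And>t. norm (u t - c0 - of_real t * c1) \<le> K * (exp (\<bar>t\<bar> * m) - 1 - \<bar>t\<bar> * m)"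
  shows "u 0 = c0" "(u has_vector_derivative c1) (at 0)"
proof -
  show u0: "u 0 = c0" using bd[of 0] by simp
  have "(u has_derivative (\<lambda>t. t *\<^sub>R c1)) (at 0)"
    unfolding has_derivative_at2
  proof (intro conjI bounded_linear_scaleR_left)
    show "((\<lambda>y. (1 / norm (y - 0)) *\<^sub>R (u y - (u 0 + (y - 0) *\<^sub>R c1))) \<longlongrightarrow> 0) (at 0)"
    proof (rule Lim_null_comparison)
      have "((\<lambda>y. K * m^2 * \<bar>y\<bar>) \<longlongrightarrow> K * m^2 * \<bar>0::real\<bar>) (at 0)"
        by (intro tendsto_intros)
      then show "((\<lambda>y. K * m^2 * \<bar>y\<bar>) \<longlongrightarrow> 0) (at 0)" by simp
      have small: "\<forall>\<^sub>F y in at (0::real). \<bar>y\<bar> * m < 1"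
      proof -
        have "((\<lambda>y::real. \<bar>y\<bar> * m) \<longlongrightarrow> \<bar>0\<bar> * m) (at 0)" by (intro tendsto_intros)
        then show ?thesis by (intro order_tendstoD(2)[of _ "0::real"]) auto
      qed
      show "\<forall>\<^sub>F y in at 0. norm ((1 / norm (y - 0)) *\<^sub>R (u y - (u 0 + (y - 0) *\<^sub>R c1))) \<le> K * m^2 * \<bar>y\<bar>"
        using small eventually_neq_at_within[of 0]
      proof eventually_elim
        case (elim y)
        have "norm (u y - (u 0 + y *\<^sub>R c1)) \<le> K * (exp (\<bar>y\<bar> * m) - 1 - \<bar>y\<bar> * m)"
          using bd[of y] u0 by (simp add: scaleR_conv_of_real algebra_simps)
        also have "\<dots> \<le> K * (\<bar>y\<bar> * m)\<^sup>2"
          using exp_bound[of "\<bar>y\<bar> * m"] elim m K by (intro mult_left_mono) auto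
        finally have "norm (u y - (u 0 + y *\<^sub>R c1)) \<le> K * m^2 * \<bar>y\<bar> * \<bar>y\<bar>"
          by (simp add: power2_eq_square mult_ac)
        then show ?case using elim by (simp add: pos_divide_le_eq)
      qed
    qed
  qed
  then show "(u has_vector_derivative c1) (at 0)" by (simp add: has_vector_derivative_def)
qed

text \<open>The quantity assumed to vanish is the imaginary part of the semi-inner product of a vector
  supported at two points with its image under the matrix \<open>(\<alpha>, \<beta>; \<gamma>, \<delta>)\<close>.\<close>

lemma numerical_range_real_imp_diagonal:
  fixes \<alpha> \<beta> \<gamma> \<delta> :: complex and p :: real
  assumes p: "p \<noteq> 2" and "Im \<alpha> = 0" "Im \<delta> = 0"
    and real: "\<And>a b. a \<noteq> 0 \<Longrightarrow> b \<noteq> 0 \<Longrightarrow> norm a powr (p - 2) * Im (cnj a * (\<alpha> * a + \<beta> * b))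
      + norm b powr (p - 2) * Im (cnj b * (\<gamma> * a + \<delta> * b)) = 0"
  shows "\<beta> = 0"
proof -
  \<comment> \<open>Four test vectors. The pairs (1, 1) and (1, \<i>) have equal moduli and give
    \<gamma> = \<open>cnj \<beta>\<close>; the pairs (1, 2) and (1, 2\<i>) give the same relation
    with weight \<open>2 powr (p - 2)\<close> on \<gamma>. Since that weight is not 1, both can hold
    only if \<beta> = 0.\<close>
  have *: "Im \<beta> * 2 + 2 powr (p - 2) * (2 * Im \<gamma>) = 0" "Re \<beta> * 2 - 2 powr (p - 2) * (2 * Re \<gamma>) = 0"
    "Im \<beta> + Im \<gamma> = 0" "Re \<beta> - Re \<gamma> = 0"
    using real[of 1 2] real[of 1 "2 * \<i>"] real[of 1 1] real[of 1 \<i>] assms(2,3)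
    by (simp_all add: algebra_simps norm_mult)
  have "2 powr (p - 2) \<noteq> (1::real)" using p by (simp add: powr_eq_one_iff_gen)
  moreover have "Im \<beta> * (2 powr (p - 2) - 1) = 0" "Re \<beta> * (2 powr (p - 2) - 1) = 0"
  proof -
    have "Im \<gamma> = - Im \<beta>" "Re \<gamma> = Re \<beta>" using *(3,4) by auto
    then show "Im \<beta> * (2 powr (p - 2) - 1) = 0" "Re \<beta> * (2 powr (p - 2) - 1) = 0"
      using *(1,2) by (simp_all add: algebra_simps)
  qed
  ultimately show ?thesis by (simp add: complex_eq_iff)
qed

section \<open>Matrices with bounded finite sections\<close>

text \<open>Norm bounds for matrices are expressed by finite sections only, so that they are stable under
  entrywise limits.\<close>

definition matrix_bounded :: "real \<Rightarrow> 'b set \<Rightarrow> ('b \<Rightarrow> 'b \<Rightarrow> complex) \<Rightarrow> real \<Rightarrow> bool" where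
  "matrix_bounded p I M C \<longleftrightarrow> 0 \<le> C \<and> (\<forall>S T \<xi>. finite S \<longrightarrow> finite T \<longrightarrow> S \<subseteq> I \<longrightarrow> T \<subseteq> I \<longrightarrow>
    (\<Sum>i\<in>T. norm (\<Sum>j\<in>S. M i j * \<xi> j) powr p) \<le> C powr p * (\<Sum>j\<in>S. norm (\<xi> j) powr p))"

definition matrix_operator :: "'b set \<Rightarrow> ('b \<Rightarrow> 'b \<Rightarrow> complex) \<Rightarrow> ('b \<Rightarrow> complex) \<Rightarrow> 'b \<Rightarrow> complex" where
  "matrix_operator I M \<xi> i = (if i \<in> I then \<Sum>\<^sub>\<infinity>j\<in>I. M i j * \<xi> j else 0)"

lemma matrix_boundedD:
  assumes "matrix_bounded p I M C" "finite S" "finite T" "S \<subseteq> I" "T \<subseteq> I"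
  shows "(\<Sum>i\<in>T. norm (\<Sum>j\<in>S. M i j * \<xi> j) powr p) \<le> C powr p * (\<Sum>j\<in>S. norm (\<xi> j) powr p)"
  using assms unfolding matrix_bounded_def by blast

lemma matrix_bounded_nonneg: "matrix_bounded p I M C \<Longrightarrow> 0 \<le> C"
  by (simp add: matrix_bounded_def)

lemma matrix_bounded_cong:
  assumes "\<And>i j. i \<in> I \<Longrightarrow> j \<in> I \<Longrightarrow> M i j = M' i j"
  shows "matrix_bounded p I M C \<longleftrightarrow> matrix_bounded p I M' C"
proof -
  have "(\<Sum>i\<in>T. norm (\<Sum>j\<in>S. M i j * \<xi> j) powr p) = (\<Sum>i\<in>T. norm (\<Sum>j\<in>S. M' i j * \<xi> j) powr p)"
    if "S \<subseteq> I" "T \<subseteq> I" for S T \<xi>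
    using that assms by (intro sum.cong arg_cong[where f = "\<lambda>z. norm z powr p"]) auto
  then show ?thesis unfolding matrix_bounded_def by (intro conj_cong refl all_cong1 imp_cong) simp
qed

context
  fixes p :: real
  assumes p: "1 \<le> p"
begin

lemma powr_le_imp_le:
  fixes x C :: real
  assumes "x powr p \<le> C powr p" "0 \<le> x" "0 \<le> C" shows "x \<le> C"
  using assms p powr_less_mono2[of p C x] by force

lemma matrix_bounded_entry:
  assumes "matrix_bounded p I M C" "i \<in> I" "j \<in> I"
  shows "norm (M i j) \<le> C"
  using matrix_boundedD[OF assms(1), of "{j}" "{i}" "\<lambda>_. 1"] assms(2,3) matrix_bounded_nonneg[OF assms(1)]
  by (auto intro: powr_le_imp_le)

lemma matrix_bounded_mono:
  assumes "matrix_bounded p I M C" "C \<le> D"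
  shows "matrix_bounded p I M D"
  unfolding matrix_bounded_def
proof (intro conjI allI impI)
  fix S T \<xi> assume *: "finite S" "finite T" "S \<subseteq> I" "T \<subseteq> I"
  have "(\<Sum>i\<in>T. norm (\<Sum>j\<in>S. M i j * \<xi> j) powr p) \<le> C powr p * (\<Sum>j\<in>S. norm (\<xi> j) powr p)"
    by (rule matrix_boundedD[OF assms(1) *])
  also have "\<dots> \<le> D powr p * (\<Sum>j\<in>S. norm (\<xi> j) powr p)"
    using assms matrix_bounded_nonneg p by (intro mult_right_mono powr_mono2 sum_nonneg) auto
  finally show "(\<Sum>i\<in>T. norm (\<Sum>j\<in>S. M i j * \<xi> j) powr p) \<le> D powr p * (\<Sum>j\<in>S. norm (\<xi> j) powr p)" .
qed (use assms matrix_bounded_nonneg[OF assms(1)] in linarith)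

lemma matrix_bounded_add:
  assumes M: "matrix_bounded p I M C" and M': "matrix_bounded p I M' D"
  shows "matrix_bounded p I (\<lambda>i j. M i j + M' i j) (C + D)"
  unfolding matrix_bounded_def
proof (intro conjI allI impI)
  fix S T \<xi> assume *: "finite S" "finite T" "S \<subseteq> I" "T \<subseteq> I"
  show "(\<Sum>i\<in>T. norm (\<Sum>j\<in>S. (M i j + M' i j) * \<xi> j) powr p) \<le> (C + D) powr p * (\<Sum>j\<in>S. norm (\<xi> j) powr p)"
    using Minkowski_powr_sum[OF p *(2) _ _ _ matrix_boundedD[OF M *, of \<xi>] matrix_boundedD[OF M' *, of \<xi>]]
      matrix_bounded_nonneg[OF M] matrix_bounded_nonneg[OF M']
    by (simp add: sum.distrib distrib_right sum_nonneg)
qed (use matrix_bounded_nonneg[OF M] matrix_bounded_nonneg[OF M'] in simp)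

lemma matrix_bounded_mult_const:
  assumes M: "matrix_bounded p I M C"
  shows "matrix_bounded p I (\<lambda>i j. c * M i j) (norm c * C)"
  unfolding matrix_bounded_def
proof (intro conjI allI impI)
  fix S T \<xi> assume *: "finite S" "finite T" "S \<subseteq> I" "T \<subseteq> I"
  have "(\<Sum>i\<in>T. norm (\<Sum>j\<in>S. c * M i j * \<xi> j) powr p) = norm c powr p * (\<Sum>i\<in>T. norm (\<Sum>j\<in>S. M i j * \<xi> j) powr p)"
    by (simp add: mult.assoc sum_distrib_left[symmetric] norm_mult powr_mult)
  also have "\<dots> \<le> norm c powr p * (C powr p * (\<Sum>j\<in>S. norm (\<xi> j) powr p))"
    by (intro mult_left_mono matrix_boundedD[OF M *]) auto
  finally show "(\<Sum>i\<in>T. norm (\<Sum>j\<in>S. c * M i j * \<xi> j) powr p) \<le> (norm c * C) powr p * (\<Sum>j\<in>S. norm (\<xi> j) powr p)"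
    using matrix_bounded_nonneg[OF M] by (simp add: powr_mult mult.assoc)
qed (use matrix_bounded_nonneg[OF M] in simp)

lemma matrix_bounded_limit:
  assumes M: "\<And>n. n \<ge> n0 \<Longrightarrow> matrix_bounded p I (M n) (C' n)"
    and lim: "\<And>i j. i \<in> I \<Longrightarrow> j \<in> I \<Longrightarrow> (\<lambda>n::nat. M n i j) \<longlonglongrightarrow> L i j" and C': "C' \<longlonglongrightarrow> C"
  shows "matrix_bounded p I L C"
  unfolding matrix_bounded_def
proof (intro conjI allI impI)
  have nonneg: "0 \<le> C' n" if "n \<ge> n0" for n using matrix_bounded_nonneg[OF M[OF that]] .
  {
    fix S T \<xi> assume *: "finite S" "finite T" "S \<subseteq> I" "T \<subseteq> I"
    have "(\<lambda>n. \<Sum>i\<in>T. norm (\<Sum>j\<in>S. M n i j * \<xi> j) powr p) \<longlonglongrightarrow> (\<Sum>i\<in>T. norm (\<Sum>j\<in>S. L i j * \<xi> j) powr p)"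
      using * p by (intro tendsto_sum tendsto_powr' tendsto_norm tendsto_mult lim tendsto_const) auto
    moreover have "(\<lambda>n. C' n powr p * (\<Sum>j\<in>S. norm (\<xi> j) powr p)) \<longlonglongrightarrow> C powr p * (\<Sum>j\<in>S. norm (\<xi> j) powr p)"
      using p nonneg by (intro tendsto_mult tendsto_powr' C' tendsto_const)
        (auto intro!: eventually_sequentiallyI[of n0])
    ultimately show "(\<Sum>i\<in>T. norm (\<Sum>j\<in>S. L i j * \<xi> j) powr p) \<le> C powr p * (\<Sum>j\<in>S. norm (\<xi> j) powr p)"
      by (rule LIMSEQ_le) (use matrix_boundedD[OF M *] in blast)
  }
  show "0 \<le> C" using LIMSEQ_le_const[OF C'] nonneg by blast
qed

text \<open>Because the columns of M' have finite support, M' maps a finitely supported vector to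
  one supported in a finite set, the union J of the sets F k. Two finite-section bounds can
  therefore be composed without any infinite sum.\<close>

lemma matrix_bounded_mult:
  assumes M: "matrix_bounded p I M C" and M': "matrix_bounded p I M' D"
    and F: "\<And>k. k \<in> I \<Longrightarrow> finite (F k)" "\<And>k. k \<in> I \<Longrightarrow> F k \<subseteq> I"
      "\<And>j k. j \<in> I \<Longrightarrow> k \<in> I \<Longrightarrow> j \<notin> F k \<Longrightarrow> M' j k = 0"
    and L: "\<And>i k. i \<in> I \<Longrightarrow> k \<in> I \<Longrightarrow> L i k = (\<Sum>j\<in>F k. M i j * M' j k)"
  shows "matrix_bounded p I L (C * D)"
  unfolding matrix_bounded_def
proof (intro conjI allI impI)
  fix S T \<xi> assume *: "finite S" "finite T" "S \<subseteq> I" "T \<subseteq> I"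
  define J where "J = (\<Union>k\<in>S. F k)"
  have J: "finite J" "J \<subseteq> I" using * F(1,2) unfolding J_def by blast+
  have "(\<Sum>k\<in>S. L i k * \<xi> k) = (\<Sum>j\<in>J. M i j * (\<Sum>k\<in>S. M' j k * \<xi> k))" if "i \<in> I" for i
  proof -
    have "(\<Sum>k\<in>S. L i k * \<xi> k) = (\<Sum>k\<in>S. \<Sum>j\<in>J. M i j * M' j k * \<xi> k)"
    proof (rule sum.cong[OF refl])
      fix k assume k: "k \<in> S"
      have "(\<Sum>j\<in>F k. M i j * M' j k) = (\<Sum>j\<in>J. M i j * M' j k)"
      proof (rule sum.mono_neutral_left)
        show "F k \<subseteq> J" using k by (auto simp: J_def)
        show "\<forall>j\<in>J - F k. M i j * M' j k = 0"
          using J * k F(3)[of _ k] by (metis DiffD1 DiffD2 mult_zero_right subsetD)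
      qed (use J in auto)
      then show "L i k * \<xi> k = (\<Sum>j\<in>J. M i j * M' j k * \<xi> k)"
        using L[OF that, of k] k * by (auto simp: sum_distrib_right)
    qed
    also have "\<dots> = (\<Sum>j\<in>J. \<Sum>k\<in>S. M i j * M' j k * \<xi> k)" by (rule sum.swap)
    finally show ?thesis by (simp add: sum_distrib_left mult.assoc)
  qed
  then have "(\<Sum>i\<in>T. norm (\<Sum>k\<in>S. L i k * \<xi> k) powr p)
      = (\<Sum>i\<in>T. norm (\<Sum>j\<in>J. M i j * (\<Sum>k\<in>S. M' j k * \<xi> k)) powr p)"
    using * by (intro sum.cong) auto
  also have "\<dots> \<le> C powr p * (\<Sum>j\<in>J. norm (\<Sum>k\<in>S. M' j k * \<xi> k) powr p)"
    by (rule matrix_boundedD[OF M J(1) *(2) J(2) *(4)])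
  also have "\<dots> \<le> C powr p * (D powr p * (\<Sum>k\<in>S. norm (\<xi> k) powr p))"
    by (intro mult_left_mono matrix_boundedD[OF M' *(1) J(1) *(3) J(2)]) auto
  finally show "(\<Sum>i\<in>T. norm (\<Sum>j\<in>S. L i j * \<xi> j) powr p) \<le> (C * D) powr p * (\<Sum>j\<in>S. norm (\<xi> j) powr p)"
    using matrix_bounded_nonneg[OF M] matrix_bounded_nonneg[OF M'] by (simp add: powr_mult mult.assoc)
qed (use matrix_bounded_nonneg[OF M] matrix_bounded_nonneg[OF M'] in simp)

text \<open>The column k of M' has p-norm at most D. Rotating the phases of its entries keeps that
  norm and makes all terms of the product with row i nonnegative, so nothing cancels. This is the
  source of absolute convergence for elements of the completion, whose rows and columns may be
  infinite.\<close>

lemma matrix_bounded_row_column: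
  assumes M: "matrix_bounded p I M C" and M': "matrix_bounded p I M' D"
    and J: "finite J" "J \<subseteq> I" and ik: "i \<in> I" "k \<in> I"
  shows "(\<Sum>j\<in>J. norm (M i j) * norm (M' j k)) \<le> C * D"
proof -
  have column: "(\<Sum>j\<in>J. norm (M' j k) powr p) \<le> D powr p"
    using matrix_boundedD[OF M', of "{k}" J "\<lambda>_. 1"] J ik by simp
  \<comment> \<open>The phase is set to 1 where the product vanishes: \<open>sgn 0\<close> is 0 and
    would destroy \<open>norm (\<xi> j) = norm (M' j k)\<close> at places where only M i j is
    0.\<close>
  define \<xi> where "\<xi> j = (if M i j * M' j k = 0 then 1 else cnj (sgn (M i j * M' j k))) * M' j k" for j
  have \<xi>: "norm (\<xi> j) = norm (M' j k)" for j
    by (auto simp: \<xi>_def norm_mult norm_sgn)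
  have sgn: "cnj (sgn z) * z = of_real (norm z)" for z :: complex
  proof (cases "z = 0")
    case False
    have "cnj (sgn z) * z = of_real ((norm z)\<^sup>2) / of_real (norm z)"
      by (simp only: complex_norm_square) (simp add: sgn_eq mult.commute)
    then show ?thesis using False by (simp add: power2_eq_square)
  qed simp
  have M\<xi>: "M i j * \<xi> j = of_real (norm (M i j) * norm (M' j k))" for j
    using sgn[of "M i j * M' j k"] by (auto simp: \<xi>_def norm_mult mult_ac)
  have "norm (\<Sum>j\<in>J. M i j * \<xi> j) powr p \<le> C powr p * (\<Sum>j\<in>J. norm (\<xi> j) powr p)"
    using matrix_boundedD[OF M, of J "{i}" \<xi>] J ik by simp
  also have "\<dots> \<le> C powr p * D powr p"
    unfolding \<xi> by (intro mult_left_mono column) auto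
  also have "\<dots> = (C * D) powr p"
    using matrix_bounded_nonneg[OF M] matrix_bounded_nonneg[OF M'] by (simp add: powr_mult)
  finally have "norm (\<Sum>j\<in>J. M i j * \<xi> j) \<le> C * D"
    using matrix_bounded_nonneg[OF M] matrix_bounded_nonneg[OF M']
    by (rule powr_le_imp_le[OF _ norm_ge_zero mult_nonneg_nonneg])
  moreover have "norm (\<Sum>j\<in>J. M i j * \<xi> j) = (\<Sum>j\<in>J. norm (M i j) * norm (M' j k))"
    unfolding M\<xi> of_real_sum[symmetric] by (subst norm_of_real) (simp add: sum_nonneg)
  ultimately show ?thesis by simp
qed

lemma matrix_bounded_diagonal:
  assumes "\<And>i. i \<in> I \<Longrightarrow> norm (d i) \<le> C" "0 \<le> C"
  shows "matrix_bounded p I (\<lambda>i j. if i = j then d i else 0) C"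
  unfolding matrix_bounded_def
proof (intro conjI allI impI)
  fix S T \<xi> assume *: "finite S" "finite T" "S \<subseteq> I" "T \<subseteq> I"
  have "(\<Sum>i\<in>T. norm (\<Sum>j\<in>S. (if i = j then d i else 0) * \<xi> j) powr p)
      = (\<Sum>i\<in>T. if i \<in> S then norm (d i * \<xi> i) powr p else 0)"
  proof (rule sum.cong[OF refl])
    fix i
    have "(\<Sum>j\<in>S. (if i = j then d i else 0) * \<xi> j) = (\<Sum>j\<in>S. if i = j then d j * \<xi> j else 0)"
      by (intro sum.cong) auto
    also have "\<dots> = (if i \<in> S then d i * \<xi> i else 0)" using *(1) by (rule sum.delta')
    finally show "norm (\<Sum>j\<in>S. (if i = j then d i else 0) * \<xi> j) powr p
        = (if i \<in> S then norm (d i * \<xi> i) powr p else 0)" by simp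
  qed
  also have "\<dots> = (\<Sum>i\<in>T \<inter> S. norm (d i * \<xi> i) powr p)"
    using * by (simp add: sum.inter_restrict)
  also have "\<dots> \<le> (\<Sum>i\<in>S. norm (d i * \<xi> i) powr p)"
    using * by (intro sum_mono2) auto
  also have "\<dots> \<le> (\<Sum>i\<in>S. C powr p * norm (\<xi> i) powr p)"
    unfolding norm_mult using * assms p
    by (intro sum_mono) (auto simp: powr_mult intro!: mult_right_mono powr_mono2)
  finally show "(\<Sum>i\<in>T. norm (\<Sum>j\<in>S. (if i = j then d i else 0) * \<xi> j) powr p)
      \<le> C powr p * (\<Sum>j\<in>S. norm (\<xi> j) powr p)"
    by (simp add: sum_distrib_left)
qed (use assms in simp)

text \<open>Origin of the constant: a row sum has at most n terms, so it is bounded by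
  \<open>n * K\<close> times the largest entry of \<xi> that it sees, and the p-th power of that
  entry is at most the sum over the row. Summing over rows counts each column at most n times, which
  costs the factor \<open>n powr (1 / p)\<close>.\<close>

lemma matrix_bounded_sparse:
  assumes row: "\<And>i. i \<in> I \<Longrightarrow> finite {j\<in>I. M i j \<noteq> 0} \<and> card {j\<in>I. M i j \<noteq> 0} \<le> n"
    and col: "\<And>j. j \<in> I \<Longrightarrow> finite {i\<in>I. M i j \<noteq> 0} \<and> card {i\<in>I. M i j \<noteq> 0} \<le> n"
    and K: "\<And>i j. i \<in> I \<Longrightarrow> j \<in> I \<Longrightarrow> norm (M i j) \<le> K" "0 \<le> K"
  shows "matrix_bounded p I M (real n * K * real n powr (1 / p))"
  unfolding matrix_bounded_def
proof (intro conjI allI impI)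
  fix S T \<xi> assume *: "finite S" "finite T" "S \<subseteq> I" "T \<subseteq> I"
  let ?R = "\<lambda>i. {j\<in>S. M i j \<noteq> 0}" and ?c = "(real n * K) powr p"
  have row_est: "norm (\<Sum>j\<in>S. M i j * \<xi> j) powr p \<le> (\<Sum>j\<in>?R i. ?c * norm (\<xi> j) powr p)" if i: "i \<in> T" for i
  proof (cases "?R i = {}")
    case True
    then have "(\<Sum>j\<in>S. M i j * \<xi> j) = 0" by (intro sum.neutral) auto
    then show ?thesis by (simp add: sum_nonneg)
  next
    case False
    have fin: "finite (?R i)" using * by simp
    define m where "m = Max ((\<lambda>j. norm (\<xi> j)) ` ?R i)"
    have m: "norm (\<xi> j) \<le> m" if "j \<in> ?R i" for j
      unfolding m_def using fin that by (intro Max_ge) auto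
    obtain j0 where j0: "j0 \<in> ?R i" "norm (\<xi> j0) = m"
      using Max_in[of "(\<lambda>j. norm (\<xi> j)) ` ?R i"] fin False unfolding m_def by (auto simp: image_iff)
    have "card (?R i) \<le> card {j\<in>I. M i j \<noteq> 0}"
      using row * i by (intro card_mono) auto
    then have card: "card (?R i) \<le> n" using row[of i] * i by auto
    have "norm (\<Sum>j\<in>S. M i j * \<xi> j) = norm (\<Sum>j\<in>?R i. M i j * \<xi> j)"
      using * by (intro arg_cong[where f = norm] sum.mono_neutral_right) auto
    also have "\<dots> \<le> (\<Sum>j\<in>?R i. K * m)"
      using K * i m by (intro sum_norm_le) (auto simp: norm_mult intro!: mult_mono)
    also have "\<dots> = real (card (?R i)) * (K * m)" by simp
    also have "\<dots> \<le> real n * (K * m)"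
      using card K(2) j0(2) norm_ge_zero[of "\<xi> j0"] by (intro mult_right_mono mult_nonneg_nonneg) auto
    finally have "norm (\<Sum>j\<in>S. M i j * \<xi> j) powr p \<le> (real n * (K * m)) powr p"
      using p by (intro powr_mono2) auto
    also have "\<dots> = ?c * norm (\<xi> j0) powr p"
      using j0(2) K(2) norm_ge_zero[of "\<xi> j0"] by (simp add: powr_mult mult.assoc)
    also have "\<dots> \<le> (\<Sum>j\<in>?R i. ?c * norm (\<xi> j) powr p)"
      using fin j0(1) by (intro member_le_sum) auto
    finally show ?thesis .
  qed
  have "(\<Sum>i\<in>T. norm (\<Sum>j\<in>S. M i j * \<xi> j) powr p) \<le> (\<Sum>i\<in>T. \<Sum>j\<in>?R i. ?c * norm (\<xi> j) powr p)"
    by (intro sum_mono row_est)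
  also have "\<dots> = (\<Sum>i\<in>T. \<Sum>j\<in>S. if M i j \<noteq> 0 then ?c * norm (\<xi> j) powr p else 0)"
    using * by (intro sum.cong refl sum.inter_filter)
  also have "\<dots> = (\<Sum>j\<in>S. \<Sum>i\<in>T. if M i j \<noteq> 0 then ?c * norm (\<xi> j) powr p else 0)"
    by (rule sum.swap)
  also have "\<dots> = (\<Sum>j\<in>S. real (card {i\<in>T. M i j \<noteq> 0}) * (?c * norm (\<xi> j) powr p))"
    using * by (intro sum.cong refl) (simp flip: sum.inter_filter)
  also have "\<dots> \<le> (\<Sum>j\<in>S. real n * (?c * norm (\<xi> j) powr p))"
  proof (intro sum_mono mult_right_mono)
    fix j assume j: "j \<in> S"
    have "card {i\<in>T. M i j \<noteq> 0} \<le> card {i\<in>I. M i j \<noteq> 0}"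
      using col[of j] j * by (intro card_mono) auto
    then show "real (card {i\<in>T. M i j \<noteq> 0}) \<le> real n" using col[of j] j * by auto
  qed auto
  also have "\<dots> = (real n * K * real n powr (1 / p)) powr p * (\<Sum>j\<in>S. norm (\<xi> j) powr p)"
    using p K(2) by (simp add: powr_mult powr_powr sum_distrib_left mult_ac)
  finally show "(\<Sum>i\<in>T. norm (\<Sum>j\<in>S. M i j * \<xi> j) powr p)
      \<le> (real n * K * real n powr (1 / p)) powr p * (\<Sum>j\<in>S. norm (\<xi> j) powr p)" .
qed (use K(2) in simp)

text \<open>Finitely many rows with finite support see only a finite part S of the vector, so the
  finite-section bound applies although \<xi> may have infinite support.\<close>

lemma matrix_operator_finite_sum_le:
  assumes M: "matrix_bounded p I M C"
    and row: "\<And>i. i \<in> I \<Longrightarrow> finite {j\<in>I. M i j \<noteq> 0}"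
    and \<xi>: "\<xi> \<in> lp_space p I" "lp_norm p I \<xi> \<le> 1" and T: "finite T" "T \<subseteq> I"
  shows "(\<Sum>i\<in>T. norm (matrix_operator I M \<xi> i) powr p) \<le> C powr p"
proof -
  define S where "S = (\<Union>i\<in>T. {j\<in>I. M i j \<noteq> 0})"
  have S: "finite S" "S \<subseteq> I" using T row by (auto simp: S_def)
  have "matrix_operator I M \<xi> i = (\<Sum>j\<in>S. M i j * \<xi> j)" if "i \<in> T" for i
  proof -
    have "(\<Sum>\<^sub>\<infinity>j\<in>I. M i j * \<xi> j) = (\<Sum>\<^sub>\<infinity>j\<in>S. M i j * \<xi> j)"
      using that S by (intro infsum_cong_neutral) (auto simp: S_def)
    then show ?thesis using that T S by (auto simp: matrix_operator_def)
  qed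
  then have "(\<Sum>i\<in>T. norm (matrix_operator I M \<xi> i) powr p) = (\<Sum>i\<in>T. norm (\<Sum>j\<in>S. M i j * \<xi> j) powr p)"
    by simp
  also have "\<dots> \<le> C powr p * (\<Sum>j\<in>S. norm (\<xi> j) powr p)"
    by (rule matrix_boundedD[OF M S(1) T(1) S(2) T(2)])
  also have "\<dots> \<le> C powr p * 1"
  proof (rule mult_left_mono)
    have "(\<Sum>\<^sub>\<infinity>i\<in>I. norm (\<xi> i) powr p) powr (1 / p) \<le> 1 powr (1 / p)"
      using \<xi>(2) by (simp add: lp_norm_def)
    then have "(\<Sum>\<^sub>\<infinity>i\<in>I. norm (\<xi> i) powr p) \<le> 1"
      using p powr_less_mono2[of "1/p" 1 "\<Sum>\<^sub>\<infinity>i\<in>I. norm (\<xi> i) powr p"]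
      by (meson less_le_not_le linorder_not_le order_less_le_trans zero_le_one zero_less_divide_1_iff zero_less_one)
    moreover have "(\<Sum>j\<in>S. norm (\<xi> j) powr p) \<le> (\<Sum>\<^sub>\<infinity>i\<in>I. norm (\<xi> i) powr p)"
      using \<xi>(1) S by (intro finite_sum_le_infsum) (auto simp: lp_space_def)
    ultimately show "(\<Sum>j\<in>S. norm (\<xi> j) powr p) \<le> 1" by linarith
  qed simp
  finally show ?thesis by simp
qed

lemma matrix_operator_summable:
  assumes "matrix_bounded p I M C" "\<And>i. i \<in> I \<Longrightarrow> finite {j\<in>I. M i j \<noteq> 0}"
    and "\<xi> \<in> lp_space p I" "lp_norm p I \<xi> \<le> 1"
  shows "(\<lambda>i. norm (matrix_operator I M \<xi> i) powr p) summable_on I"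
  by (rule nonneg_bounded_partial_sums_imp_summable_on[of _ _ "C powr p"])
    (auto intro!: eventually_finite_subsets_at_top_weakI matrix_operator_finite_sum_le[OF assms])

lemma lp_norm_matrix_operator_le:
  assumes "matrix_bounded p I M C" "\<And>i. i \<in> I \<Longrightarrow> finite {j\<in>I. M i j \<noteq> 0}"
    and "\<xi> \<in> lp_space p I" "lp_norm p I \<xi> \<le> 1"
  shows "lp_norm p I (matrix_operator I M \<xi>) \<le> C"
proof -
  have "(\<Sum>\<^sub>\<infinity>i\<in>I. norm (matrix_operator I M \<xi> i) powr p) \<le> C powr p"
    using matrix_operator_summable[OF assms] matrix_operator_finite_sum_le[OF assms]
    by (rule infsum_le_finite_sums)
  then have "lp_norm p I (matrix_operator I M \<xi>) \<le> (C powr p) powr (1 / p)"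
    unfolding lp_norm_def using p by (intro powr_mono2) (auto intro: infsum_nonneg)
  then show ?thesis using p matrix_bounded_nonneg[OF assms(1)] by (simp add: powr_powr)
qed

text \<open>\<open>lp_opnorm\<close> is a supremum of reals and carries information only if the set
  is bounded above; the a priori bound C0 ensures this. Passing back to finite sections means
  testing the operator on normalised finitely supported vectors.\<close>

lemma lp_opnorm_matrix_operator:
  assumes M: "matrix_bounded p I M C0" and row: "\<And>i. i \<in> I \<Longrightarrow> finite {j\<in>I. M i j \<noteq> 0}"
    and C: "0 \<le> C"
  shows "lp_opnorm p I (matrix_operator I M) \<le> C \<longleftrightarrow> matrix_bounded p I M C"
proof
  assume "matrix_bounded p I M C"
  moreover have "(\<lambda>_. 0) \<in> {\<xi> \<in> lp_space p I. lp_norm p I \<xi> \<le> 1}"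
    by (simp add: lp_space_def lp_norm_def)
  ultimately show "lp_opnorm p I (matrix_operator I M) \<le> C"
    unfolding lp_opnorm_def using row by (intro cSUP_least) (blast intro: lp_norm_matrix_operator_le)+
next
  assume le: "lp_opnorm p I (matrix_operator I M) \<le> C"
  have bdd: "bdd_above ((\<lambda>\<xi>. lp_norm p I (matrix_operator I M \<xi>)) ` {\<xi> \<in> lp_space p I. lp_norm p I \<xi> \<le> 1})"
    using lp_norm_matrix_operator_le[OF M row] by (intro bdd_aboveI2[of _ _ C0]) auto
  show "matrix_bounded p I M C"
    unfolding matrix_bounded_def
  proof (intro conjI allI impI C)
    fix S T and \<xi> :: "'a \<Rightarrow> complex" assume *: "finite S" "finite T" "S \<subseteq> I" "T \<subseteq> I"
    define s where "s = (\<Sum>j\<in>S. norm (\<xi> j) powr p)"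
    have s0: "s \<ge> 0" by (simp add: s_def sum_nonneg)
    show "(\<Sum>i\<in>T. norm (\<Sum>j\<in>S. M i j * \<xi> j) powr p) \<le> C powr p * (\<Sum>j\<in>S. norm (\<xi> j) powr p)"
    proof (cases "s = 0")
      case True
      then have "\<forall>j\<in>S. \<xi> j = 0" using sum_norm_powr_eq_0_iff[OF *(1)] by (simp add: s_def)
      then show ?thesis by simp
    next
      case False
      \<comment> \<open>r is the p-norm of the restriction of \<xi> to S, and \<eta> below is that
        restriction scaled to a unit vector.\<close>
      define r where "r = s powr (1 / p)"
      have r: "r > 0" and rp: "r powr p = s" using False s0 p by (auto simp: r_def powr_powr)
      define \<eta> where "\<eta> j = (if j \<in> S then \<xi> j / of_real r else 0)" for j
      have \<eta>_sum: "((\<lambda>j. norm (\<eta> j) powr p) has_sum 1) I"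
      proof -
        have "(\<Sum>j\<in>S. norm (\<eta> j) powr p) = (\<Sum>j\<in>S. norm (\<xi> j) powr p / s)"
          using r rp by (intro sum.cong) (auto simp: \<eta>_def norm_divide powr_divide)
        also have "\<dots> = 1" using False by (simp add: sum_divide_distrib[symmetric] s_def)
        finally have "((\<lambda>j. norm (\<eta> j) powr p) has_sum 1) S" using *(1) by (simp add: has_sum_finite_iff)
        then show ?thesis
          using has_sum_cong_neutral[of I S "\<lambda>j. norm (\<eta> j) powr p" "\<lambda>j. norm (\<eta> j) powr p" 1] *(3)
          by (auto simp: \<eta>_def)
      qed
      have \<eta>: "\<eta> \<in> lp_space p I" "lp_norm p I \<eta> \<le> 1"
        using \<eta>_sum *(3) infsumI[OF \<eta>_sum] has_sum_imp_summable[OF \<eta>_sum]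
        by (auto simp: lp_space_def lp_norm_def \<eta>_def)
      have "lp_norm p I (matrix_operator I M \<eta>) \<le> C"
        using cSUP_upper[OF _ bdd, of \<eta>] \<eta> le by (auto simp: lp_opnorm_def)
      then have "((\<Sum>\<^sub>\<infinity>i\<in>I. norm (matrix_operator I M \<eta> i) powr p) powr (1 / p)) powr p \<le> C powr p"
        unfolding lp_norm_def using p by (intro powr_mono2) auto
      then have "(\<Sum>\<^sub>\<infinity>i\<in>I. norm (matrix_operator I M \<eta> i) powr p) \<le> C powr p"
        using p by (simp add: powr_powr infsum_nonneg)
      moreover have "(\<Sum>i\<in>T. norm (matrix_operator I M \<eta> i) powr p)
          \<le> (\<Sum>\<^sub>\<infinity>i\<in>I. norm (matrix_operator I M \<eta> i) powr p)"
        using matrix_operator_summable[OF M row \<eta>] * by (intro finite_sum_le_infsum) auto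
      moreover have "norm (matrix_operator I M \<eta> i) powr p = norm (\<Sum>j\<in>S. M i j * \<xi> j) powr p / s" if "i \<in> T" for i
      proof -
        have "(\<Sum>\<^sub>\<infinity>j\<in>I. M i j * \<eta> j) = (\<Sum>\<^sub>\<infinity>j\<in>S. M i j * (\<xi> j / of_real r))"
          using *(3) by (intro infsum_cong_neutral) (auto simp: \<eta>_def)
        also have "\<dots> = (\<Sum>j\<in>S. M i j * \<xi> j) / of_real r"
          using *(1) by (simp add: sum_divide_distrib)
        finally show ?thesis using that * r rp
          by (auto simp: matrix_operator_def norm_divide powr_divide)
      qed
      ultimately have "(\<Sum>i\<in>T. norm (\<Sum>j\<in>S. M i j * \<xi> j) powr p / s) \<le> C powr p" by simp
      then show ?thesis
        unfolding sum_divide_distrib[symmetric] s_def[symmetric]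
        using False s0 by (simp add: pos_divide_le_eq)
    qed
  qed
qed

end

section \<open>Etale groupoids\<close>

lemma local_homeomorphism_open_map:
  assumes "local_homeomorphism X Y f" shows "open_map X Y f"
  unfolding open_map_def
proof (intro allI impI)
  fix O' assume O': "openin X O'"
  show "openin Y (f ` O')"
  proof (subst openin_subopen, intro ballI)
    fix y assume "y \<in> f ` O'"
    then obtain x where x: "x \<in> O'" "y = f x" by blast
    then have "x \<in> topspace X" using O' openin_subset by blast
    then obtain U where U: "openin X U" "x \<in> U" "openin Y (f ` U)"
      and h: "homeomorphic_map (subtopology X U) (subtopology Y (f ` U)) f"
      using assms unfolding local_homeomorphism_def by blast
    have "openin (subtopology X U) (O' \<inter> U)" using O' by (auto simp: openin_subtopology)
    then have "openin (subtopology Y (f ` U)) (f ` (O' \<inter> U))"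
      using homeomorphic_imp_open_map[OF h] by (simp add: open_map_def)
    then have "openin Y (f ` (O' \<inter> U))" using U(3) openin_trans_full by blast
    then show "\<exists>T. openin Y T \<and> y \<in> T \<and> T \<subseteq> f ` O'" using x U(2) by blast
  qed
qed

lemma local_homeomorphism_injective:
  assumes "local_homeomorphism X Y f" "x \<in> topspace X"
  obtains U where "openin X U" "x \<in> U" "inj_on f U"
proof -
  obtain U where U: "openin X U" "x \<in> U"
    and h: "homeomorphic_map (subtopology X U) (subtopology Y (f ` U)) f"
    using assms unfolding local_homeomorphism_def by blast
  have "inj_on f U"
    using homeomorphic_imp_injective_map[OF h] openin_subset[OF U(1)] by (simp add: Int_absorb1)
  then show thesis using that U by blast
qed

lemma continuous_map_locally:
  assumes "\<And>x. x \<in> topspace X \<Longrightarrow> \<exists>U. openin X U \<and> x \<in> U \<and> continuous_map (subtopology X U) Y f"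
  shows "continuous_map X Y f"
proof -
  obtain U where U: "\<And>x. x \<in> topspace X \<Longrightarrow> openin X (U x) \<and> x \<in> U x \<and> continuous_map (subtopology X (U x)) Y f"
    using assms by metis
  show ?thesis
    by (rule pasting_lemma[of "topspace X" X U Y "\<lambda>_. f"]) (use U in auto)
qed

lemma continuous_map_mult_euclidean:
  fixes f g :: "'a \<Rightarrow> 'b::real_normed_algebra"
  shows "continuous_map X euclidean f \<Longrightarrow> continuous_map X euclidean g \<Longrightarrow>
    continuous_map X euclidean (\<lambda>x. f x * g x)"
  by (simp add: continuous_map_atin tendsto_mult)

lemma Hausdorff_space_separate_finite:
  assumes X: "Hausdorff_space X" and "finite F" "F \<subseteq> topspace X"
  obtains U where "\<And>x. x \<in> F \<Longrightarrow> openin X (U x)" "\<And>x. x \<in> F \<Longrightarrow> x \<in> U x"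
    "\<And>x y. x \<in> F \<Longrightarrow> y \<in> F \<Longrightarrow> x \<noteq> y \<Longrightarrow> U x \<inter> U y = {}"
proof -
  have "\<exists>U V. openin X U \<and> openin X V \<and> x \<in> U \<and> y \<in> V \<and> disjnt U V" if "x \<in> F" "y \<in> F" "x \<noteq> y" for x y
    using X assms(3) that unfolding Hausdorff_space_def by (metis subsetD)
  then obtain U V where UV: "\<And>x y. x \<in> F \<Longrightarrow> y \<in> F \<Longrightarrow> x \<noteq> y \<Longrightarrow>
      openin X (U x y) \<and> openin X (V x y) \<and> x \<in> U x y \<and> y \<in> V x y \<and> disjnt (U x y) (V x y)"
    by metis
  \<comment> \<open>Intersecting with the whole space covers the case of a single point, where the
    intersection over the empty index set would be \<open>UNIV\<close>.\<close>
  define W where "W x = topspace X \<inter> (\<Inter>y\<in>F - {x}. U x y \<inter> V y x)" for x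
  show thesis
  proof
    fix x assume x: "x \<in> F"
    show "openin X (W x)"
      unfolding W_def using assms(2) UV x
      by (cases "F - {x} = {}") (simp only: INT_empty Int_UNIV_right openin_topspace,
          auto intro!: openin_Int openin_INT2)
    show "x \<in> W x" using assms(3) x UV by (auto simp: W_def)
    fix y assume y: "y \<in> F" "x \<noteq> y"
    have "W x \<subseteq> U x y" "W y \<subseteq> V x y" using x y by (auto simp: W_def)
    then show "W x \<inter> W y = {}" using UV[OF x y] by (auto simp: disjnt_def)
  qed
qed

section \<open>Algebra of arrows\<close>

context topological_groupoid
begin

lemma dom_inv: "\<gamma> \<in> arrows G \<Longrightarrow> gdom G (ginv G \<gamma>) = gran G \<gamma>"
  by (simp add: gdom_def gran_def inv_inv)

lemma ran_inv: "\<gamma> \<in> arrows G \<Longrightarrow> gran G (ginv G \<gamma>) = gdom G \<gamma>"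
  by (simp add: gdom_def gran_def inv_inv)

lemma ran_closed: "\<gamma> \<in> arrows G \<Longrightarrow> gran G \<gamma> \<in> arrows G"
  using dom_closed[OF inv_closed] dom_inv by metis

lemma composable_iff: "(\<gamma>, \<eta>) \<in> composable G \<longleftrightarrow> \<gamma> \<in> arrows G \<and> \<eta> \<in> arrows G \<and> gdom G \<gamma> = gran G \<eta>"
  by (simp add: composable_def)

lemma inv_composable: "\<gamma> \<in> arrows G \<Longrightarrow> (ginv G \<gamma>, \<gamma>) \<in> composable G"
  by (simp add: composable_iff inv_closed dom_inv)

lemma composable_inv: "\<gamma> \<in> arrows G \<Longrightarrow> (\<gamma>, ginv G \<gamma>) \<in> composable G"
  by (simp add: composable_iff inv_closed ran_inv)

lemma dom_dom: "\<gamma> \<in> arrows G \<Longrightarrow> gdom G (gdom G \<gamma>) = gdom G \<gamma>"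
  using dom_mult[OF inv_composable, of \<gamma>] by (simp flip: gdom_def[of G \<gamma>])

lemma ran_dom: "\<gamma> \<in> arrows G \<Longrightarrow> gran G (gdom G \<gamma>) = gdom G \<gamma>"
  using ran_mult[OF inv_composable, of \<gamma>] ran_inv[of \<gamma>] by (simp flip: gdom_def[of G \<gamma>])

lemma dom_ran: "\<gamma> \<in> arrows G \<Longrightarrow> gdom G (gran G \<gamma>) = gran G \<gamma>"
  using dom_dom[OF inv_closed] dom_inv by metis

lemma units_iff: "x \<in> units G \<longleftrightarrow> x \<in> arrows G \<and> gdom G x = x"
  unfolding units_def using dom_closed dom_dom by (metis imageE image_eqI)

lemma units_arrows: "x \<in> units G \<Longrightarrow> x \<in> arrows G"
  and dom_unit: "x \<in> units G \<Longrightarrow> gdom G x = x"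
  by (auto simp: units_iff)

lemma ran_unit: "x \<in> units G \<Longrightarrow> gran G x = x"
  using ran_dom[of x] by (simp add: units_iff)

lemma dom_units: "\<gamma> \<in> arrows G \<Longrightarrow> gdom G \<gamma> \<in> units G"
  by (simp add: units_def)

lemma ran_units: "\<gamma> \<in> arrows G \<Longrightarrow> gran G \<gamma> \<in> units G"
  by (simp add: units_iff ran_closed dom_ran)

lemma inv_unit:
  assumes "x \<in> units G" shows "ginv G x = x"
proof -
  have "gmult G (ginv G x) x = x" using assms by (simp add: units_iff gdom_def)
  moreover have "gmult G (ginv G x) x = ginv G x"
    using mult_dom[OF inv_closed[OF units_arrows[OF assms]]] dom_inv[OF units_arrows[OF assms]]
    by (simp add: ran_unit[OF assms])
  ultimately show ?thesis by simp
qed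

lemma inv_mult_cancel:
  assumes "(\<gamma>, \<eta>) \<in> composable G" shows "gmult G (ginv G \<gamma>) (gmult G \<gamma> \<eta>) = \<eta>"
proof -
  have g: "\<gamma> \<in> arrows G" "\<eta> \<in> arrows G" "gdom G \<gamma> = gran G \<eta>" using assms by (auto simp: composable_iff)
  have "gmult G (ginv G \<gamma>) (gmult G \<gamma> \<eta>) = gmult G (gdom G \<gamma>) \<eta>"
    using assoc[OF inv_composable[OF g(1)] assms] by (simp add: gdom_def)
  then show ?thesis using ran_mult_self g by simp
qed

lemma mult_inv_cancel:
  assumes "(\<gamma>, \<eta>) \<in> composable G" shows "gmult G (gmult G \<gamma> \<eta>) (ginv G \<eta>) = \<gamma>"
proof -
  have g: "\<gamma> \<in> arrows G" "\<eta> \<in> arrows G" "gdom G \<gamma> = gran G \<eta>" using assms by (auto simp: composable_iff)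
  have "gmult G (gmult G \<gamma> \<eta>) (ginv G \<eta>) = gmult G \<gamma> (gran G \<eta>)"
    using assoc[OF assms composable_inv[OF g(2)]] by (simp add: gran_def)
  then show ?thesis using mult_dom[OF g(1)] g(3) by simp
qed

lemma inv_mult:
  assumes "(\<gamma>, \<eta>) \<in> composable G" shows "ginv G (gmult G \<gamma> \<eta>) = gmult G (ginv G \<eta>) (ginv G \<gamma>)"
proof -
  let ?x = "gmult G \<gamma> \<eta>"
  have g: "\<gamma> \<in> arrows G" "\<eta> \<in> arrows G" "gdom G \<gamma> = gran G \<eta>" using assms by (auto simp: composable_iff)
  have x: "?x \<in> arrows G" "gdom G ?x = gdom G \<eta>" "gran G ?x = gran G \<gamma>"
    using assms mult_closed dom_mult ran_mult by auto
  have c1: "(ginv G \<eta>, ginv G \<gamma>) \<in> composable G"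
    using g by (simp add: composable_iff inv_closed dom_inv ran_inv)
  have c2: "(?x, ginv G \<eta>) \<in> composable G"
    using g x by (simp add: composable_iff inv_closed dom_inv ran_inv)
  have "gmult G ?x (gmult G (ginv G \<eta>) (ginv G \<gamma>)) = gran G \<gamma>"
    using assoc[OF c2 c1] mult_inv_cancel[OF assms] by (simp add: gran_def)
  then have "gmult G (ginv G ?x) (gran G \<gamma>) = gmult G (ginv G \<eta>) (ginv G \<gamma>)"
    using inv_mult_cancel[of ?x "gmult G (ginv G \<eta>) (ginv G \<gamma>)"] c1 c2 x
    by (simp add: composable_iff mult_closed ran_mult)
  moreover have "gmult G (ginv G ?x) (gran G \<gamma>) = ginv G ?x"
    using mult_dom[OF inv_closed[OF x(1)]] dom_inv[OF x(1)] x(3) by simp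
  ultimately show ?thesis by simp
qed

lemma dom_fibre_iff: "\<sigma> \<in> dom_fibre G x \<longleftrightarrow> \<sigma> \<in> arrows G \<and> gdom G \<sigma> = x"
  by (simp add: dom_fibre_def)

lemma dom_fibre_unit: "x \<in> units G \<Longrightarrow> x \<in> dom_fibre G x"
  by (simp add: dom_fibre_iff units_iff)

text \<open>For arrows \<gamma>, \<sigma> with common domain x,
  \<open>f (quot \<gamma> \<sigma>)\<close> is the (\<gamma>, \<sigma>) entry of the matrix by which
  f acts in the left regular representation on the fibre over x.\<close>

definition quot :: "'g \<Rightarrow> 'g \<Rightarrow> 'g" where
  "quot \<gamma> \<sigma> = gmult G \<gamma> (ginv G \<sigma>)"

lemma quot_props:
  assumes "\<gamma> \<in> dom_fibre G x" "\<sigma> \<in> dom_fibre G x"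
  shows quot_composable: "(\<gamma>, ginv G \<sigma>) \<in> composable G"
    and quot_closed: "quot \<gamma> \<sigma> \<in> arrows G"
    and dom_quot: "gdom G (quot \<gamma> \<sigma>) = gran G \<sigma>"
    and ran_quot: "gran G (quot \<gamma> \<sigma>) = gran G \<gamma>"
    and inv_quot: "ginv G (quot \<gamma> \<sigma>) = quot \<sigma> \<gamma>"
    and quot_mult: "gmult G (quot \<gamma> \<sigma>) \<sigma> = \<gamma>"
proof -
  show c: "(\<gamma>, ginv G \<sigma>) \<in> composable G"
    using assms by (simp add: dom_fibre_iff composable_iff inv_closed ran_inv)
  then show "quot \<gamma> \<sigma> \<in> arrows G" "gdom G (quot \<gamma> \<sigma>) = gran G \<sigma>" "gran G (quot \<gamma> \<sigma>) = gran G \<gamma>"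
    using assms by (simp_all add: quot_def mult_closed dom_mult ran_mult dom_inv dom_fibre_iff)
  show "ginv G (quot \<gamma> \<sigma>) = quot \<sigma> \<gamma>"
    using inv_mult[OF c] assms by (simp add: quot_def inv_inv dom_fibre_iff)
  show "gmult G (quot \<gamma> \<sigma>) \<sigma> = \<gamma>"
    using mult_inv_cancel[OF c] assms by (simp add: quot_def inv_inv dom_fibre_iff)
qed

lemma quot_self: "\<gamma> \<in> arrows G \<Longrightarrow> quot \<gamma> \<gamma> = gran G \<gamma>"
  by (simp add: quot_def gran_def)

lemma quot_unit: "x \<in> units G \<Longrightarrow> \<gamma> \<in> dom_fibre G x \<Longrightarrow> quot \<gamma> x = \<gamma>"
  using mult_dom[of \<gamma>] by (simp add: quot_def inv_unit dom_fibre_iff)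

lemma unit_quot: "x \<in> units G \<Longrightarrow> \<gamma> \<in> dom_fibre G x \<Longrightarrow> quot x \<gamma> = ginv G \<gamma>"
  using inv_quot[of \<gamma> x x] quot_unit dom_fibre_unit by simp

text \<open>This is why functions supported on the units act by diagonal matrices, and why the unit
  of the algebra acts as the identity matrix.\<close>

lemma quot_units_iff:
  assumes "\<gamma> \<in> dom_fibre G x" "\<sigma> \<in> dom_fibre G x"
  shows "quot \<gamma> \<sigma> \<in> units G \<longleftrightarrow> \<gamma> = \<sigma>"
proof
  assume u: "quot \<gamma> \<sigma> \<in> units G"
  then have "quot \<gamma> \<sigma> = gran G \<sigma>" using dom_quot[OF assms] by (simp add: units_iff)
  then show "\<gamma> = \<sigma>" using quot_mult[OF assms] ran_mult_self[of \<sigma>] assms by (simp add: dom_fibre_iff)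
qed (use assms quot_self ran_units in \<open>auto simp: dom_fibre_iff\<close>)

lemma quot_quot:
  assumes "\<gamma> \<in> dom_fibre G x" "\<sigma> \<in> dom_fibre G x" "\<tau> \<in> dom_fibre G x"
  shows "quot (quot \<gamma> \<tau>) (quot \<sigma> \<tau>) = quot \<gamma> \<sigma>"
proof -
  have c1: "(quot \<gamma> \<tau>, \<tau>) \<in> composable G" and c2: "(\<tau>, ginv G \<sigma>) \<in> composable G"
    using assms by (auto simp: composable_iff quot_closed dom_quot dom_fibre_iff inv_closed ran_inv)
  have "quot (quot \<gamma> \<tau>) (quot \<sigma> \<tau>) = gmult G (quot \<gamma> \<tau>) (gmult G \<tau> (ginv G \<sigma>))"
    using inv_quot[OF assms(2,3)] by (simp add: quot_def)
  also have "\<dots> = gmult G (gmult G (quot \<gamma> \<tau>) \<tau>) (ginv G \<sigma>)"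
    using assoc[OF c1 c2] by simp
  finally show ?thesis using quot_mult[OF assms(1,3)] by (simp add: quot_def)
qed

text \<open>Right translation by \<sigma> is inverse to it. Together with \<open>quot_quot\<close>
  it reindexes a convolution, which sums over the fibre of \<open>gran G \<sigma>\<close>, as a
  matrix product over the fibre of x.\<close>

lemma quot_bij_betw:
  assumes \<sigma>: "\<sigma> \<in> dom_fibre G x"
  shows "bij_betw (\<lambda>\<rho>. quot \<rho> \<sigma>) (dom_fibre G x) (dom_fibre G (gran G \<sigma>))"
proof (rule bij_betwI[where g = "\<lambda>\<tau>. gmult G \<tau> \<sigma>"])
  have c: "(\<tau>, \<sigma>) \<in> composable G" if "\<tau> \<in> dom_fibre G (gran G \<sigma>)" for \<tau>
    using that \<sigma> by (simp add: composable_iff dom_fibre_iff)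
  show "(\<lambda>\<rho>. quot \<rho> \<sigma>) \<in> dom_fibre G x \<rightarrow> dom_fibre G (gran G \<sigma>)"
    using \<sigma> quot_closed dom_quot by (auto simp: dom_fibre_iff[of _ "gran G \<sigma>"])
  show "(\<lambda>\<tau>. gmult G \<tau> \<sigma>) \<in> dom_fibre G (gran G \<sigma>) \<rightarrow> dom_fibre G x"
    using c \<sigma> mult_closed dom_mult by (auto simp: dom_fibre_iff[of _ x])
  show "gmult G (quot \<rho> \<sigma>) \<sigma> = \<rho>" if "\<rho> \<in> dom_fibre G x" for \<rho>
    using quot_mult[OF that \<sigma>] .
  show "quot (gmult G \<tau> \<sigma>) \<sigma> = \<tau>" if "\<tau> \<in> dom_fibre G (gran G \<sigma>)" for \<tau>
    using mult_inv_cancel[OF c[OF that]] by (simp add: quot_def)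
qed

text \<open>The product of \<open>ginv G \<sigma>\<close> with \<tau> is an isotropy arrow at x,
  hence the unit x.\<close>

lemma trivial_isotropy_unique:
  assumes "isotropy G x = {x}" "\<sigma> \<in> dom_fibre G x" "\<tau> \<in> dom_fibre G x" "gran G \<sigma> = gran G \<tau>"
  shows "\<sigma> = \<tau>"
proof -
  have *: "\<sigma> \<in> arrows G" "\<tau> \<in> arrows G" "gdom G \<sigma> = x" "gdom G \<tau> = x"
    using assms(2,3) by (auto simp: dom_fibre_iff)
  then have comp: "(ginv G \<sigma>, \<tau>) \<in> composable G" using assms(4) by (simp add: composable_iff inv_closed dom_inv)
  then have "gmult G (ginv G \<sigma>) \<tau> \<in> isotropy G x"
    using * by (simp add: isotropy_def mult_closed dom_mult ran_mult ran_inv)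
  then have "gmult G (ginv G (ginv G \<sigma>)) x = \<tau>" using inv_mult_cancel[OF comp] assms(1) by simp
  then show ?thesis using mult_dom[OF *(1)] * by (simp add: inv_inv)
qed

lemma continuous_mult_pair:
  assumes "continuous_map X (gtop G) f" "continuous_map X (gtop G) g"
    and "\<And>x. x \<in> topspace X \<Longrightarrow> gdom G (f x) = gran G (g x)"
  shows "continuous_map X (gtop G) (\<lambda>x. gmult G (f x) (g x))"
proof -
  have "f x \<in> arrows G" "g x \<in> arrows G" if "x \<in> topspace X" for x
    using that assms(1,2) by (auto dest!: continuous_map_funspace)
  then have "continuous_map X (subtopology (prod_topology (gtop G) (gtop G)) (composable G)) (\<lambda>x. (f x, g x))"
    using assms by (intro continuous_map_into_subtopology) (auto simp: continuous_map_paired composable_iff)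
  then show ?thesis
    using continuous_map_compose[OF _ continuous_mult] by (fastforce simp: o_def)
qed

lemma continuous_dom: "continuous_map (gtop G) (gtop G) (gdom G)"
  unfolding gdom_def[abs_def]
  by (rule continuous_mult_pair[OF continuous_inv]) (auto simp: dom_inv)

lemma continuous_ran: "continuous_map (gtop G) (gtop G) (gran G)"
  unfolding gran_def[abs_def]
  by (rule continuous_mult_pair[OF _ continuous_inv]) (auto simp: ran_inv)

end

section \<open>Units, bisections and local sections\<close>

locale etale_groupoid = topological_groupoid G for G :: "'g topgroupoid" +
  assumes Hausdorff: "Hausdorff_space (gtop G)" and etale: "etale G"
begin

text \<open>Take U around x on which \<open>gdom\<close> is injective. If \<gamma> and
  \<open>gdom G \<gamma>\<close> both lie in U, they have the same domain and so coincide; the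
  arrows with this property form a neighbourhood of x.\<close>

lemma units_open: "openin (gtop G) (units G)"
proof (subst openin_subopen, intro ballI)
  fix x assume x: "x \<in> units G"
  obtain U where U: "openin (gtop G) U" "x \<in> U" "inj_on (gdom G) U"
    using local_homeomorphism_injective etale units_arrows[OF x] unfolding etale_def by metis
  let ?V = "U \<inter> {\<gamma> \<in> arrows G. gdom G \<gamma> \<in> U}"
  have "openin (gtop G) ?V"
    using U(1) openin_continuous_map_preimage[OF continuous_dom U(1)] by blast
  moreover have "?V \<subseteq> units G"
  proof
    fix \<gamma> assume \<gamma>: "\<gamma> \<in> ?V"
    then have "gdom G \<gamma> = \<gamma>" using dom_dom inj_onD[OF U(3), of "gdom G \<gamma>" \<gamma>] by blast
    then show "\<gamma> \<in> units G" using \<gamma> by (simp add: units_iff)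
  qed
  moreover have "x \<in> ?V" using x U(2) by (simp add: units_iff)
  ultimately show "\<exists>T. openin (gtop G) T \<and> x \<in> T \<and> T \<subseteq> units G" by blast
qed

text \<open>The units are the set where \<open>gdom\<close> agrees with the identity, and such sets
  are closed in a Hausdorff space.\<close>

lemma units_closed: "closedin (gtop G) (units G)"
proof -
  have "units G = {x \<in> arrows G. gdom G x = x}" by (auto simp: units_iff)
  then show ?thesis
    using closedin_continuous_maps_eq[OF Hausdorff continuous_dom continuous_map_id[unfolded id_def]] by simp
qed

lemma openin_unit_space: "openin (unit_space G) U \<longleftrightarrow> openin (gtop G) U \<and> U \<subseteq> units G"
  unfolding unit_space_def by (rule openin_open_subtopology[OF units_open])

lemma topspace_unit_space: "topspace (unit_space G) = units G"
  using openin_subset[OF units_open] by (auto simp: unit_space_def)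

lemma Hausdorff_unit_space: "Hausdorff_space (unit_space G)"
  unfolding unit_space_def by (rule Hausdorff_space_subtopology[OF Hausdorff])

lemma open_dom: "openin (gtop G) U \<Longrightarrow> openin (gtop G) (gdom G ` U)"
  using local_homeomorphism_open_map etale openin_unit_space unfolding etale_def open_map_def by blast

lemma open_ran: "openin (gtop G) U \<Longrightarrow> openin (gtop G) (gran G ` U)"
  using local_homeomorphism_open_map etale openin_unit_space unfolding etale_def open_map_def by blast

lemma bisection_basis:
  assumes "openin (gtop G) W" "\<gamma> \<in> W"
  obtains B where "open_bisection G B" "\<gamma> \<in> B" "B \<subseteq> W"
proof -
  have \<gamma>: "\<gamma> \<in> arrows G" using assms openin_subset by blast
  obtain U where U: "openin (gtop G) U" "\<gamma> \<in> U" "inj_on (gdom G) U"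
    using local_homeomorphism_injective etale \<gamma> unfolding etale_def by metis
  obtain V where V: "openin (gtop G) V" "\<gamma> \<in> V" "inj_on (gran G) V"
    using local_homeomorphism_injective etale \<gamma> unfolding etale_def by metis
  have "open_bisection G (W \<inter> (U \<inter> V))"
    using U V assms(1) unfolding open_bisection_def by (auto intro: inj_on_subset)
  then show thesis using that[of "W \<inter> (U \<inter> V)"] assms(2) U V by blast
qed

lemma bisection_open: "open_bisection G B \<Longrightarrow> openin (gtop G) B"
  by (simp add: open_bisection_def)

lemma bisection_arrows: "open_bisection G B \<Longrightarrow> \<beta> \<in> B \<Longrightarrow> \<beta> \<in> arrows G"
  using bisection_open openin_subset by blast

lemma bisection_Int:
  "open_bisection G B \<Longrightarrow> openin (gtop G) W \<Longrightarrow> open_bisection G (B \<inter> W)"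
  unfolding open_bisection_def by (auto intro: inj_on_subset)

definition sec :: "'g set \<Rightarrow> 'g \<Rightarrow> 'g" where
  "sec B = inv_into B (gdom G)"

lemma sec_dom: "open_bisection G B \<Longrightarrow> \<beta> \<in> B \<Longrightarrow> sec B (gdom G \<beta>) = \<beta>"
  by (simp add: sec_def open_bisection_def)

lemma sec_in: "x \<in> gdom G ` B \<Longrightarrow> sec B x \<in> B"
  and dom_sec: "x \<in> gdom G ` B \<Longrightarrow> gdom G (sec B x) = x"
  by (simp_all add: sec_def inv_into_into f_inv_into_f)

lemma continuous_sec:
  assumes B: "open_bisection G B"
  shows "continuous_map (subtopology (gtop G) (gdom G ` B)) (gtop G) (sec B)"
  unfolding continuous_map_def
proof (intro conjI allI impI)
  have sub: "topspace (subtopology (gtop G) (gdom G ` B)) = gdom G ` B"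
    using openin_subset[OF open_dom[OF bisection_open[OF B]]] by auto
  show "sec B \<in> topspace (subtopology (gtop G) (gdom G ` B)) \<rightarrow> arrows G"
    unfolding sub using sec_in bisection_arrows[OF B] by blast
  fix U assume U: "openin (gtop G) U"
  have "{x \<in> gdom G ` B. sec B x \<in> U} = gdom G ` (B \<inter> U)"
    using sec_dom[OF B] by auto
  then show "openin (subtopology (gtop G) (gdom G ` B))
      {x \<in> topspace (subtopology (gtop G) (gdom G ` B)). sec B x \<in> U}"
    unfolding sub openin_open_subtopology[OF open_dom[OF bisection_open[OF B]]]
    using open_dom[of "B \<inter> U"] bisection_open[OF B] U by auto
qed

lemma compact_bisection_cover:
  assumes K: "compactin (gtop G) K"
  obtains \<B> where "finite \<B>" "\<And>B. B \<in> \<B> \<Longrightarrow> open_bisection G B" "K \<subseteq> \<Union>\<B>"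
proof -
  have "\<forall>U\<in>Collect (open_bisection G). openin (gtop G) U" by (simp add: bisection_open)
  moreover have "K \<subseteq> \<Union>(Collect (open_bisection G))"
    using compactin_subset_topspace[OF K] bisection_basis[OF openin_topspace] by blast
  ultimately obtain \<F> where "finite \<F>" "\<F> \<subseteq> Collect (open_bisection G)" "K \<subseteq> \<Union>\<F>"
    using K unfolding compactin_def by meson
  then show thesis using that[of \<F>] by blast
qed

text \<open>Cover K by finitely many bisections. Each meets a fibre of \<open>gdom\<close> or
  \<open>gran\<close> at most once, so the size of the cover bounds all fibres at the same time;
  uniformity in x is what the estimate of the reduced norm requires.\<close>

lemma compact_fibres_bounded:
  assumes K: "compactin (gtop G) K"
  obtains n where "\<And>x. finite {\<gamma>\<in>K. gdom G \<gamma> = x}" "\<And>x. card {\<gamma>\<in>K. gdom G \<gamma> = x} \<le> n"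
    "\<And>x. finite {\<gamma>\<in>K. gran G \<gamma> = x}" "\<And>x. card {\<gamma>\<in>K. gran G \<gamma> = x} \<le> n"
proof -
  obtain \<B> where \<B>: "finite \<B>" "\<And>B. B \<in> \<B> \<Longrightarrow> open_bisection G B" "K \<subseteq> \<Union>\<B>"
    using compact_bisection_cover[OF K] by blast
  have main: "finite {\<gamma>\<in>K. q \<gamma> = x} \<and> card {\<gamma>\<in>K. q \<gamma> = x} \<le> card \<B>"
    if q: "\<And>B. B \<in> \<B> \<Longrightarrow> inj_on q B" for q :: "'g \<Rightarrow> 'g" and x
  proof -
    have sub: "{\<gamma>\<in>K. q \<gamma> = x} \<subseteq> (\<lambda>B. inv_into B q x) ` \<B>"
    proof
      fix \<gamma> assume "\<gamma> \<in> {\<gamma>\<in>K. q \<gamma> = x}"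
      then obtain B where "B \<in> \<B>" "\<gamma> \<in> B" "q \<gamma> = x" using \<B>(3) by blast
      then show "\<gamma> \<in> (\<lambda>B. inv_into B q x) ` \<B>" using q by (metis image_eqI inv_into_f_f)
    qed
    have "card {\<gamma>\<in>K. q \<gamma> = x} \<le> card ((\<lambda>B. inv_into B q x) ` \<B>)"
      using sub \<B>(1) by (intro card_mono) auto
    also have "\<dots> \<le> card \<B>" using \<B>(1) by (rule card_image_le)
    finally show ?thesis using sub \<B>(1) finite_subset by blast
  qed
  have "finite {\<gamma>\<in>K. gdom G \<gamma> = x} \<and> card {\<gamma>\<in>K. gdom G \<gamma> = x} \<le> card \<B>" for x
    by (rule main) (use \<B>(2) in \<open>auto simp: open_bisection_def\<close>)
  moreover have "finite {\<gamma>\<in>K. gran G \<gamma> = x} \<and> card {\<gamma>\<in>K. gran G \<gamma> = x} \<le> card \<B>" for x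
    by (rule main) (use \<B>(2) in \<open>auto simp: open_bisection_def\<close>)
  ultimately show thesis using that by blast
qed

text \<open>Turns convolution, near a given arrow, into a finite sum of continuous functions.\<close>

lemma compact_local_sections:
  assumes K: "compactin (gtop G) K" and x: "x \<in> units G"
  obtains F :: "'g set" and B W where "finite F" "\<And>\<sigma>. \<sigma> \<in> F \<Longrightarrow> open_bisection G (B \<sigma>)"
    "\<And>\<sigma> \<tau>. \<sigma> \<in> F \<Longrightarrow> \<tau> \<in> F \<Longrightarrow> \<sigma> \<noteq> \<tau> \<Longrightarrow> B \<sigma> \<inter> B \<tau> = {}"
    "openin (gtop G) W" "x \<in> W" "W \<subseteq> units G" "\<And>\<sigma>. \<sigma> \<in> F \<Longrightarrow> W \<subseteq> gdom G ` B \<sigma>"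
    "\<And>\<sigma>. \<sigma> \<in> K \<Longrightarrow> gdom G \<sigma> \<in> W \<Longrightarrow> \<exists>\<tau>\<in>F. \<sigma> \<in> B \<tau>"
proof -
  define F where "F = {\<gamma>\<in>K. gdom G \<gamma> = x}"
  have F: "finite F" using compact_fibres_bounded[OF K] unfolding F_def by metis
  have Far: "F \<subseteq> arrows G" using compactin_subset_topspace[OF K] by (auto simp: F_def)
  obtain U where U: "\<And>\<sigma>. \<sigma> \<in> F \<Longrightarrow> openin (gtop G) (U \<sigma>)" "\<And>\<sigma>. \<sigma> \<in> F \<Longrightarrow> \<sigma> \<in> U \<sigma>"
    "\<And>\<sigma> \<tau>. \<sigma> \<in> F \<Longrightarrow> \<tau> \<in> F \<Longrightarrow> \<sigma> \<noteq> \<tau> \<Longrightarrow> U \<sigma> \<inter> U \<tau> = {}"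
    using Hausdorff_space_separate_finite[OF Hausdorff F Far] by metis
  have "\<exists>B. open_bisection G B \<and> \<sigma> \<in> B \<and> B \<subseteq> U \<sigma>" if "\<sigma> \<in> F" for \<sigma>
    using bisection_basis[OF U(1)[OF that] U(2)[OF that]] by metis
  then obtain B where B: "\<And>\<sigma>. \<sigma> \<in> F \<Longrightarrow> open_bisection G (B \<sigma>) \<and> \<sigma> \<in> B \<sigma> \<and> B \<sigma> \<subseteq> U \<sigma>" by metis
  define L where "L = K - (\<Union>\<sigma>\<in>F. B \<sigma>)"
  have "openin (gtop G) (\<Union>\<sigma>\<in>F. B \<sigma>)" using B bisection_open by blast
  then have "closedin (gtop G) (arrows G - (\<Union>\<sigma>\<in>F. B \<sigma>))"
    by (simp add: openin_closedin_eq)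
  then have "compactin (gtop G) ((arrows G - (\<Union>\<sigma>\<in>F. B \<sigma>)) \<inter> K)"
    using K by (rule closed_Int_compactin)
  moreover have "(arrows G - (\<Union>\<sigma>\<in>F. B \<sigma>)) \<inter> K = L"
    using compactin_subset_topspace[OF K] by (auto simp: L_def)
  ultimately have "compactin (gtop G) L" by simp
  then have "compactin (gtop G) (gdom G ` L)" by (rule image_compactin[OF _ continuous_dom])
  then have closed: "closedin (gtop G) (gdom G ` L)" by (rule compactin_imp_closedin[OF Hausdorff])
  define W where "W = (units G \<inter> (\<Inter>\<sigma>\<in>F. gdom G ` B \<sigma>)) - gdom G ` L"
  show thesis
  proof (rule that[of F B W])
    show "finite F" by (rule F)
    show "open_bisection G (B \<sigma>)" if "\<sigma> \<in> F" for \<sigma> using B that by blast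
    show "B \<sigma> \<inter> B \<tau> = {}" if "\<sigma> \<in> F" "\<tau> \<in> F" "\<sigma> \<noteq> \<tau>" for \<sigma> \<tau>
      using U(3)[OF that] B[OF that(1)] B[OF that(2)] by blast
    have "openin (gtop G) (units G \<inter> (\<Inter>\<sigma>\<in>F. gdom G ` B \<sigma>))"
    proof (cases "F = {}")
      case False
      then show ?thesis using F B bisection_open open_dom units_open by (intro openin_Int openin_INT2) auto
    qed (simp add: units_open)
    then show "openin (gtop G) W" unfolding W_def using closed by (rule openin_diff)
    have "x \<notin> gdom G ` L" using B by (auto simp: L_def F_def)
    moreover have "x \<in> gdom G ` B \<sigma>" if "\<sigma> \<in> F" for \<sigma>
      using B[OF that] that by (auto simp: F_def)
    ultimately show "x \<in> W" using x by (auto simp: W_def)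
    show "W \<subseteq> units G" "\<And>\<sigma>. \<sigma> \<in> F \<Longrightarrow> W \<subseteq> gdom G ` B \<sigma>" by (auto simp: W_def)
    show "\<exists>\<tau>\<in>F. \<sigma> \<in> B \<tau>" if "\<sigma> \<in> K" "gdom G \<sigma> \<in> W" for \<sigma>
      using that by (auto simp: W_def L_def)
  qed
qed

section \<open>Continuous functions with compact support\<close>

lemma CcI:
  assumes "continuous_map (gtop G) euclidean f" "\<And>\<gamma>. \<gamma> \<notin> arrows G \<Longrightarrow> f \<gamma> = 0"
    and K: "compactin (gtop G) K" "\<And>\<gamma>. f \<gamma> \<noteq> 0 \<Longrightarrow> \<gamma> \<in> K"
  shows "f \<in> Cc G"
proof -
  have "gtop G closure_of {\<gamma> \<in> arrows G. f \<gamma> \<noteq> 0} \<subseteq> K"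
    using K by (intro closure_of_minimal compactin_imp_closedin[OF Hausdorff]) auto
  then have "compactin (gtop G) (gtop G closure_of {\<gamma> \<in> arrows G. f \<gamma> \<noteq> 0})"
    by (rule closed_compactin[OF K(1)]) simp
  then show ?thesis using assms(1,2) by (simp add: Cc_def)
qed

lemma Cc_support:
  assumes "f \<in> Cc G"
  obtains K where "compactin (gtop G) K" "\<And>\<gamma>. f \<gamma> \<noteq> 0 \<Longrightarrow> \<gamma> \<in> K"
proof
  show "compactin (gtop G) (gtop G closure_of {\<gamma> \<in> arrows G. f \<gamma> \<noteq> 0})"
    using assms by (simp add: Cc_def)
  show "\<gamma> \<in> gtop G closure_of {\<gamma> \<in> arrows G. f \<gamma> \<noteq> 0}" if "f \<gamma> \<noteq> 0" for \<gamma>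
    using closure_of_subset[of "{\<gamma> \<in> arrows G. f \<gamma> \<noteq> 0}" "gtop G"] that assms by (auto simp: Cc_def)
qed

lemma Cc_continuous: "f \<in> Cc G \<Longrightarrow> continuous_map (gtop G) euclidean f"
  and Cc_outside: "f \<in> Cc G \<Longrightarrow> \<gamma> \<notin> arrows G \<Longrightarrow> f \<gamma> = 0"
  by (auto simp: Cc_def)

lemma Cc_zero: "(\<lambda>_. 0) \<in> Cc G"
  by (rule CcI[where K = "{}"]) auto

lemma Cc_add:
  assumes "f \<in> Cc G" "g \<in> Cc G" shows "(\<lambda>\<gamma>. f \<gamma> + g \<gamma>) \<in> Cc G"
proof -
  obtain K where K: "compactin (gtop G) K" "\<And>\<gamma>. f \<gamma> \<noteq> 0 \<Longrightarrow> \<gamma> \<in> K" using Cc_support[OF assms(1)] by blast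
  obtain L where L: "compactin (gtop G) L" "\<And>\<gamma>. g \<gamma> \<noteq> 0 \<Longrightarrow> \<gamma> \<in> L" using Cc_support[OF assms(2)] by blast
  show ?thesis
  proof (rule CcI[where K = "K \<union> L"])
    show "\<gamma> \<in> K \<union> L" if "f \<gamma> + g \<gamma> \<noteq> 0" for \<gamma>
      using that K(2)[of \<gamma>] L(2)[of \<gamma>] by (cases "f \<gamma> = 0") auto
  qed (use assms K L in \<open>auto simp: Cc_outside intro: continuous_map_add Cc_continuous compactin_Un\<close>)
qed

lemma Cc_smult:
  assumes "f \<in> Cc G" shows "(\<lambda>\<gamma>. c * f \<gamma>) \<in> Cc G"
proof -
  obtain K where K: "compactin (gtop G) K" "\<And>\<gamma>. f \<gamma> \<noteq> 0 \<Longrightarrow> \<gamma> \<in> K" using Cc_support[OF assms(1)] by blast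
  show ?thesis
  proof (rule CcI[where K = K])
    show "continuous_map (gtop G) euclidean (\<lambda>\<gamma>. c * f \<gamma>)"
      by (rule continuous_map_mult_euclidean[OF _ Cc_continuous[OF assms]]) simp
  qed (use assms K in \<open>auto simp: Cc_outside\<close>)
qed

lemma Cc_bounded:
  assumes "f \<in> Cc G" obtains C where "0 \<le> C" "\<And>\<gamma>. norm (f \<gamma>) \<le> C"
proof -
  obtain K where K: "compactin (gtop G) K" "\<And>\<gamma>. f \<gamma> \<noteq> 0 \<Longrightarrow> \<gamma> \<in> K" using Cc_support[OF assms] by blast
  have "compactin euclidean (f ` K)" by (rule image_compactin[OF K(1) Cc_continuous[OF assms]])
  then have "bounded (f ` K)" by (simp add: compact_imp_bounded)
  then obtain C where C: "\<And>\<gamma>. \<gamma> \<in> K \<Longrightarrow> norm (f \<gamma>) \<le> C" by (auto simp: bounded_iff)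
  have "norm (f \<gamma>) \<le> max C 0" for \<gamma> using C[of \<gamma>] K(2)[of \<gamma>] by (cases "f \<gamma> = 0") auto
  then show thesis using that[of "max C 0"] by simp
qed

lemma Cc_finite_fibre:
  assumes "f \<in> Cc G" shows "finite {\<sigma>\<in>dom_fibre G x. f \<sigma> \<noteq> 0}"
proof -
  obtain K where K: "compactin (gtop G) K" "\<And>\<gamma>. f \<gamma> \<noteq> 0 \<Longrightarrow> \<gamma> \<in> K" using Cc_support[OF assms] by blast
  have "finite {\<gamma>\<in>K. gdom G \<gamma> = x}" using compact_fibres_bounded[OF K(1)] by metis
  moreover have "{\<sigma>\<in>dom_fibre G x. f \<sigma> \<noteq> 0} \<subseteq> {\<gamma>\<in>K. gdom G \<gamma> = x}"
    using K(2) by (auto simp: dom_fibre_iff)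
  ultimately show ?thesis by (rule finite_subset[rotated])
qed

lemma convolution_eq_sum:
  assumes "\<gamma> \<in> arrows G" "finite S" "S \<subseteq> dom_fibre G (gdom G \<gamma>)"
    and "\<And>\<sigma>. \<sigma> \<in> dom_fibre G (gdom G \<gamma>) \<Longrightarrow> \<sigma> \<notin> S \<Longrightarrow> f (quot \<gamma> \<sigma>) * g \<sigma> = 0"
  shows "convolution G f g \<gamma> = (\<Sum>\<sigma>\<in>S. f (quot \<gamma> \<sigma>) * g \<sigma>)"
proof -
  have "(\<Sum>\<^sub>\<infinity>\<sigma>\<in>dom_fibre G (gdom G \<gamma>). f (quot \<gamma> \<sigma>) * g \<sigma>) = (\<Sum>\<^sub>\<infinity>\<sigma>\<in>S. f (quot \<gamma> \<sigma>) * g \<sigma>)"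
    using assms by (intro infsum_cong_neutral) auto
  then show ?thesis using assms by (simp add: convolution_def quot_def)
qed

text \<open>Support: the convolution lives on the product of the two supports, a compact set because
  composability is a closed condition. Continuity: near a given arrow the sum runs over finitely
  many local sections that are fixed in advance.\<close>

lemma convolution_Cc:
  assumes f: "f \<in> Cc G" and g: "g \<in> Cc G"
  shows "convolution G f g \<in> Cc G"
proof -
  obtain K where K: "compactin (gtop G) K" "\<And>\<gamma>. f \<gamma> \<noteq> 0 \<Longrightarrow> \<gamma> \<in> K" using Cc_support[OF f] by blast
  obtain L where L: "compactin (gtop G) L" "\<And>\<gamma>. g \<gamma> \<noteq> 0 \<Longrightarrow> \<gamma> \<in> L" using Cc_support[OF g] by blast
  let ?P = "prod_topology (gtop G) (gtop G)"
  let ?M = "(\<lambda>(\<gamma>, \<eta>). gmult G \<gamma> \<eta>) ` (composable G \<inter> (K \<times> L))"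
  show ?thesis
  proof (rule CcI[where K = ?M])
    have "closedin ?P {z \<in> topspace ?P. (gdom G \<circ> fst) z = (gran G \<circ> snd) z}"
      by (intro closedin_continuous_maps_eq[OF Hausdorff] continuous_map_compose[OF continuous_map_fst continuous_dom]
        continuous_map_compose[OF continuous_map_snd continuous_ran])
    moreover have "{z \<in> topspace ?P. (gdom G \<circ> fst) z = (gran G \<circ> snd) z} = composable G"
      by (auto simp: composable_def)
    ultimately have "compactin ?P (composable G \<inter> (K \<times> L))"
      using K(1) L(1) by (intro closed_Int_compactin) (auto simp: compactin_Times)
    then have "compactin (subtopology ?P (composable G)) (composable G \<inter> (K \<times> L))"
      by (simp add: compactin_subtopology)
    then show "compactin (gtop G) ?M" by (rule image_compactin[OF _ continuous_mult])
    show "\<gamma> \<in> ?M" if nz: "convolution G f g \<gamma> \<noteq> 0" for \<gamma>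
    proof -
      have \<gamma>: "\<gamma> \<in> arrows G" using nz by (auto simp: convolution_def split: if_splits)
      obtain \<sigma> where \<sigma>: "\<sigma> \<in> dom_fibre G (gdom G \<gamma>)" "f (quot \<gamma> \<sigma>) * g \<sigma> \<noteq> 0"
        using convolution_eq_sum[OF \<gamma>, of "{}" f g] nz by auto
      have \<gamma>': "\<gamma> \<in> dom_fibre G (gdom G \<gamma>)" using \<gamma> by (simp add: dom_fibre_iff)
      have "(quot \<gamma> \<sigma>, \<sigma>) \<in> composable G \<inter> (K \<times> L)"
        using K(2) L(2) \<sigma> \<gamma>' by (auto simp: composable_iff quot_closed dom_quot dom_fibre_iff)
      then show ?thesis using quot_mult[OF \<gamma>' \<sigma>(1)] by force
    qed
    show "convolution G f g \<gamma> = 0" if "\<gamma> \<notin> arrows G" for \<gamma> using that by (simp add: convolution_def)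
    show "continuous_map (gtop G) euclidean (convolution G f g)"
    proof (rule continuous_map_locally)
      fix \<gamma>0 assume \<gamma>0: "\<gamma>0 \<in> arrows G"
      show "\<exists>U. openin (gtop G) U \<and> \<gamma>0 \<in> U \<and> continuous_map (subtopology (gtop G) U) euclidean (convolution G f g)"
      proof (rule compact_local_sections[OF L(1) dom_units[OF \<gamma>0]])
        fix F :: "'g set" and B W
        assume F: "finite F" and B: "\<And>\<sigma>. \<sigma> \<in> F \<Longrightarrow> open_bisection G (B \<sigma>)"
          "\<And>\<sigma> \<tau>. \<sigma> \<in> F \<Longrightarrow> \<tau> \<in> F \<Longrightarrow> \<sigma> \<noteq> \<tau> \<Longrightarrow> B \<sigma> \<inter> B \<tau> = {}"
          and W: "openin (gtop G) W" "gdom G \<gamma>0 \<in> W" "W \<subseteq> units G" "\<And>\<sigma>. \<sigma> \<in> F \<Longrightarrow> W \<subseteq> gdom G ` B \<sigma>"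
          and cover: "\<And>\<sigma>. \<sigma> \<in> L \<Longrightarrow> gdom G \<sigma> \<in> W \<Longrightarrow> \<exists>\<tau>\<in>F. \<sigma> \<in> B \<tau>"
        let ?U = "{\<gamma> \<in> arrows G. gdom G \<gamma> \<in> W}"
        let ?X = "subtopology (gtop G) ?U"
        have U: "openin (gtop G) ?U" by (rule openin_continuous_map_preimage[OF continuous_dom W(1)])
        have tX: "topspace ?X = ?U" by auto
        have sB: "sec (B \<sigma>) (gdom G \<gamma>) \<in> B \<sigma>" "sec (B \<sigma>) (gdom G \<gamma>) \<in> dom_fibre G (gdom G \<gamma>)"
          if "\<gamma> \<in> ?U" "\<sigma> \<in> F" for \<gamma> \<sigma>
        proof -
          have d: "gdom G \<gamma> \<in> gdom G ` B \<sigma>" using that W(4) by blast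
          show "sec (B \<sigma>) (gdom G \<gamma>) \<in> B \<sigma>" by (rule sec_in[OF d])
          then show "sec (B \<sigma>) (gdom G \<gamma>) \<in> dom_fibre G (gdom G \<gamma>)"
            using dom_sec[OF d] bisection_arrows B(1) that by (auto simp: dom_fibre_iff)
        qed
        \<comment> \<open>The sections meet every arrow of the fibre that lies in L, and outside L
          the factor g vanishes. Disjointness of the bisections ensures that no arrow is counted
          twice.\<close>
        have eq: "convolution G f g \<gamma> = (\<Sum>\<sigma>\<in>F. f (quot \<gamma> (sec (B \<sigma>) (gdom G \<gamma>))) * g (sec (B \<sigma>) (gdom G \<gamma>)))"
          if \<gamma>: "\<gamma> \<in> ?U" for \<gamma>
        proof -
          let ?s = "\<lambda>\<sigma>. sec (B \<sigma>) (gdom G \<gamma>)"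
          have inj: "inj_on ?s F"
          proof (rule inj_onI)
            fix \<sigma> \<tau> assume st: "\<sigma> \<in> F" "\<tau> \<in> F" "?s \<sigma> = ?s \<tau>"
            then have "?s \<sigma> \<in> B \<sigma> \<inter> B \<tau>" using sB(1)[OF \<gamma> st(1)] sB(1)[OF \<gamma> st(2)] by simp
            then show "\<sigma> = \<tau>" using B(2) st by blast
          qed
          have "convolution G f g \<gamma> = (\<Sum>\<sigma>\<in>?s ` F. f (quot \<gamma> \<sigma>) * g \<sigma>)"
          proof (rule convolution_eq_sum)
            show "\<gamma> \<in> arrows G" "finite (?s ` F)" using \<gamma> F by auto
            show "?s ` F \<subseteq> dom_fibre G (gdom G \<gamma>)" using sB(2)[OF \<gamma>] by blast
            fix \<sigma> assume \<sigma>: "\<sigma> \<in> dom_fibre G (gdom G \<gamma>)" "\<sigma> \<notin> ?s ` F"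
            have "\<sigma> \<notin> L"
            proof
              assume "\<sigma> \<in> L"
              then obtain \<tau> where \<tau>: "\<tau> \<in> F" "\<sigma> \<in> B \<tau>" using cover[of \<sigma>] \<sigma> \<gamma> by (auto simp: dom_fibre_iff)
              then have "?s \<tau> = \<sigma>" using sec_dom[OF B(1)[OF \<tau>(1)] \<tau>(2)] \<sigma>(1) by (simp add: dom_fibre_iff)
              then show False using \<sigma>(2) \<tau>(1) by blast
            qed
            then show "f (quot \<gamma> \<sigma>) * g \<sigma> = 0" using L(2) by auto
          qed
          then show ?thesis by (simp add: sum.reindex[OF inj])
        qed
        have cs: "continuous_map ?X (gtop G) (\<lambda>\<gamma>. sec (B \<sigma>) (gdom G \<gamma>))" if "\<sigma> \<in> F" for \<sigma>
        proof -
          have "continuous_map ?X (subtopology (gtop G) (gdom G ` B \<sigma>)) (gdom G)"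
            using W(4)[OF that] by (intro continuous_map_into_subtopology continuous_map_from_subtopology continuous_dom) auto
          from continuous_map_compose[OF this continuous_sec[OF B(1)[OF that]]] show ?thesis by (simp add: o_def)
        qed
        have "continuous_map ?X euclidean (\<lambda>\<gamma>. \<Sum>\<sigma>\<in>F. f (quot \<gamma> (sec (B \<sigma>) (gdom G \<gamma>))) * g (sec (B \<sigma>) (gdom G \<gamma>)))"
        proof (intro continuous_map_sum[OF F] continuous_map_mult_euclidean)
          fix \<sigma> assume \<sigma>: "\<sigma> \<in> F"
          show "continuous_map ?X euclidean (\<lambda>\<gamma>. g (sec (B \<sigma>) (gdom G \<gamma>)))"
            using continuous_map_compose[OF cs[OF \<sigma>] Cc_continuous[OF g]] by (simp add: o_def)
          have "continuous_map ?X (gtop G) (\<lambda>\<gamma>. quot \<gamma> (sec (B \<sigma>) (gdom G \<gamma>)))"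
            unfolding quot_def
          proof (rule continuous_mult_pair)
            show "continuous_map ?X (gtop G) (\<lambda>\<gamma>. \<gamma>)"
              by (rule continuous_map_from_subtopology) simp
            show "continuous_map ?X (gtop G) (\<lambda>\<gamma>. ginv G (sec (B \<sigma>) (gdom G \<gamma>)))"
              using continuous_map_compose[OF cs[OF \<sigma>] continuous_inv] by (simp add: o_def)
            show "gdom G \<gamma> = gran G (ginv G (sec (B \<sigma>) (gdom G \<gamma>)))" if "\<gamma> \<in> topspace ?X" for \<gamma>
              using sB(2)[OF _ \<sigma>, of \<gamma>] that unfolding tX by (auto simp: ran_inv dom_fibre_iff)
          qed
          from continuous_map_compose[OF this Cc_continuous[OF f]]
          show "continuous_map ?X euclidean (\<lambda>\<gamma>. f (quot \<gamma> (sec (B \<sigma>) (gdom G \<gamma>))))" by (simp add: o_def)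
        qed
        then have "continuous_map ?X euclidean (convolution G f g)"
          by (rule continuous_map_eq) (use eq tX in auto)
        then show "\<exists>U. openin (gtop G) U \<and> \<gamma>0 \<in> U \<and> continuous_map (subtopology (gtop G) U) euclidean (convolution G f g)"
        using U W(2) \<gamma>0 by blast
      qed
    qed
  qed
qed

end

section \<open>The reduced norm\<close>

locale reduced_groupoid_algebra = etale_groupoid G for G :: "'g topgroupoid" +
  fixes p :: real
  assumes p: "1 \<le> p" and compact: "compact_space (unit_space G)"
begin

lemma compact_units: "compactin (gtop G) (units G)"
  using compact units_arrows unfolding unit_space_def by (auto simp: compactin_subspace)

lemma Cc_one: "(\<lambda>\<gamma>. if \<gamma> \<in> units G then 1 else 0) \<in> Cc G"
proof (rule CcI[OF _ _ compact_units])
  show "continuous_map (gtop G) euclidean (\<lambda>\<gamma>. if \<gamma> \<in> units G then 1 else 0 :: complex)"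
  proof (rule continuous_map_locally)
    fix \<gamma> assume \<gamma>: "\<gamma> \<in> arrows G"
    have *: "continuous_map (subtopology (gtop G) U) euclidean (\<lambda>\<gamma>. if \<gamma> \<in> units G then 1 else 0 :: complex)"
      if "U = units G \<or> U = arrows G - units G" for U
      by (rule continuous_map_eq[of _ _ "\<lambda>_. if U = units G then 1 else 0"]) (use that in auto)
    have "openin (gtop G) (arrows G - units G)" using units_closed by (simp add: closedin_def)
    then show "\<exists>U. openin (gtop G) U \<and> \<gamma> \<in> U \<and> continuous_map (subtopology (gtop G) U) euclidean (\<lambda>\<gamma>. if \<gamma> \<in> units G then 1 else 0 :: complex)"
      using * units_open \<gamma> by (cases "\<gamma> \<in> units G") blast+
  qed
qed (auto simp: units_arrows split: if_splits)

lemma left_reg_matrix_operator: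
  "left_reg G x f = matrix_operator (dom_fibre G x) (\<lambda>\<gamma> \<sigma>. f (quot \<gamma> \<sigma>))"
  by (intro ext) (simp add: left_reg_def matrix_operator_def quot_def)

text \<open>A bound for the norms of f on all fibres that makes sense for every function on the
  arrows, in Cc G or not; so it can be stated for limits.\<close>

definition ker_bounded :: "('g \<Rightarrow> complex) \<Rightarrow> real \<Rightarrow> bool" where
  "ker_bounded f C \<longleftrightarrow> 0 \<le> C \<and>
    (\<forall>x\<in>units G. matrix_bounded p (dom_fibre G x) (\<lambda>\<gamma> \<sigma>. f (quot \<gamma> \<sigma>)) C)"

text \<open>For fixed \<gamma> the map \<open>quot \<gamma>\<close> is injective and sends the
  support of the row into the arrows of K with range \<open>gran G \<gamma>\<close>; columns land in
  the arrows of K with a given domain. Both sets are uniformly finite.\<close>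

lemma Cc_sparse:
  assumes "f \<in> Cc G"
  obtains n where
    "\<And>x \<gamma>. \<gamma> \<in> dom_fibre G x \<Longrightarrow> finite {\<sigma>\<in>dom_fibre G x. f (quot \<gamma> \<sigma>) \<noteq> 0} \<and>
      card {\<sigma>\<in>dom_fibre G x. f (quot \<gamma> \<sigma>) \<noteq> 0} \<le> n"
    "\<And>x \<sigma>. \<sigma> \<in> dom_fibre G x \<Longrightarrow> finite {\<gamma>\<in>dom_fibre G x. f (quot \<gamma> \<sigma>) \<noteq> 0} \<and>
      card {\<gamma>\<in>dom_fibre G x. f (quot \<gamma> \<sigma>) \<noteq> 0} \<le> n"
proof -
  obtain K where K: "compactin (gtop G) K" "\<And>\<gamma>. f \<gamma> \<noteq> 0 \<Longrightarrow> \<gamma> \<in> K" using Cc_support[OF assms] by blast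
  obtain n where n: "\<And>x. finite {\<gamma>\<in>K. gdom G \<gamma> = x}" "\<And>x. card {\<gamma>\<in>K. gdom G \<gamma> = x} \<le> n"
    "\<And>x. finite {\<gamma>\<in>K. gran G \<gamma> = x}" "\<And>x. card {\<gamma>\<in>K. gran G \<gamma> = x} \<le> n"
    using compact_fibres_bounded[OF K(1)] by metis
  have inj: "inj_on (\<lambda>\<gamma>. quot \<gamma> \<sigma>) (dom_fibre G x)" if "\<sigma> \<in> dom_fibre G x" for \<sigma> x
    using quot_bij_betw[OF that] by (rule bij_betw_imp_inj_on)
  have inj': "inj_on (\<lambda>\<sigma>. quot \<gamma> \<sigma>) (dom_fibre G x)" if \<gamma>: "\<gamma> \<in> dom_fibre G x" for \<gamma> x
  proof (rule inj_onI)
    fix \<sigma> \<tau> assume "\<sigma> \<in> dom_fibre G x" "\<tau> \<in> dom_fibre G x" "quot \<gamma> \<sigma> = quot \<gamma> \<tau>"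
    then have "quot \<sigma> \<gamma> = quot \<tau> \<gamma>" using inv_quot \<gamma> by metis
    then show "\<sigma> = \<tau>" using inj_onD[OF inj[OF \<gamma>]] \<open>\<sigma> \<in> _\<close> \<open>\<tau> \<in> _\<close> by blast
  qed
  have *: "finite S \<and> card S \<le> n" if "inj_on q S" "q ` S \<subseteq> T" "finite T" "card T \<le> n" for q :: "'g \<Rightarrow> 'g" and S T
    using that card_inj_on_le[OF that(1,2,3)] inj_on_finite[OF that(1,2,3)] by linarith
  show thesis
  proof (rule that[of n])
    fix x \<gamma> assume \<gamma>: "\<gamma> \<in> dom_fibre G x"
    show "finite {\<sigma>\<in>dom_fibre G x. f (quot \<gamma> \<sigma>) \<noteq> 0} \<and> card {\<sigma>\<in>dom_fibre G x. f (quot \<gamma> \<sigma>) \<noteq> 0} \<le> n"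
    proof (rule *[of "quot \<gamma>"])
      show "quot \<gamma> ` {\<sigma>\<in>dom_fibre G x. f (quot \<gamma> \<sigma>) \<noteq> 0} \<subseteq> {\<eta>\<in>K. gran G \<eta> = gran G \<gamma>}"
        using K(2) ran_quot[OF \<gamma>] by auto
    qed (use n inj'[OF \<gamma>] in \<open>auto intro: inj_on_subset\<close>)
    show "finite {\<rho>\<in>dom_fibre G x. f (quot \<rho> \<gamma>) \<noteq> 0} \<and> card {\<rho>\<in>dom_fibre G x. f (quot \<rho> \<gamma>) \<noteq> 0} \<le> n"
    proof (rule *[of "\<lambda>\<rho>. quot \<rho> \<gamma>"])
      show "(\<lambda>\<rho>. quot \<rho> \<gamma>) ` {\<rho>\<in>dom_fibre G x. f (quot \<rho> \<gamma>) \<noteq> 0} \<subseteq> {\<eta>\<in>K. gdom G \<eta> = gran G \<gamma>}"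
        using K(2) dom_quot[OF _ \<gamma>] by auto
    qed (use n inj[OF \<gamma>] in \<open>auto intro: inj_on_subset\<close>)
  qed
qed

lemma Cc_finite_rows: "f \<in> Cc G \<Longrightarrow> \<gamma> \<in> dom_fibre G x \<Longrightarrow> finite {\<sigma>\<in>dom_fibre G x. f (quot \<gamma> \<sigma>) \<noteq> 0}"
  and Cc_finite_columns: "f \<in> Cc G \<Longrightarrow> \<sigma> \<in> dom_fibre G x \<Longrightarrow> finite {\<gamma>\<in>dom_fibre G x. f (quot \<gamma> \<sigma>) \<noteq> 0}"
  by (metis (no_types, lifting) Cc_sparse)+

lemma Cc_ker_bounded:
  assumes f: "f \<in> Cc G" obtains C where "ker_bounded f C"
proof -
  obtain n where n: "\<And>x \<gamma>. \<gamma> \<in> dom_fibre G x \<Longrightarrow> finite {\<sigma>\<in>dom_fibre G x. f (quot \<gamma> \<sigma>) \<noteq> 0} \<and>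
      card {\<sigma>\<in>dom_fibre G x. f (quot \<gamma> \<sigma>) \<noteq> 0} \<le> n"
    "\<And>x \<sigma>. \<sigma> \<in> dom_fibre G x \<Longrightarrow> finite {\<gamma>\<in>dom_fibre G x. f (quot \<gamma> \<sigma>) \<noteq> 0} \<and>
      card {\<gamma>\<in>dom_fibre G x. f (quot \<gamma> \<sigma>) \<noteq> 0} \<le> n"
    using Cc_sparse[OF f] by blast
  obtain K where K: "0 \<le> K" "\<And>\<gamma>. norm (f \<gamma>) \<le> K" using Cc_bounded[OF f] by blast
  have "ker_bounded f (real n * K * real n powr (1 / p))"
    unfolding ker_bounded_def using matrix_bounded_sparse[OF p n K(2) K(1)] K(1) by simp
  then show thesis by (rule that)
qed

lemma lp_opnorm_le_iff:
  assumes "f \<in> Cc G" "x \<in> units G" "0 \<le> C"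
  shows "lp_opnorm p (dom_fibre G x) (left_reg G x f) \<le> C \<longleftrightarrow>
    matrix_bounded p (dom_fibre G x) (\<lambda>\<gamma> \<sigma>. f (quot \<gamma> \<sigma>)) C"
proof -
  obtain C0 where "ker_bounded f C0" using Cc_ker_bounded[OF assms(1)] by blast
  then have "matrix_bounded p (dom_fibre G x) (\<lambda>\<gamma> \<sigma>. f (quot \<gamma> \<sigma>)) C0"
    using assms(2) by (simp add: ker_bounded_def)
  then show ?thesis
    unfolding left_reg_matrix_operator
    using lp_opnorm_matrix_operator[OF p] Cc_finite_rows[OF assms(1)] assms(3) by blast
qed

text \<open>The supremum becomes usable only after \<open>Cc_ker_bounded\<close> has bounded the
  norms of all fibres together; the inserted 0 is harmless because C \<ge> 0. From here on the
  reduced norm is handled through \<open>ker_bounded\<close>.\<close>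

lemma reduced_norm_le_iff:
  assumes f: "f \<in> Cc G" and C: "0 \<le> C"
  shows "reduced_norm p G f \<le> C \<longleftrightarrow> ker_bounded f C"
proof -
  let ?S = "insert 0 ((\<lambda>x. lp_opnorm p (dom_fibre G x) (left_reg G x f)) ` units G)"
  obtain C0 where C0: "ker_bounded f C0" using Cc_ker_bounded[OF f] by blast
  then have "y \<le> C0" if "y \<in> ?S" for y
    using that lp_opnorm_le_iff[OF f] by (auto simp: ker_bounded_def)
  then have "bdd_above ?S" by (rule bdd_aboveI)
  then have "Sup ?S \<le> C \<longleftrightarrow> (\<forall>y\<in>?S. y \<le> C)" by (intro cSup_le_iff) auto
  then show ?thesis
    using C lp_opnorm_le_iff[OF f] by (auto simp: reduced_norm_def ker_bounded_def)
qed

lemma reduced_norm_nonneg: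
  assumes f: "f \<in> Cc G" shows "0 \<le> reduced_norm p G f"
proof -
  let ?S = "insert 0 ((\<lambda>x. lp_opnorm p (dom_fibre G x) (left_reg G x f)) ` units G)"
  obtain C0 where C0: "ker_bounded f C0" using Cc_ker_bounded[OF f] by blast
  then have "y \<le> C0" if "y \<in> ?S" for y
    using that lp_opnorm_le_iff[OF f] by (auto simp: ker_bounded_def)
  then have "bdd_above ?S" by (rule bdd_aboveI)
  then show ?thesis unfolding reduced_norm_def by (rule cSup_upper[rotated]) simp
qed

lemma ker_bounded_reduced_norm: "f \<in> Cc G \<Longrightarrow> ker_bounded f (reduced_norm p G f)"
  using reduced_norm_le_iff[of f "reduced_norm p G f"] reduced_norm_nonneg by simp

lemma reduced_norm_le: "f \<in> Cc G \<Longrightarrow> ker_bounded f C \<Longrightarrow> reduced_norm p G f \<le> C"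
  using reduced_norm_le_iff by (simp add: ker_bounded_def)

text \<open>The value of f at \<gamma> is the matrix entry at (\<gamma>,
  \<open>gdom G \<gamma>\<close>) on the fibre over \<open>gdom G \<gamma>\<close>.\<close>

lemma ker_bounded_entry:
  assumes "ker_bounded f C" "\<gamma> \<in> arrows G" shows "norm (f \<gamma>) \<le> C"
proof -
  have u: "gdom G \<gamma> \<in> units G" using assms dom_units by blast
  then have "norm (f (quot \<gamma> (gdom G \<gamma>))) \<le> C"
    using assms u by (intro matrix_bounded_entry[OF p, of "dom_fibre G (gdom G \<gamma>)" "\<lambda>\<gamma> \<sigma>. f (quot \<gamma> \<sigma>)"])
      (auto simp: ker_bounded_def dom_fibre_unit dom_fibre_iff[of \<gamma>])
  then show ?thesis using quot_unit[OF u] assms(2) by (simp add: dom_fibre_iff)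
qed

lemma ker_bounded_add: "ker_bounded f C \<Longrightarrow> ker_bounded g D \<Longrightarrow> ker_bounded (\<lambda>\<gamma>. f \<gamma> + g \<gamma>) (C + D)"
  unfolding ker_bounded_def using matrix_bounded_add[OF p] by fastforce

lemma ker_bounded_smult: "ker_bounded f C \<Longrightarrow> ker_bounded (\<lambda>\<gamma>. c * f \<gamma>) (norm c * C)"
  unfolding ker_bounded_def using matrix_bounded_mult_const[OF p] by fastforce

text \<open>The left regular representation is multiplicative: translating by \<sigma> turns the
  convolution sum into the entry of a matrix product.\<close>

lemma convolution_quot:
  assumes "\<gamma> \<in> dom_fibre G x" "\<sigma> \<in> dom_fibre G x" and g: "g \<in> Cc G"
  shows "convolution G f g (quot \<gamma> \<sigma>) =
    (\<Sum>\<rho>\<in>{\<rho>\<in>dom_fibre G x. g (quot \<rho> \<sigma>) \<noteq> 0}. f (quot \<gamma> \<rho>) * g (quot \<rho> \<sigma>))"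
proof -
  let ?F = "{\<rho>\<in>dom_fibre G x. g (quot \<rho> \<sigma>) \<noteq> 0}"
  have bij: "bij_betw (\<lambda>\<rho>. quot \<rho> \<sigma>) (dom_fibre G x) (dom_fibre G (gran G \<sigma>))"
    by (rule quot_bij_betw[OF assms(2)])
  have "convolution G f g (quot \<gamma> \<sigma>) = (\<Sum>\<tau>\<in>(\<lambda>\<rho>. quot \<rho> \<sigma>) ` ?F. f (quot (quot \<gamma> \<sigma>) \<tau>) * g \<tau>)"
  proof (rule convolution_eq_sum)
    show "quot \<gamma> \<sigma> \<in> arrows G" by (rule quot_closed[OF assms(1,2)])
    show "finite ((\<lambda>\<rho>. quot \<rho> \<sigma>) ` ?F)" using Cc_finite_columns[OF g assms(2)] by simp
    show "(\<lambda>\<rho>. quot \<rho> \<sigma>) ` ?F \<subseteq> dom_fibre G (gdom G (quot \<gamma> \<sigma>))"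
      unfolding dom_quot[OF assms(1,2)] using bij by (auto simp: bij_betw_def)
    fix \<tau> assume \<tau>: "\<tau> \<in> dom_fibre G (gdom G (quot \<gamma> \<sigma>))" "\<tau> \<notin> (\<lambda>\<rho>. quot \<rho> \<sigma>) ` ?F"
    then obtain \<rho> where "\<rho> \<in> dom_fibre G x" "\<tau> = quot \<rho> \<sigma>"
      unfolding dom_quot[OF assms(1,2)] using bij by (auto simp: bij_betw_def image_iff)
    then have "g \<tau> = 0" using \<tau>(2) by blast
    then show "f (quot (quot \<gamma> \<sigma>) \<tau>) * g \<tau> = 0" by simp
  qed
  also have "\<dots> = (\<Sum>\<rho>\<in>?F. f (quot (quot \<gamma> \<sigma>) (quot \<rho> \<sigma>)) * g (quot \<rho> \<sigma>))"
    using bij by (subst sum.reindex) (auto simp: bij_betw_def intro: inj_on_subset)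
  also have "\<dots> = (\<Sum>\<rho>\<in>?F. f (quot \<gamma> \<rho>) * g (quot \<rho> \<sigma>))"
    using quot_quot[OF assms(1) _ assms(2)] by (intro sum.cong) auto
  finally show ?thesis .
qed

lemma ker_bounded_convolution:
  assumes "ker_bounded f C" "ker_bounded g D" and g: "g \<in> Cc G"
  shows "ker_bounded (convolution G f g) (C * D)"
  unfolding ker_bounded_def
proof (intro conjI ballI)
  show "0 \<le> C * D" using assms by (simp add: ker_bounded_def)
  fix x assume x: "x \<in> units G"
  show "matrix_bounded p (dom_fibre G x) (\<lambda>\<gamma> \<sigma>. convolution G f g (quot \<gamma> \<sigma>)) (C * D)"
  proof (rule matrix_bounded_mult[OF p, where F = "\<lambda>\<sigma>. {\<rho>\<in>dom_fibre G x. g (quot \<rho> \<sigma>) \<noteq> 0}"])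
    show "matrix_bounded p (dom_fibre G x) (\<lambda>\<gamma> \<sigma>. f (quot \<gamma> \<sigma>)) C"
      "matrix_bounded p (dom_fibre G x) (\<lambda>\<gamma> \<sigma>. g (quot \<gamma> \<sigma>)) D"
      using assms x by (auto simp: ker_bounded_def)
  qed (use Cc_finite_columns[OF g] convolution_quot[OF _ _ g] in auto)
qed

text \<open>By \<open>quot_units_iff\<close> the kernel is diagonal, and the norm of a diagonal
  matrix is the supremum of its entries.\<close>

lemma ker_bounded_units:
  assumes "\<And>\<gamma>. \<gamma> \<in> arrows G \<Longrightarrow> \<gamma> \<notin> units G \<Longrightarrow> f \<gamma> = 0" "\<And>x. x \<in> units G \<Longrightarrow> norm (f x) \<le> C" "0 \<le> C"
  shows "ker_bounded f C"
  unfolding ker_bounded_def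
proof (intro conjI ballI assms(3))
  fix x assume x: "x \<in> units G"
  have "f (quot \<gamma> \<sigma>) = (if \<gamma> = \<sigma> then f (gran G \<gamma>) else 0)" if "\<gamma> \<in> dom_fibre G x" "\<sigma> \<in> dom_fibre G x" for \<gamma> \<sigma>
    using that quot_self[of \<gamma>] assms(1)[OF quot_closed[OF that]] quot_units_iff[OF that]
    by (auto simp: dom_fibre_iff)
  moreover have "matrix_bounded p (dom_fibre G x) (\<lambda>\<gamma> \<sigma>. if \<gamma> = \<sigma> then f (gran G \<gamma>) else 0) C"
    using assms(2,3) ran_units by (intro matrix_bounded_diagonal[OF p]) (auto simp: dom_fibre_iff)
  ultimately show "matrix_bounded p (dom_fibre G x) (\<lambda>\<gamma> \<sigma>. f (quot \<gamma> \<sigma>)) C"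
    by (subst matrix_bounded_cong) auto
qed

lemma convolution_fibre_sum:
  assumes "\<gamma> \<in> arrows G" "finite S" "{\<sigma>\<in>dom_fibre G (gdom G \<gamma>). g \<sigma> \<noteq> 0} \<subseteq> S" "S \<subseteq> dom_fibre G (gdom G \<gamma>)"
  shows "convolution G f g \<gamma> = (\<Sum>\<sigma>\<in>S. f (quot \<gamma> \<sigma>) * g \<sigma>)"
  using assms by (intro convolution_eq_sum) auto

lemma convolution_outside: "\<gamma> \<notin> arrows G \<Longrightarrow> convolution G f g \<gamma> = 0"
  by (simp add: convolution_def)

lemma convolution_left_units:
  assumes "\<gamma> \<in> arrows G" "\<And>\<eta>. \<eta> \<in> arrows G \<Longrightarrow> \<eta> \<notin> units G \<Longrightarrow> f \<eta> = 0"
  shows "convolution G f g \<gamma> = f (gran G \<gamma>) * g \<gamma>"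
proof -
  have \<gamma>: "\<gamma> \<in> dom_fibre G (gdom G \<gamma>)" using assms(1) by (simp add: dom_fibre_iff)
  have "convolution G f g \<gamma> = (\<Sum>\<sigma>\<in>{\<gamma>}. f (quot \<gamma> \<sigma>) * g \<sigma>)"
  proof (rule convolution_eq_sum)
    show "f (quot \<gamma> \<sigma>) * g \<sigma> = 0" if "\<sigma> \<in> dom_fibre G (gdom G \<gamma>)" "\<sigma> \<notin> {\<gamma>}" for \<sigma>
      using assms(2)[OF quot_closed[OF \<gamma> that(1)]] quot_units_iff[OF \<gamma> that(1)] that(2) by auto
  qed (use assms \<gamma> in auto)
  then show ?thesis using quot_self[OF assms(1)] by simp
qed

lemma convolution_right_units:
  assumes "\<gamma> \<in> arrows G" "\<And>\<eta>. \<eta> \<in> arrows G \<Longrightarrow> \<eta> \<notin> units G \<Longrightarrow> g \<eta> = 0"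
  shows "convolution G f g \<gamma> = f \<gamma> * g (gdom G \<gamma>)"
proof -
  have \<gamma>: "\<gamma> \<in> dom_fibre G (gdom G \<gamma>)" using assms(1) by (simp add: dom_fibre_iff)
  have "convolution G f g \<gamma> = (\<Sum>\<sigma>\<in>{gdom G \<gamma>}. f (quot \<gamma> \<sigma>) * g \<sigma>)"
  proof (rule convolution_eq_sum)
    show "f (quot \<gamma> \<sigma>) * g \<sigma> = 0" if "\<sigma> \<in> dom_fibre G (gdom G \<gamma>)" "\<sigma> \<notin> {gdom G \<gamma>}" for \<sigma>
      using assms(2)[of \<sigma>] that by (auto simp: units_iff dom_fibre_iff)
  qed (use assms \<gamma> dom_units dom_fibre_unit in auto)
  then show ?thesis using quot_unit[OF dom_units[OF assms(1)] \<gamma>] by simp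
qed

section \<open>Compactly supported functions as a normed algebra\<close>

abbreviation "CcA \<equiv> Cc_algebra p G"

lemma CcA_simps:
  "carrier CcA = Cc G" "monoid.mult CcA = convolution G" "\<one>\<^bsub>CcA\<^esub> = (\<lambda>\<gamma>. if \<gamma> \<in> units G then 1 else 0)"
  "\<zero>\<^bsub>CcA\<^esub> = (\<lambda>_. 0)" "add CcA = (\<lambda>f g \<gamma>. f \<gamma> + g \<gamma>)" "smult CcA = (\<lambda>c f \<gamma>. c * f \<gamma>)"
  "nrm CcA = reduced_norm p G"
  by (simp_all add: Cc_algebra_def)

lemma reduced_norm_smult_le:
  "f \<in> Cc G \<Longrightarrow> reduced_norm p G (\<lambda>\<gamma>. c * f \<gamma>) \<le> norm c * reduced_norm p G f"
  by (intro reduced_norm_le Cc_smult ker_bounded_smult ker_bounded_reduced_norm)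

lemma Cc_abelian_group: "abelian_group CcA"
proof (rule abelian_groupI, unfold CcA_simps)
  show "\<exists>g\<in>Cc G. (\<lambda>\<gamma>. g \<gamma> + f \<gamma>) = (\<lambda>_. 0)" if "f \<in> Cc G" for f
    using Cc_smult[OF that, of "-1"] by (intro bexI[of _ "\<lambda>\<gamma>. -1 * f \<gamma>"]) auto
qed (auto simp: Cc_add Cc_zero add_ac)

lemma Cc_normed: "nonassoc_normed_algebra CcA"
proof -
  interpret abelian_group CcA by (rule Cc_abelian_group)
  show ?thesis
  proof (unfold_locales, unfold CcA_simps)
    fix f assume f: "f \<in> Cc G"
    show "convolution G (\<lambda>\<gamma>. if \<gamma> \<in> units G then 1 else 0) f = f"
    proof
      fix \<gamma> show "convolution G (\<lambda>\<gamma>. if \<gamma> \<in> units G then 1 else 0) f \<gamma> = f \<gamma>"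
        using f ran_units by (cases "\<gamma> \<in> arrows G") (simp_all add: convolution_left_units Cc_outside convolution_outside)
    qed
    show "convolution G f (\<lambda>\<gamma>. if \<gamma> \<in> units G then 1 else 0) = f"
    proof
      fix \<gamma> show "convolution G f (\<lambda>\<gamma>. if \<gamma> \<in> units G then 1 else 0) \<gamma> = f \<gamma>"
        using f dom_units by (cases "\<gamma> \<in> arrows G") (simp_all add: convolution_right_units Cc_outside convolution_outside)
    qed
    show "0 \<le> reduced_norm p G f" by (rule reduced_norm_nonneg[OF f])
    show "reduced_norm p G (\<lambda>\<gamma>. c * f \<gamma>) = norm c * reduced_norm p G f" for c
    proof (rule antisym[OF reduced_norm_smult_le[OF f]])
      show "norm c * reduced_norm p G f \<le> reduced_norm p G (\<lambda>\<gamma>. c * f \<gamma>)"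
      proof (cases "c = 0")
        case False
        \<comment> \<open>The reverse inequality follows from the first one, applied to scaling back
          by \<open>inverse c\<close>.\<close>
        have "reduced_norm p G f \<le> norm (inverse c) * reduced_norm p G (\<lambda>\<gamma>. c * f \<gamma>)"
          using reduced_norm_smult_le[OF Cc_smult[OF f, of c], of "inverse c"] False
          by (simp add: mult.assoc[symmetric])
        then show ?thesis using False by (simp add: norm_divide field_simps)
      qed (simp add: reduced_norm_nonneg Cc_zero)
    qed
    fix g assume g: "g \<in> Cc G"
    show "convolution G f g \<in> Cc G" by (rule convolution_Cc[OF f g])
    show "reduced_norm p G (\<lambda>\<gamma>. f \<gamma> + g \<gamma>) \<le> reduced_norm p G f + reduced_norm p G g"
      by (intro reduced_norm_le Cc_add ker_bounded_add ker_bounded_reduced_norm f g)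
    show "reduced_norm p G (convolution G f g) \<le> reduced_norm p G f * reduced_norm p G g"
      by (intro reduced_norm_le convolution_Cc ker_bounded_convolution ker_bounded_reduced_norm f g)
    fix h assume h: "h \<in> Cc G"
    show "convolution G (\<lambda>\<gamma>. f \<gamma> + g \<gamma>) h = (\<lambda>\<gamma>. convolution G f h \<gamma> + convolution G g h \<gamma>)"
    proof
      fix \<gamma> show "convolution G (\<lambda>\<gamma>. f \<gamma> + g \<gamma>) h \<gamma> = convolution G f h \<gamma> + convolution G g h \<gamma>"
      proof (cases "\<gamma> \<in> arrows G")
        case True
        have "convolution G u h \<gamma> = (\<Sum>\<sigma>\<in>{\<sigma>\<in>dom_fibre G (gdom G \<gamma>). h \<sigma> \<noteq> 0}. u (quot \<gamma> \<sigma>) * h \<sigma>)" for u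
          using True Cc_finite_fibre[OF h] by (intro convolution_fibre_sum) auto
        then show ?thesis by (simp add: distrib_right sum.distrib)
      qed (simp add: convolution_outside)
    qed
    show "convolution G h (\<lambda>\<gamma>. f \<gamma> + g \<gamma>) = (\<lambda>\<gamma>. convolution G h f \<gamma> + convolution G h g \<gamma>)"
    proof
      fix \<gamma> show "convolution G h (\<lambda>\<gamma>. f \<gamma> + g \<gamma>) \<gamma> = convolution G h f \<gamma> + convolution G h g \<gamma>"
      proof (cases "\<gamma> \<in> arrows G")
        case True
        let ?D = "dom_fibre G (gdom G \<gamma>)"
        \<comment> \<open>One index set for all three convolutions, since f, g and their sum have
          different supports.\<close>
        let ?S = "{\<sigma>\<in>?D. f \<sigma> \<noteq> 0} \<union> {\<sigma>\<in>?D. g \<sigma> \<noteq> 0}"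
        have "convolution G h u \<gamma> = (\<Sum>\<sigma>\<in>?S. h (quot \<gamma> \<sigma>) * u \<sigma>)"
          if "{\<sigma>\<in>?D. u \<sigma> \<noteq> 0} \<subseteq> ?S" for u
          using True Cc_finite_fibre[OF f] Cc_finite_fibre[OF g] that by (intro convolution_fibre_sum) auto
        from this[of f] this[of g] this[of "\<lambda>\<gamma>. f \<gamma> + g \<gamma>"] show ?thesis
          by (fastforce simp: distrib_left sum.distrib)
      qed (simp add: convolution_outside)
    qed
  qed (auto simp: Cc_one Cc_smult algebra_simps)
qed

end

section \<open>Elements of the reduced algebra as functions\<close>

context reduced_groupoid_algebra
begin

abbreviation "FpA \<equiv> Fp_lambda p G"

sublocale N: nonassoc_normed_algebra CcA by (rule Cc_normed)
sublocale A: nonassoc_banach_algebra FpA unfolding Fp_lambda_def by (rule N.completion_banach)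

lemma CcA_minus: "f \<in> Cc G \<Longrightarrow> g \<in> Cc G \<Longrightarrow> f \<ominus>\<^bsub>CcA\<^esub> g = (\<lambda>\<gamma>. f \<gamma> - g \<gamma>)"
  using N.smult_minus_one[of g, symmetric] by (simp add: a_minus_def CcA_simps)

lemma norm_le_reduced_norm: "f \<in> Cc G \<Longrightarrow> norm (f \<gamma>) \<le> reduced_norm p G f"
  using ker_bounded_entry[OF ker_bounded_reduced_norm, of f \<gamma>] reduced_norm_nonneg[of f] Cc_outside[of f \<gamma>]
  by (cases "\<gamma> \<in> arrows G") auto

lemma gap_entry: "f \<in> Cc G \<Longrightarrow> g \<in> Cc G \<Longrightarrow> norm (f \<gamma> - g \<gamma>) \<le> N.gap f g"
  using norm_le_reduced_norm[of "\<lambda>\<gamma>. f \<gamma> - g \<gamma>" \<gamma>] N.minus_closed[of f g]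
  by (simp add: N.gap_def CcA_minus CcA_simps)

lemma cauchy_seqs_Cc: "X \<in> cauchy_seqs CcA \<Longrightarrow> X n \<in> Cc G"
  using N.cauchy_seqs_carrier by (simp add: CcA_simps)

lemma Cc_diff: "f \<in> Cc G \<Longrightarrow> g \<in> Cc G \<Longrightarrow> (\<lambda>\<gamma>. f \<gamma> - g \<gamma>) \<in> Cc G"
  using N.minus_closed[of f g] by (simp add: CcA_minus CcA_simps)

lemma cauchy_seqs_entry:
  assumes X: "X \<in> cauchy_seqs CcA" shows "convergent (\<lambda>n. X n \<gamma>)"
proof -
  have "Cauchy (\<lambda>n. X n \<gamma>)"
  proof (rule CauchyI)
    fix e :: real assume "e > 0"
    then obtain M where "\<And>m n. m \<ge> M \<Longrightarrow> n \<ge> M \<Longrightarrow> N.gap (X m) (X n) < e"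
      using N.cauchy_seqsD[OF X, of e] by blast
    then show "\<exists>M. \<forall>m\<ge>M. \<forall>n\<ge>M. norm (X m \<gamma> - X n \<gamma>) < e"
      using gap_entry[OF cauchy_seqs_Cc[OF X] cauchy_seqs_Cc[OF X]] by (meson le_less_trans)
  qed
  then show ?thesis by (rule Cauchy_convergent)
qed

text \<open>The function on G that an element of the completion stands for. The limit exists because
  point evaluations are bounded by the reduced norm, and \<open>J_cls\<close> shows that it can be
  taken along any representative.\<close>

definition J :: "(nat \<Rightarrow> 'g \<Rightarrow> complex) set \<Rightarrow> 'g \<Rightarrow> complex" where
  "J P \<gamma> = lim (\<lambda>n. rep P n \<gamma>)"

lemma carrier_FpA: "carrier FpA = N.cls ` cauchy_seqs CcA"
  unfolding Fp_lambda_def by (rule N.carrier_completion)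

lemma J_cls:
  assumes X: "X \<in> cauchy_seqs CcA" shows "(\<lambda>n. X n \<gamma>) \<longlonglongrightarrow> J (N.cls X) \<gamma>"
proof -
  let ?R = "rep (N.cls X)"
  have r: "(?R, X) \<in> null_rel CcA" by (rule N.rep_cls[OF X])
  then have R: "?R \<in> cauchy_seqs CcA" by (simp add: N.null_rel_iff)
  have "(\<lambda>n. ?R n \<gamma>) \<longlonglongrightarrow> J (N.cls X) \<gamma>"
    using cauchy_seqs_entry[OF R] by (simp add: J_def convergent_LIMSEQ_iff)
  moreover have "(\<lambda>n. X n \<gamma> - ?R n \<gamma>) \<longlonglongrightarrow> 0"
  proof (rule Lim_null_comparison)
    show "(\<lambda>n. N.gap (?R n) (X n)) \<longlonglongrightarrow> 0" using r by (simp add: N.null_rel_iff)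
    show "\<forall>\<^sub>F n in sequentially. norm (X n \<gamma> - ?R n \<gamma>) \<le> N.gap (?R n) (X n)"
      using gap_entry[OF cauchy_seqs_Cc[OF R] cauchy_seqs_Cc[OF X]] by (simp add: norm_minus_commute)
  qed
  ultimately show ?thesis using tendsto_add by fastforce
qed

lemma J_eqI: "X \<in> cauchy_seqs CcA \<Longrightarrow> (\<lambda>n. X n \<gamma>) \<longlonglongrightarrow> l \<Longrightarrow> J (N.cls X) \<gamma> = l"
  using J_cls LIMSEQ_unique by blast

lemma FpA_add: "X \<in> cauchy_seqs CcA \<Longrightarrow> Y \<in> cauchy_seqs CcA \<Longrightarrow>
    N.cls X \<oplus>\<^bsub>FpA\<^esub> N.cls Y = N.cls (\<lambda>n \<gamma>. X n \<gamma> + Y n \<gamma>)"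
  using N.cls_add by (simp add: Fp_lambda_def CcA_simps)

lemma FpA_mult: "X \<in> cauchy_seqs CcA \<Longrightarrow> Y \<in> cauchy_seqs CcA \<Longrightarrow>
    N.cls X \<otimes>\<^bsub>FpA\<^esub> N.cls Y = N.cls (\<lambda>n. convolution G (X n) (Y n))"
  using N.cls_mult by (simp add: Fp_lambda_def CcA_simps)

lemma FpA_smult: "X \<in> cauchy_seqs CcA \<Longrightarrow> c \<odot>\<^bsub>FpA\<^esub> N.cls X = N.cls (\<lambda>n \<gamma>. c * X n \<gamma>)"
  using N.cls_smult by (simp add: Fp_lambda_def CcA_simps)

lemma cauchy_seqs_CcA_ops:
  assumes "X \<in> cauchy_seqs CcA"
  shows "Y \<in> cauchy_seqs CcA \<Longrightarrow> (\<lambda>n \<gamma>. X n \<gamma> + Y n \<gamma>) \<in> cauchy_seqs CcA"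
    "Y \<in> cauchy_seqs CcA \<Longrightarrow> (\<lambda>n. convolution G (X n) (Y n)) \<in> cauchy_seqs CcA"
    "(\<lambda>n \<gamma>. c * X n \<gamma>) \<in> cauchy_seqs CcA"
  using N.cauchy_seqs_add[OF assms] N.cauchy_seqs_mult[OF assms] N.cauchy_seqs_smult[OF assms]
  by (simp_all add: CcA_simps)

abbreviation emb :: "('g \<Rightarrow> complex) \<Rightarrow> (nat \<Rightarrow> 'g \<Rightarrow> complex) set" where
  "emb \<equiv> Fp_embed p G"

lemma emb_cls: "emb f = N.cls (\<lambda>n. f)"
  by (simp add: Fp_embed_def completion_embed_def)

lemma const_cauchy: "f \<in> Cc G \<Longrightarrow> (\<lambda>n. f) \<in> cauchy_seqs CcA"
  using N.cauchy_seqs_const by (simp add: CcA_simps)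

lemma emb_carrier: "f \<in> Cc G \<Longrightarrow> emb f \<in> carrier FpA"
  using const_cauchy by (auto simp: emb_cls carrier_FpA)

lemma J_emb: "f \<in> Cc G \<Longrightarrow> J (emb f) = f"
  unfolding emb_cls by (intro ext J_eqI const_cauchy tendsto_const)

lemma J_add:
  assumes "P \<in> carrier FpA" "Q \<in> carrier FpA" shows "J (P \<oplus>\<^bsub>FpA\<^esub> Q) \<gamma> = J P \<gamma> + J Q \<gamma>"
proof -
  obtain X Y where XY: "X \<in> cauchy_seqs CcA" "P = N.cls X" "Y \<in> cauchy_seqs CcA" "Q = N.cls Y"
    using assms by (auto simp: carrier_FpA)
  show ?thesis unfolding XY(2,4) FpA_add[OF XY(1,3)]
    by (intro J_eqI cauchy_seqs_CcA_ops tendsto_add J_cls XY)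
qed

lemma J_smult:
  assumes "P \<in> carrier FpA" shows "J (c \<odot>\<^bsub>FpA\<^esub> P) \<gamma> = c * J P \<gamma>"
proof -
  obtain X where X: "X \<in> cauchy_seqs CcA" "P = N.cls X"
    using assms by (auto simp: carrier_FpA)
  show ?thesis unfolding X(2) FpA_smult[OF X(1)]
    by (intro J_eqI cauchy_seqs_CcA_ops tendsto_mult_left J_cls X)
qed

lemma one_FpA: "\<one>\<^bsub>FpA\<^esub> = emb (\<lambda>\<gamma>. if \<gamma> \<in> units G then 1 else 0)"
  using N.completion_one by (simp add: Fp_lambda_def emb_cls CcA_simps)

lemma J_one: "J \<one>\<^bsub>FpA\<^esub> = (\<lambda>\<gamma>. if \<gamma> \<in> units G then 1 else 0)"
  by (simp add: one_FpA J_emb Cc_one)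

lemma J_ker_bounded:
  assumes "P \<in> carrier FpA" shows "ker_bounded (J P) (nrm FpA P)"
proof -
  obtain X where X: "X \<in> cauchy_seqs CcA" "P = N.cls X"
    using assms by (auto simp: carrier_FpA)
  have lim: "(\<lambda>n. reduced_norm p G (X n)) \<longlonglongrightarrow> nrm FpA P"
    using N.cls_nrm[OF X(1)] X(2) by (simp add: Fp_lambda_def CcA_simps)
  show ?thesis
    unfolding ker_bounded_def
  proof (intro conjI ballI A.nrm_nonneg assms)
    fix x assume x: "x \<in> units G"
    show "matrix_bounded p (dom_fibre G x) (\<lambda>\<gamma> \<sigma>. J P (quot \<gamma> \<sigma>)) (nrm FpA P)"
      using ker_bounded_reduced_norm[OF cauchy_seqs_Cc[OF X(1)]] x X J_cls
      by (intro matrix_bounded_limit[OF p _ _ lim, of 0]) (auto simp: ker_bounded_def)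
  qed
qed

lemma J_outside:
  assumes "P \<in> carrier FpA" "\<gamma> \<notin> arrows G" shows "J P \<gamma> = 0"
proof -
  obtain X where X: "X \<in> cauchy_seqs CcA" "P = N.cls X"
    using assms by (auto simp: carrier_FpA)
  then show ?thesis using J_eqI[OF X(1), of \<gamma> 0] Cc_outside[OF cauchy_seqs_Cc[OF X(1)] assms(2)] by simp
qed

lemma J_norm_le: "P \<in> carrier FpA \<Longrightarrow> norm (J P \<gamma>) \<le> nrm FpA P"
  using ker_bounded_entry[OF J_ker_bounded, of P \<gamma>] J_outside[of P \<gamma>] A.nrm_nonneg[of P]
  by (cases "\<gamma> \<in> arrows G") auto

lemma nrm_emb: "f \<in> Cc G \<Longrightarrow> nrm FpA (emb f) = reduced_norm p G f"
  using N.nrm_cls_const[of f] by (simp add: Fp_lambda_def emb_cls CcA_simps)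

text \<open>An operator on \<open>\<ell>\<^sup>p\<close> is determined by its matrix entries.\<close>

lemma J_inject:
  assumes "P \<in> carrier FpA" "Q \<in> carrier FpA" "J P = J Q" shows "P = Q"
proof -
  obtain X Y where XY: "X \<in> cauchy_seqs CcA" "P = N.cls X" "Y \<in> cauchy_seqs CcA" "Q = N.cls Y"
    using assms by (auto simp: carrier_FpA)
  define Z where "Z n = (\<lambda>\<gamma>. X n \<gamma> + (-1) * Y n \<gamma>)" for n
  have Z: "Z \<in> cauchy_seqs CcA"
    unfolding Z_def by (intro cauchy_seqs_CcA_ops XY)
  note ZC = cauchy_seqs_Cc[OF Z]
  have Z0: "(\<lambda>n. Z n \<gamma>) \<longlonglongrightarrow> 0" for \<gamma>
    using tendsto_diff[OF J_cls[OF XY(1), of \<gamma>] J_cls[OF XY(3), of \<gamma>]] assms(3) XY by (simp add: Z_def)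
  have "(\<lambda>n. N.gap (X n) (Y n)) \<longlonglongrightarrow> 0"
  proof (rule LIMSEQ_I)
    fix e :: real assume e: "e > 0"
    obtain M where M: "\<And>m n. m \<ge> M \<Longrightarrow> n \<ge> M \<Longrightarrow> N.gap (Z m) (Z n) < e / 2"
      using N.cauchy_seqsD[OF Z, of "e / 2"] e by auto
    have "norm (N.gap (X n) (Y n) - 0) < e" if n: "n \<ge> M" for n
    proof -
      \<comment> \<open>For large m the function Z n - Z m is bounded by e / 2, and as m grows its
        entries converge to those of Z n. The finite-section bound passes to this entrywise limit,
        so the reduced norm of Z n itself is small.\<close>
      have "ker_bounded (Z n) (e / 2)"
        unfolding ker_bounded_def
      proof (intro conjI ballI)
        fix x assume x: "x \<in> units G"
        have bd: "matrix_bounded p (dom_fibre G x) (\<lambda>\<gamma> \<sigma>. Z n (quot \<gamma> \<sigma>) - Z m (quot \<gamma> \<sigma>)) (e / 2)" if m: "m \<ge> M" for m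
        proof -
          have "ker_bounded (\<lambda>\<gamma>. Z n \<gamma> - Z m \<gamma>) (reduced_norm p G (\<lambda>\<gamma>. Z n \<gamma> - Z m \<gamma>))"
            by (intro ker_bounded_reduced_norm Cc_diff ZC)
          moreover have "reduced_norm p G (\<lambda>\<gamma>. Z n \<gamma> - Z m \<gamma>) \<le> e / 2"
            using M[OF n m] by (simp add: N.gap_def CcA_minus[OF ZC ZC] CcA_simps)
          ultimately show ?thesis
            using x matrix_bounded_mono[OF p] unfolding ker_bounded_def by blast
        qed
        have lim: "(\<lambda>m. Z n (quot \<gamma> \<sigma>) - Z m (quot \<gamma> \<sigma>)) \<longlonglongrightarrow> Z n (quot \<gamma> \<sigma>)" for \<gamma> \<sigma>
          using tendsto_diff[OF tendsto_const Z0, of "Z n (quot \<gamma> \<sigma>)" "quot \<gamma> \<sigma>"] by simp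
        show "matrix_bounded p (dom_fibre G x) (\<lambda>\<gamma> \<sigma>. Z n (quot \<gamma> \<sigma>)) (e / 2)"
          by (rule matrix_bounded_limit[OF p bd lim tendsto_const])
      qed (use e in auto)
      then have "reduced_norm p G (Z n) \<le> e / 2" by (rule reduced_norm_le[OF ZC])
      moreover have "N.gap (X n) (Y n) = reduced_norm p G (Z n)"
        using CcA_minus[OF cauchy_seqs_Cc[OF XY(1)] cauchy_seqs_Cc[OF XY(3)]]
        by (simp add: N.gap_def Z_def CcA_simps)
      ultimately show ?thesis
        using e N.gap_nonneg[of "X n" "Y n"] N.cauchy_seqs_carrier XY(1,3) by simp
    qed
    then show "\<exists>M. \<forall>n\<ge>M. norm (N.gap (X n) (Y n) - 0) < e" by blast
  qed
  then have "(X, Y) \<in> null_rel CcA" using XY by (simp add: N.null_rel_iff)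
  then show ?thesis using N.cls_eqI XY by blast
qed

text \<open>Values are bounded by the norm, so a Cauchy sequence in the reduced norm converges
  uniformly.\<close>

lemma J_continuous:
  assumes "P \<in> carrier FpA" shows "continuous_map (gtop G) euclidean (J P)"
proof -
  obtain X where X: "X \<in> cauchy_seqs CcA" "P = N.cls X"
    using assms by (auto simp: carrier_FpA)
  have "continuous_map (gtop G) Met_TC.mtopology (J P)"
  proof (rule Met_TC.continuous_map_uniform_limit[where F = sequentially and f = X])
    show "\<forall>\<^sub>F n in sequentially. continuous_map (gtop G) Met_TC.mtopology (X n)"
      using Cc_continuous[OF cauchy_seqs_Cc[OF X(1)]] by simp
    fix e :: real assume e: "e > 0"
    obtain M where M: "\<And>m n. m \<ge> M \<Longrightarrow> n \<ge> M \<Longrightarrow> N.gap (X m) (X n) < e / 2"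
      using N.cauchy_seqsD[OF X(1), of "e / 2"] e by auto
    have "dist (X n \<gamma>) (J P \<gamma>) < e" if n: "n \<ge> M" for n \<gamma>
    proof -
      have "(\<lambda>m. norm (X n \<gamma> - X m \<gamma>)) \<longlonglongrightarrow> norm (X n \<gamma> - J P \<gamma>)"
        unfolding X(2) by (intro tendsto_intros J_cls X(1))
      then have "norm (X n \<gamma> - J P \<gamma>) \<le> e / 2"
      proof (rule LIMSEQ_le_const2, intro exI allI impI)
        fix m assume "m \<ge> M"
        then show "norm (X n \<gamma> - X m \<gamma>) \<le> e / 2"
          using M[OF n, of m] gap_entry[OF cauchy_seqs_Cc[OF X(1)] cauchy_seqs_Cc[OF X(1)], of n \<gamma> m] by linarith
      qed
      then show ?thesis using e by (simp add: dist_norm)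
    qed
    then show "\<forall>\<^sub>F n in sequentially. \<forall>\<gamma>\<in>arrows G. J P \<gamma> \<in> UNIV \<and> dist (X n \<gamma>) (J P \<gamma>) < e"
      by (auto intro: eventually_sequentiallyI)
  qed auto
  then show ?thesis by simp
qed

section \<open>The core of the reduced algebra\<close>

definition Cu :: "('g \<Rightarrow> complex) set" where
  "Cu = {f \<in> Cc G. \<forall>\<gamma>. f \<gamma> \<noteq> 0 \<longrightarrow> \<gamma> \<in> units G}"

lemma Cu_Cc: "f \<in> Cu \<Longrightarrow> f \<in> Cc G"
  and Cu_outside: "f \<in> Cu \<Longrightarrow> \<gamma> \<notin> units G \<Longrightarrow> f \<gamma> = 0"
  by (auto simp: Cu_def)

text \<open>Extension by zero stays continuous because the units are both open and closed in the
  arrows.\<close>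

lemma CuI:
  assumes "continuous_map (unit_space G) euclidean f"
  shows "(\<lambda>\<gamma>. if \<gamma> \<in> units G then f \<gamma> else 0) \<in> Cu"
  unfolding Cu_def
proof (intro CollectI conjI CcI[OF _ _ compact_units])
  let ?f = "\<lambda>\<gamma>. if \<gamma> \<in> units G then f \<gamma> else 0"
  show "continuous_map (gtop G) euclidean ?f"
  proof (rule continuous_map_locally)
    fix \<gamma> assume \<gamma>: "\<gamma> \<in> arrows G"
    have "continuous_map (subtopology (gtop G) (units G)) euclidean ?f"
      by (rule continuous_map_eq[OF assms[unfolded unit_space_def]]) auto
    moreover have "continuous_map (subtopology (gtop G) (arrows G - units G)) euclidean ?f"
      by (rule continuous_map_eq[of _ _ "\<lambda>_. 0"]) auto
    moreover have "openin (gtop G) (arrows G - units G)" using units_closed by (simp add: closedin_def)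
    ultimately show "\<exists>U. openin (gtop G) U \<and> \<gamma> \<in> U \<and> continuous_map (subtopology (gtop G) U) euclidean ?f"
      using units_open \<gamma> by (cases "\<gamma> \<in> units G") blast+
  qed
qed (auto simp: units_arrows split: if_splits)

lemma Cu_continuous: "f \<in> Cu \<Longrightarrow> continuous_map (unit_space G) euclidean f"
  unfolding unit_space_def by (intro continuous_map_from_subtopology Cc_continuous Cu_Cc)

lemma Cu_one: "(\<lambda>\<gamma>. if \<gamma> \<in> units G then 1 else 0) \<in> Cu"
  by (rule CuI) simp

lemma Cu_add: "f \<in> Cu \<Longrightarrow> g \<in> Cu \<Longrightarrow> (\<lambda>\<gamma>. f \<gamma> + g \<gamma>) \<in> Cu"
  by (auto simp: Cu_def Cc_add) (metis add.right_neutral)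

lemma Cu_smult: "f \<in> Cu \<Longrightarrow> (\<lambda>\<gamma>. c * f \<gamma>) \<in> Cu"
  by (auto simp: Cu_def Cc_smult)

lemma Cu_compose:
  assumes "f \<in> Cu" "continuous_on UNIV q"
  shows "(\<lambda>\<gamma>. if \<gamma> \<in> units G then q (f \<gamma>) else 0) \<in> Cu"
  by (rule CuI) (use continuous_map_compose[OF Cu_continuous[OF assms(1)], of euclidean q] assms(2)
    in \<open>simp add: o_def\<close>)

lemma Cu_mult:
  assumes "f \<in> Cu" "g \<in> Cu" shows "(\<lambda>\<gamma>. f \<gamma> * g \<gamma>) \<in> Cu"
proof -
  have "(\<lambda>\<gamma>. if \<gamma> \<in> units G then f \<gamma> * g \<gamma> else 0) \<in> Cu"
    by (intro CuI continuous_map_mult_euclidean Cu_continuous assms)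
  moreover have "(\<lambda>\<gamma>. if \<gamma> \<in> units G then f \<gamma> * g \<gamma> else 0) = (\<lambda>\<gamma>. f \<gamma> * g \<gamma>)"
    using Cu_outside[OF assms(1)] by auto
  ultimately show ?thesis by simp
qed

lemma convolution_Cu:
  assumes "f \<in> Cu" "g \<in> Cu" shows "convolution G f g = (\<lambda>\<gamma>. f \<gamma> * g \<gamma>)"
proof
  fix \<gamma> show "convolution G f g \<gamma> = f \<gamma> * g \<gamma>"
  proof (cases "\<gamma> \<in> arrows G")
    case True
    then have *: "convolution G f g \<gamma> = f (gran G \<gamma>) * g \<gamma>"
      by (rule convolution_left_units) (use Cu_outside[OF assms(1)] in auto)
    show ?thesis
      using * ran_unit Cu_outside[OF assms(2)] by (cases "\<gamma> \<in> units G") auto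
  qed (simp add: convolution_outside Cc_outside[OF Cu_Cc[OF assms(1)]])
qed

lemma emb_add: "f \<in> Cc G \<Longrightarrow> g \<in> Cc G \<Longrightarrow> emb f \<oplus>\<^bsub>FpA\<^esub> emb g = emb (\<lambda>\<gamma>. f \<gamma> + g \<gamma>)"
  unfolding emb_cls by (intro FpA_add const_cauchy)

lemma emb_smult: "f \<in> Cc G \<Longrightarrow> c \<odot>\<^bsub>FpA\<^esub> emb f = emb (\<lambda>\<gamma>. c * f \<gamma>)"
  unfolding emb_cls by (intro FpA_smult const_cauchy)

lemma emb_mult: "f \<in> Cc G \<Longrightarrow> g \<in> Cc G \<Longrightarrow> emb f \<otimes>\<^bsub>FpA\<^esub> emb g = emb (convolution G f g)"
  unfolding emb_cls by (intro FpA_mult const_cauchy)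

lemma reduced_norm_Cu_le:
  assumes "f \<in> Cu" "\<And>x. x \<in> units G \<Longrightarrow> norm (f x) \<le> C" "0 \<le> C"
  shows "reduced_norm p G f \<le> C"
  using ker_bounded_units[of f C] Cu_outside[OF assms(1)] assms by (intro reduced_norm_le Cu_Cc) auto

text \<open>Compared through J: the partial sums are the pointwise ones, J is contractive, so
  \<open>J\<close> of the exponential is the pointwise limit, and \<open>J_inject\<close> lifts the
  equality back to the completion.\<close>

lemma alg_exp_Cu:
  assumes f: "f \<in> Cu"
  shows "alg_exp FpA (emb f) = emb (\<lambda>\<gamma>. if \<gamma> \<in> units G then exp (f \<gamma>) else 0)"
proof (rule J_inject)
  have fA: "emb f \<in> carrier FpA" by (rule emb_carrier[OF Cu_Cc[OF f]])
  let ?g = "\<lambda>\<gamma>. if \<gamma> \<in> units G then exp (f \<gamma>) else 0"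
  have g: "?g \<in> Cu" by (rule Cu_compose[OF f]) (intro continuous_intros)
  show eA: "alg_exp FpA (emb f) \<in> carrier FpA" by (rule A.alg_exp(1)[OF fA])
  show "emb ?g \<in> carrier FpA" by (rule emb_carrier[OF Cu_Cc[OF g]])
  define s where "s n = (\<lambda>\<gamma>. if \<gamma> \<in> units G then \<Sum>k\<le>n. f \<gamma> ^ k / fact k else 0)" for n
  have pow: "emb f [^]\<^bsub>FpA\<^esub> k = emb (\<lambda>\<gamma>. if \<gamma> \<in> units G then f \<gamma> ^ k else 0) \<and>
      (\<lambda>\<gamma>. if \<gamma> \<in> units G then f \<gamma> ^ k else 0) \<in> Cu" for k :: nat
  proof (induction k)
    case 0
    then show ?case using Cu_one by (simp add: one_FpA nat_pow_def cong: if_cong)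
  next
    case (Suc k)
    let ?h = "\<lambda>\<gamma>. if \<gamma> \<in> units G then f \<gamma> ^ k else 0"
    have "(\<lambda>\<gamma>. ?h \<gamma> * f \<gamma>) = (\<lambda>\<gamma>. if \<gamma> \<in> units G then f \<gamma> ^ Suc k else 0)" by (auto simp: mult.commute)
    then show ?case
      using Suc.IH emb_mult[of ?h f] convolution_Cu[of ?h f] Cu_mult[of ?h f] f by (simp add: nat_pow_def Cu_Cc)
  qed
  have J_sum: "J (A.exp_sum (emb f) n) = s n" for n
  proof (induction n)
    case 0
    then show ?case using fA J_one by (simp add: A.exp_sum_0 s_def cong: if_cong)
  next
    case (Suc n)
    show ?case
    proof
      fix \<gamma>
      have "J ((1 / fact (Suc n)) \<odot>\<^bsub>FpA\<^esub> (emb f [^]\<^bsub>FpA\<^esub> Suc n)) \<gamma> =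
          1 / fact (Suc n) * (if \<gamma> \<in> units G then f \<gamma> ^ Suc n else 0)"
        unfolding J_smult[OF A.power_closed[OF fA]] using pow[of "Suc n"] by (simp add: J_emb Cu_Cc del: power_Suc nat_pow_Suc)
      then show "J (A.exp_sum (emb f) (Suc n)) \<gamma> = s (Suc n) \<gamma>"
        using Suc.IH J_add[OF A.exp_term_closed[OF fA] A.exp_sum_closed[OF fA]]
        by (simp add: A.exp_sum_Suc[OF fA] s_def del: power_Suc nat_pow_Suc fact_Suc)
    qed
  qed
  show "J (alg_exp FpA (emb f)) = J (emb ?g)"
  proof
    fix \<gamma>
    have "(\<lambda>n. s n \<gamma> - J (alg_exp FpA (emb f)) \<gamma>) \<longlonglongrightarrow> 0"
    proof (rule Lim_null_comparison[OF _ A.alg_exp(2)[OF fA]])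
      have "norm (s n \<gamma> - J (alg_exp FpA (emb f)) \<gamma>) \<le> nrm FpA (A.exp_sum (emb f) n \<ominus>\<^bsub>FpA\<^esub> alg_exp FpA (emb f))" for n
      proof -
        have "A.exp_sum (emb f) n \<ominus>\<^bsub>FpA\<^esub> alg_exp FpA (emb f)
            = A.exp_sum (emb f) n \<oplus>\<^bsub>FpA\<^esub> (-1) \<odot>\<^bsub>FpA\<^esub> alg_exp FpA (emb f)"
          using A.smult_minus_one[OF eA] by (simp add: a_minus_def)
        then have "J (A.exp_sum (emb f) n \<ominus>\<^bsub>FpA\<^esub> alg_exp FpA (emb f)) \<gamma> = s n \<gamma> - J (alg_exp FpA (emb f)) \<gamma>"
          using J_add[OF A.exp_sum_closed[OF fA] A.smult_closed[OF eA]] J_smult[OF eA] J_sum by simp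
        then show ?thesis
          using J_norm_le[OF A.minus_closed[OF A.exp_sum_closed[OF fA] eA]] by metis
      qed
      then show "\<forall>\<^sub>F n in sequentially. norm (s n \<gamma> - J (alg_exp FpA (emb f)) \<gamma>)
          \<le> nrm FpA (A.exp_sum (emb f) n \<ominus>\<^bsub>FpA\<^esub> alg_exp FpA (emb f))" by simp
    qed
    then have "(\<lambda>n. s n \<gamma>) \<longlonglongrightarrow> J (alg_exp FpA (emb f)) \<gamma>" using LIM_zero_iff by blast
    moreover have "(\<lambda>n. s n \<gamma>) \<longlonglongrightarrow> ?g \<gamma>"
    proof (cases "\<gamma> \<in> units G")
      case True
      have "(\<lambda>k. f \<gamma> ^ k / fact k) sums exp (f \<gamma>)"
        using exp_converges[of "f \<gamma>"] by (simp add: scaleR_conv_of_real divide_inverse mult.commute)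
      then show ?thesis using True by (simp add: s_def sums_def_le)
    qed (simp add: s_def)
    ultimately show "J (alg_exp FpA (emb f)) \<gamma> = J (emb ?g) \<gamma>"
      using J_emb[OF Cu_Cc[OF g]] LIMSEQ_unique by metis
  qed
qed

text \<open>\<open>exp(itf)\<close> has modulus 1 on the units. Acting diagonally it has norm at
  most 1, and its value at any unit shows that the norm is at least 1; some unit must exist for the
  latter.\<close>

lemma real_Cu_hermitian:
  assumes f: "f \<in> Cu" "\<And>x. x \<in> units G \<Longrightarrow> f x \<in> \<real>" and ne: "units G \<noteq> {}"
  shows "emb f \<in> hermitians FpA"
  unfolding hermitians_def
proof (intro CollectI conjI allI emb_carrier Cu_Cc f)
  fix t :: real
  let ?f = "\<lambda>\<gamma>. (\<i> * of_real t) * f \<gamma>"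
  let ?g = "\<lambda>\<gamma>. if \<gamma> \<in> units G then exp (?f \<gamma>) else 0"
  have tf: "?f \<in> Cu" by (rule Cu_smult[OF f(1)])
  have g: "?g \<in> Cu" by (rule Cu_compose[OF tf]) (intro continuous_intros)
  have ng: "norm (?g x) = 1" if "x \<in> units G" for x
    using f(2)[OF that] that by (auto elim!: Reals_cases simp: norm_exp_eq_Re)
  obtain x where x: "x \<in> units G" using ne by blast
  have "reduced_norm p G ?g = 1"
  proof (rule antisym)
    show "reduced_norm p G ?g \<le> 1" by (rule reduced_norm_Cu_le[OF g]) (use ng in \<open>auto simp del: norm_exp_eq_Re\<close>)
    show "1 \<le> reduced_norm p G ?g" using norm_le_reduced_norm[OF Cu_Cc[OF g], of x] ng[OF x] by simp
  qed
  then show "nrm FpA (alg_exp FpA ((\<i> * of_real t) \<odot>\<^bsub>FpA\<^esub> emb f)) = 1"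
    using alg_exp_Cu[OF tf] nrm_emb[OF Cu_Cc[OF g]] by (simp add: emb_smult[OF Cu_Cc[OF f(1)]])
qed

end

locale reduced_groupoid_algebra_ne_2 = reduced_groupoid_algebra G p for G :: "'g topgroupoid" and p +
  assumes p_ne_2: "p \<noteq> 2"
begin

text \<open>The isometries \<open>exp(ita)\<close> cannot increase the norm of a vector supported on a finite set \<open>I\<close>, not
  even after cutting down to \<open>I\<close>; hence the derivative of this cut-down norm vanishes at \<open>t = 0\<close>.\<close>

lemma hermitian_numerical_range:
  assumes a: "a \<in> hermitians FpA" and x: "x \<in> units G"
    and I: "finite I" "I \<subseteq> dom_fibre G x" and \<xi>: "\<And>\<gamma>. \<gamma> \<in> I \<Longrightarrow> \<xi> \<gamma> \<noteq> 0"
  shows "(\<Sum>\<gamma>\<in>I. norm (\<xi> \<gamma>) powr (p - 2) * Im (cnj (\<xi> \<gamma>) * (\<Sum>\<sigma>\<in>I. J a (quot \<gamma> \<sigma>) * \<xi> \<sigma>))) = 0"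
proof -
  have aA: "a \<in> carrier FpA" using a by (simp add: hermitians_def)
  define e where "e t = alg_exp FpA ((\<i> * complex_of_real t) \<odot>\<^bsub>FpA\<^esub> a)" for t
  have eA: "e t \<in> carrier FpA" and e1: "nrm FpA (e t) = 1" for t
    using a A.alg_exp(1)[OF A.smult_closed[OF aA]] by (auto simp: e_def hermitians_def)
  have entry: "((\<lambda>t. J (e t) \<gamma>) has_vector_derivative (\<i> * J a \<gamma>)) (at 0)" "J (e 0) \<gamma> = J \<one>\<^bsub>FpA\<^esub> \<gamma>" for \<gamma>
  proof -
    have "norm (J (e t) \<gamma> - J \<one>\<^bsub>FpA\<^esub> \<gamma> - of_real t * (\<i> * J a \<gamma>))
        \<le> nrm FpA \<one>\<^bsub>FpA\<^esub> * (exp (\<bar>t\<bar> * nrm FpA a) - 1 - \<bar>t\<bar> * nrm FpA a)" for t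
      using A.functional_exp_second_order[OF A.smult_closed[OF aA], of "\<lambda>P. J P \<gamma>" "\<i> * complex_of_real t"]
        J_add J_smult J_norm_le aA A.nrm_smult[OF aA]
      by (simp add: e_def norm_mult mult_ac)
    then show "((\<lambda>t. J (e t) \<gamma>) has_vector_derivative (\<i> * J a \<gamma>)) (at 0)" "J (e 0) \<gamma> = J \<one>\<^bsub>FpA\<^esub> \<gamma>"
      using has_vector_derivative_second_order[where u = "\<lambda>t. J (e t) \<gamma>" and m = "nrm FpA a" and K = "nrm FpA \<one>\<^bsub>FpA\<^esub>"]
        A.nrm_nonneg[OF aA] A.nrm_nonneg[OF A.one_closed] by blast+
  qed
  define u where "u \<gamma> t = (\<Sum>\<sigma>\<in>I. J (e t) (quot \<gamma> \<sigma>) * \<xi> \<sigma>)" for \<gamma> t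
  define u' where "u' \<gamma> = (\<Sum>\<sigma>\<in>I. \<i> * J a (quot \<gamma> \<sigma>) * \<xi> \<sigma>)" for \<gamma>
  have du: "(u \<gamma> has_vector_derivative u' \<gamma>) (at 0)" for \<gamma>
    unfolding u_def u'_def by (intro derivative_intros entry)
  have u0: "u \<gamma> 0 = \<xi> \<gamma>" if "\<gamma> \<in> I" for \<gamma>
  proof -
    have "u \<gamma> 0 = (\<Sum>\<sigma>\<in>I. if \<gamma> = \<sigma> then \<xi> \<sigma> else 0)"
      unfolding u_def entry(2) J_one using quot_units_iff I(2) that
      by (intro sum.cong refl) (auto simp: subset_eq)
    then show ?thesis using I(1) that by simp
  qed
  have "(\<Sum>\<gamma>\<in>I. norm (u \<gamma> 0) powr (p - 2) * Re (cnj (u \<gamma> 0) * u' \<gamma>)) = 0"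
  proof (rule sum_norm_powr_max_derivative[OF I(1)])
    fix t
    \<comment> \<open>\<open>u \<gamma> t\<close> is the entry at \<gamma> of the image of \<xi>
      under the I by I section of \<open>e t\<close>, whose bound is 1; at t = 0 the section is the
      identity, so \<open>u \<gamma> 0\<close> is \<xi> \<gamma>.\<close>
    have "matrix_bounded p (dom_fibre G x) (\<lambda>\<gamma> \<sigma>. J (e t) (quot \<gamma> \<sigma>)) 1"
      using J_ker_bounded[OF eA[of t]] x by (simp add: ker_bounded_def e1)
    from matrix_boundedD[OF this I(1) I(1) I(2) I(2), of \<xi>]
    show "(\<Sum>\<gamma>\<in>I. norm (u \<gamma> t) powr p) \<le> (\<Sum>\<gamma>\<in>I. norm (u \<gamma> 0) powr p)"
      using u0 by (simp add: u_def[of _ t])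
  qed (use p du u0 \<xi> in auto)
  \<comment> \<open>The factor \<i> from differentiating \<open>exp(ita)\<close> turns the real part
    into minus the imaginary part.\<close>
  moreover have "Re (cnj (\<xi> \<gamma>) * u' \<gamma>) = - Im (cnj (\<xi> \<gamma>) * (\<Sum>\<sigma>\<in>I. J a (quot \<gamma> \<sigma>) * \<xi> \<sigma>))" for \<gamma>
  proof -
    have "u' \<gamma> = \<i> * (\<Sum>\<sigma>\<in>I. J a (quot \<gamma> \<sigma>) * \<xi> \<sigma>)"
      by (simp add: u'_def sum_distrib_left mult.assoc)
    then show ?thesis by simp
  qed
  then have "(\<Sum>\<gamma>\<in>I. norm (\<xi> \<gamma>) powr (p - 2) * Im (cnj (\<xi> \<gamma>) * (\<Sum>\<sigma>\<in>I. J a (quot \<gamma> \<sigma>) * \<xi> \<sigma>)))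
      = (\<Sum>\<gamma>\<in>I. - (norm (u \<gamma> 0) powr (p - 2) * Re (cnj (u \<gamma> 0) * u' \<gamma>)))"
    by (intro sum.cong refl) (simp only: u0 mult_minus_right minus_minus)
  ultimately show ?thesis by (simp only: sum_negf neg_equal_0_iff_equal)
qed

text \<open>The one-point case of \<open>hermitian_numerical_range\<close>: on {x} the section of
  the matrix is the single entry \<open>J a x\<close>.\<close>

lemma hermitian_real_on_units:
  assumes a: "a \<in> hermitians FpA" and x: "x \<in> units G" shows "Im (J a x) = 0"
  using hermitian_numerical_range[OF a x, of "{x}" "\<lambda>_. 1"] dom_fibre_unit[OF x] quot_self[OF units_arrows[OF x]]
  by (simp add: ran_unit[OF x])

text \<open>On the two points \<gamma> and x = \<open>gdom G \<gamma>\<close> the section of a has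
  the diagonal entries \<open>J a (gran G \<gamma>)\<close> and \<open>J a x\<close>, which are
  real, and the off-diagonal entries \<open>J a \<gamma>\<close> and
  \<open>J a (ginv G \<gamma>)\<close>. The value at \<gamma> is thus the entry \<beta> of
  \<open>numerical_range_real_imp_diagonal\<close>.\<close>

lemma hermitian_off_units:
  assumes a: "a \<in> hermitians FpA" and \<gamma>: "\<gamma> \<in> arrows G" "\<gamma> \<notin> units G" shows "J a \<gamma> = 0"
proof -
  define x where "x = gdom G \<gamma>"
  have x: "x \<in> units G" using \<gamma> dom_units by (simp add: x_def)
  have f: "\<gamma> \<in> dom_fibre G x" "x \<in> dom_fibre G x" using \<gamma> dom_fibre_unit[OF x] by (auto simp: dom_fibre_iff x_def)
  have ne: "\<gamma> \<noteq> x" using \<gamma> x by blast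
  show ?thesis
  proof (rule numerical_range_real_imp_diagonal[OF p_ne_2, of "J a (gran G \<gamma>)" "J a x" _ "J a (ginv G \<gamma>)"])
    show "Im (J a (gran G \<gamma>)) = 0" "Im (J a x) = 0"
      using hermitian_real_on_units[OF a] ran_units[OF \<gamma>(1)] x by auto
    fix \<alpha> \<beta> :: complex assume "\<alpha> \<noteq> 0" "\<beta> \<noteq> 0"
    then show "norm \<alpha> powr (p - 2) * Im (cnj \<alpha> * (J a (gran G \<gamma>) * \<alpha> + J a \<gamma> * \<beta>)) +
      norm \<beta> powr (p - 2) * Im (cnj \<beta> * (J a (ginv G \<gamma>) * \<alpha> + J a x * \<beta>)) = 0"
      using hermitian_numerical_range[OF a x, of "{\<gamma>, x}" "\<lambda>\<sigma>. if \<sigma> = \<gamma> then \<alpha> else \<beta>"] f ne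
        quot_self[OF \<gamma>(1)] quot_self[OF units_arrows[OF x]] quot_unit[OF x f(1)] unit_quot[OF x f(1)] ran_unit[OF x]
      by (auto split: if_splits)
  qed
qed

text \<open>\<open>J a\<close> is continuous and lives on the compact unit space, so it belongs to
  \<open>Cc G\<close> even though a is only a limit of such functions.\<close>

lemma hermitian_Cu:
  assumes a: "a \<in> hermitians FpA" shows "J a \<in> Cu" "a = emb (J a)"
proof -
  have aA: "a \<in> carrier FpA" using a by (simp add: hermitians_def)
  have z: "J a \<gamma> = 0" if "\<gamma> \<notin> units G" for \<gamma>
    using that hermitian_off_units[OF a] J_outside[OF aA] by blast
  have "J a \<in> Cc G"
    by (rule CcI[OF J_continuous[OF aA] _ compact_units]) (use z units_arrows in auto)
  then show "J a \<in> Cu" using z by (auto simp: Cu_def)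
  then show "a = emb (J a)"
    using J_inject[OF aA emb_carrier] J_emb by (simp add: Cu_Cc)
qed

lemma core_eq:
  assumes ne: "units G \<noteq> {}" shows "core FpA = emb ` Cu"
proof
  show "core FpA \<subseteq> emb ` Cu"
  proof
    fix a assume "a \<in> core FpA"
    then obtain b c where bc: "b \<in> hermitians FpA" "c \<in> hermitians FpA" "a = b \<oplus>\<^bsub>FpA\<^esub> (\<i> \<odot>\<^bsub>FpA\<^esub> c)"
      by (auto simp: core_def)
    note b = hermitian_Cu[OF bc(1)] and c = hermitian_Cu[OF bc(2)]
    have "a = emb (J b) \<oplus>\<^bsub>FpA\<^esub> (\<i> \<odot>\<^bsub>FpA\<^esub> emb (J c))" using bc(3) b(2) c(2) by metis
    also have "\<dots> = emb (\<lambda>\<gamma>. J b \<gamma> + \<i> * J c \<gamma>)"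
      using b(1) c(1) by (simp add: emb_smult emb_add Cu_Cc Cc_smult)
    finally show "a \<in> emb ` Cu" using Cu_add[OF b(1) Cu_smult[OF c(1)]] by blast
  qed
next
  show "emb ` Cu \<subseteq> core FpA"
  proof
    fix a assume "a \<in> emb ` Cu"
    then obtain f where f: "f \<in> Cu" "a = emb f" by blast
    define g where "g = (\<lambda>\<gamma>. if \<gamma> \<in> units G then complex_of_real (Re (f \<gamma>)) else 0)"
    define h where "h = (\<lambda>\<gamma>. if \<gamma> \<in> units G then complex_of_real (Im (f \<gamma>)) else 0)"
    have gh: "g \<in> Cu" "h \<in> Cu"
      unfolding g_def h_def by (rule Cu_compose[OF f(1)], intro continuous_intros)+
    have "f = (\<lambda>\<gamma>. g \<gamma> + \<i> * h \<gamma>)"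
      using Cu_outside[OF f(1)] by (auto simp: g_def h_def complex_eq)
    then have "a = emb g \<oplus>\<^bsub>FpA\<^esub> (\<i> \<odot>\<^bsub>FpA\<^esub> emb h)"
      using f(2) gh by (simp add: emb_smult emb_add Cu_Cc Cc_smult)
    moreover have "emb g \<in> hermitians FpA" "emb h \<in> hermitians FpA"
      by (rule real_Cu_hermitian[OF _ _ ne], use gh in \<open>auto simp: g_def h_def\<close>)+
    ultimately show "a \<in> core FpA" by (auto simp: core_def)
  qed
qed

text \<open>In the zero algebra no exponential has norm 1, so there are no hermitian elements.
  Consequently the existence of a character forces the unit space to be nonempty.\<close>

lemma core_empty:
  assumes e: "units G = {}" shows "core FpA = {}"
proof -
  have arr: "arrows G = {}" using e by (auto simp: units_def)
  have "nrm FpA P = 0" if P: "P \<in> carrier FpA" for P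
  proof -
    obtain X where X: "X \<in> cauchy_seqs CcA" "P = N.cls X" using P by (auto simp: carrier_FpA)
    have "nrm CcA (X n) = 0" for n by (simp add: CcA_simps reduced_norm_def e)
    then show ?thesis using N.cls_nrm[OF X(1)] X(2) LIMSEQ_unique[OF _ tendsto_const[of 0]]
      by (simp add: Fp_lambda_def)
  qed
  then have "hermitians FpA = {}"
    using A.alg_exp(1)[OF A.smult_closed] by (fastforce simp: hermitians_def)
  then show ?thesis by (simp add: core_def)
qed

section \<open>The spectrum of the core\<close>

definition ev :: "'g \<Rightarrow> (nat \<Rightarrow> 'g \<Rightarrow> complex) set \<Rightarrow> complex" where
  "ev x = restrict (\<lambda>P. J P x) (core FpA)"

lemma emb_core: "units G \<noteq> {} \<Longrightarrow> f \<in> Cu \<Longrightarrow> emb f \<in> core FpA"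
  by (simp add: core_eq)

lemma ev_emb: "x \<in> units G \<Longrightarrow> f \<in> Cu \<Longrightarrow> ev x (emb f) = f x"
  using emb_core[of f] by (auto simp: ev_def J_emb Cu_Cc)

text \<open>Urysohn's lemma on the unit space, which is compact Hausdorff and hence normal, followed
  by extension by zero.\<close>

lemma separate_point_closed:
  assumes "x \<in> units G" "closedin (unit_space G) S" "x \<notin> S"
  obtains f where "f \<in> Cu" "f x = 1" "\<And>y. y \<in> S \<Longrightarrow> f y = 0"
    "\<And>y. norm (f y) \<le> 1" "\<And>y. f y \<in> \<real>\<^sub>\<ge>\<^sub>0"
proof -
  have "normal_space (unit_space G)"
    using compact_Hausdorff_or_regular_imp_normal_space compact Hausdorff_unit_space by blast
  moreover have "closedin (unit_space G) {x}"
    using closedin_Hausdorff_singleton[OF Hausdorff_unit_space] assms(1) by (simp add: topspace_unit_space)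
  ultimately obtain f where f: "continuous_map (unit_space G) (top_of_set {0..1}) f" "f ` S \<subseteq> {0}" "f ` {x} \<subseteq> {1::real}"
    using Urysohn_lemma[of "unit_space G" S "{x}" 0 1] assms(2,3) by (auto simp: disjnt_def)
  have r: "f y \<in> {0..1}" if "y \<in> units G" for y
    using continuous_map_funspace[OF f(1)] that by (auto simp: topspace_unit_space)
  let ?f = "\<lambda>\<gamma>. if \<gamma> \<in> units G then complex_of_real (f \<gamma>) else 0"
  have "continuous_map (unit_space G) euclidean f" using f(1) continuous_map_into_fulltopology by blast
  from continuous_map_compose[OF this, of euclidean complex_of_real]
  have "continuous_map (unit_space G) euclidean (\<lambda>\<gamma>. complex_of_real (f \<gamma>))"
    by (simp add: o_def continuous_on_of_real)
  then have "?f \<in> Cu" by (rule CuI)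
  moreover have "?f x = 1" using assms(1) f(3) by simp
  moreover have "?f y = 0" if "y \<in> S" for y using that f(2) by auto
  moreover have "norm (?f y) \<le> 1" "?f y \<in> \<real>\<^sub>\<ge>\<^sub>0" for y using r[of y] by (auto simp: complex_nonneg_Reals_iff)
  ultimately show thesis by (rule that)
qed

lemma ev_characters:
  assumes x: "x \<in> units G" shows "ev x \<in> characters FpA"
proof -
  have ne: "units G \<noteq> {}" using x by blast
  show ?thesis unfolding characters_def
  proof (intro CollectI conjI ballI allI)
    show "ev x \<in> extensional (core FpA)" by (simp add: ev_def)
    fix a assume "a \<in> core FpA"
    then obtain f where f: "f \<in> Cu" "a = emb f" by (auto simp: core_eq[OF ne])
    show "ev x (c \<odot>\<^bsub>FpA\<^esub> a) = c * ev x a" for c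
      using f x by (simp add: emb_smult ev_emb Cu_smult Cu_Cc)
    fix b assume "b \<in> core FpA"
    then obtain g where g: "g \<in> Cu" "b = emb g" by (auto simp: core_eq[OF ne])
    show "ev x (a \<oplus>\<^bsub>FpA\<^esub> b) = ev x a + ev x b" "ev x (a \<otimes>\<^bsub>FpA\<^esub> b) = ev x a * ev x b"
      using f g x by (simp_all add: emb_add emb_mult ev_emb Cu_add Cu_mult Cu_Cc convolution_Cu)
  next
    show "\<exists>a\<in>core FpA. ev x a \<noteq> 0"
      by (rule bexI[OF _ emb_core[OF ne Cu_one]]) (simp add: ev_emb[OF x Cu_one] x)
  qed
qed

text \<open>The classical argument for C(X) with X compact: if \<phi> is no evaluation, then every
  unit x has a function in the kernel of \<phi> that is nonzero near x. By compactness a finite sum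
  of squared moduli of such functions has no zero, so it is invertible; yet it lies in the kernel,
  contradicting \<phi> 1 = 1.\<close>

lemma characters_ev:
  assumes \<phi>: "\<phi> \<in> characters FpA" shows "\<phi> \<in> ev ` units G"
proof (rule ccontr)
  assume contr: "\<phi> \<notin> ev ` units G"
  have ne: "units G \<noteq> {}" using \<phi> core_empty by (auto simp: characters_def)
  define \<psi> where "\<psi> f = \<phi> (emb f)" for f
  have ext: "\<phi> \<in> extensional (core FpA)" using \<phi> by (simp add: characters_def)
  have \<psi>_add: "\<psi> (\<lambda>\<gamma>. f \<gamma> + g \<gamma>) = \<psi> f + \<psi> g" and \<psi>_mult: "\<psi> (\<lambda>\<gamma>. f \<gamma> * g \<gamma>) = \<psi> f * \<psi> g"
    and \<psi>_smult: "\<psi> (\<lambda>\<gamma>. c * f \<gamma>) = c * \<psi> f" if "f \<in> Cu" "g \<in> Cu" for f g c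
  proof -
    have "emb f \<in> core FpA" "emb g \<in> core FpA" using that emb_core[OF ne] by auto
    then have "\<phi> (emb f \<oplus>\<^bsub>FpA\<^esub> emb g) = \<psi> f + \<psi> g" "\<phi> (emb f \<otimes>\<^bsub>FpA\<^esub> emb g) = \<psi> f * \<psi> g"
      "\<phi> (c \<odot>\<^bsub>FpA\<^esub> emb f) = c * \<psi> f"
      using \<phi> by (auto simp: characters_def \<psi>_def)
    then show "\<psi> (\<lambda>\<gamma>. f \<gamma> + g \<gamma>) = \<psi> f + \<psi> g" "\<psi> (\<lambda>\<gamma>. f \<gamma> * g \<gamma>) = \<psi> f * \<psi> g"
      "\<psi> (\<lambda>\<gamma>. c * f \<gamma>) = c * \<psi> f"
      using that by (simp_all add: \<psi>_def emb_add emb_mult emb_smult Cu_Cc convolution_Cu)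
  qed
  let ?u = "\<lambda>\<gamma>. if \<gamma> \<in> units G then 1 else 0 :: complex"
  have \<psi>1: "\<psi> ?u = 1"
  proof -
    obtain a where "a \<in> core FpA" "\<phi> a \<noteq> 0" using \<phi> by (auto simp: characters_def)
    then obtain f where f: "f \<in> Cu" "\<psi> f \<noteq> 0" by (auto simp: core_eq[OF ne] \<psi>_def)
    have "(\<lambda>\<gamma>. ?u \<gamma> * f \<gamma>) = f" using Cu_outside[OF f(1)] by auto
    then show ?thesis using \<psi>_mult[OF Cu_one f(1)] f(2) by simp
  qed
  have "\<exists>f. f \<in> Cu \<and> \<psi> f = 0 \<and> f x \<noteq> 0" if x: "x \<in> units G" for x
  proof -
    have "\<exists>a\<in>core FpA. \<phi> a \<noteq> ev x a"
    proof (rule ccontr)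
      assume "\<not> ?thesis"
      then have "\<phi> = ev x" using ext by (intro extensionalityI[of _ "core FpA"]) (auto simp: ev_def)
      then show False using contr x by blast
    qed
    then obtain f where f: "f \<in> Cu" "\<psi> f \<noteq> f x"
      using ev_emb[OF x] by (auto simp: core_eq[OF ne] \<psi>_def)
    \<comment> \<open>Subtracting the constant \<psi> f moves f into the kernel, while the value at
      x stays nonzero because \<psi> f differs from f x.\<close>
    define g where "g = (\<lambda>\<gamma>. f \<gamma> + (- \<psi> f) * ?u \<gamma>)"
    have "g \<in> Cu" unfolding g_def by (rule Cu_add[OF f(1) Cu_smult[OF Cu_one]])
    moreover have "\<psi> g = 0"
      unfolding g_def \<psi>_add[OF f(1) Cu_smult[OF Cu_one]] \<psi>_smult[OF Cu_one Cu_one] \<psi>1 by simp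
    moreover have "g x \<noteq> 0" using f(2) x by (simp add: g_def)
    ultimately show ?thesis by blast
  qed
  then obtain f where f: "\<And>x. x \<in> units G \<Longrightarrow> f x \<in> Cu \<and> \<psi> (f x) = 0 \<and> f x x \<noteq> 0" by metis
  define U where "U x = {y \<in> units G. f x y \<noteq> 0}" for x
  have U: "openin (unit_space G) (U x)" if "x \<in> units G" for x
    using openin_continuous_map_preimage[OF Cu_continuous, of "f x" "- {0}"] f[OF that]
    by (simp add: U_def topspace_unit_space open_Compl)
  have "compactin (unit_space G) (units G)"
    using compact by (simp add: compact_space_def topspace_unit_space)
  moreover have "\<forall>V\<in>U ` units G. openin (unit_space G) V" "units G \<subseteq> \<Union>(U ` units G)"
    using U f by (auto simp: U_def)
  ultimately obtain \<F> where "finite \<F>" "\<F> \<subseteq> U ` units G" "units G \<subseteq> \<Union>\<F>" unfolding compactin_def by meson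
  then obtain F where F: "finite F" "F \<subseteq> units G" "units G \<subseteq> (\<Union>x\<in>F. U x)"
    by (metis finite_subset_image)
  \<comment> \<open>Multiplying by the conjugate keeps f x in the kernel and turns it into a squared
    modulus, so the finite sum cannot cancel.\<close>
  define c where "c x = (\<lambda>\<gamma>. if \<gamma> \<in> units G then cnj (f x \<gamma>) else 0)" for x
  have c: "c x \<in> Cu" if "x \<in> F" for x
    unfolding c_def by (rule Cu_compose) (use f that F(2) in \<open>auto intro: continuous_intros\<close>)
  have sum: "(\<lambda>\<gamma>. \<Sum>x\<in>S. c x \<gamma> * f x \<gamma>) \<in> Cu \<and> \<psi> (\<lambda>\<gamma>. \<Sum>x\<in>S. c x \<gamma> * f x \<gamma>) = 0" if "S \<subseteq> F" for S
    using finite_subset[OF that F(1)] that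
  proof (induction S rule: finite_induct)
    case empty
    have "(\<lambda>_. 0) \<in> Cu" by (auto simp: Cu_def Cc_zero)
    moreover from this have "\<psi> (\<lambda>_. 0) = 0" using \<psi>_smult[of "\<lambda>_. 0" "\<lambda>_. 0" 0] by simp
    ultimately show ?case by simp
  next
    case (insert x S)
    then have x: "c x \<in> Cu" "f x \<in> Cu" "\<psi> (f x) = 0" using c f F(2) by auto
    show ?case using insert Cu_add[OF Cu_mult[OF x(1,2)]] \<psi>_add[OF Cu_mult[OF x(1,2)]] \<psi>_mult[OF x(1,2)] x(3) by simp
  qed
  define g where "g = (\<lambda>\<gamma>. \<Sum>x\<in>F. c x \<gamma> * f x \<gamma>)"
  have g: "g \<in> Cu" "\<psi> g = 0" using sum[OF subset_refl] by (simp_all add: g_def)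
  have g_nz: "g y \<noteq> 0" if y: "y \<in> units G" for y
  proof -
    have "g y = (\<Sum>x\<in>F. complex_of_real ((norm (f x y))\<^sup>2))"
      unfolding g_def c_def using y by (intro sum.cong refl) (subst complex_norm_square, simp add: mult.commute)
    then have "g y = complex_of_real (\<Sum>x\<in>F. (norm (f x y))\<^sup>2)" by simp
    moreover obtain x where "x \<in> F" "f x y \<noteq> 0" using F(3) y by (auto simp: U_def)
    then have "(\<Sum>x\<in>F. (norm (f x y))\<^sup>2) > 0" using F(1) by (intro sum_pos2[of F x]) auto
    ultimately show ?thesis by (metis less_numeral_extra(3) of_real_eq_0_iff)
  qed
  define k where "k = (\<lambda>\<gamma>. if \<gamma> \<in> units G then inverse (g \<gamma>) else 0)"
  have "k \<in> Cu" unfolding k_def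
    by (rule CuI) (use Cu_continuous[OF g(1)] g_nz in \<open>auto simp: continuous_map_atin topspace_unit_space intro: tendsto_inverse\<close>)
  moreover have "(\<lambda>\<gamma>. g \<gamma> * k \<gamma>) = ?u" using g_nz by (auto simp: k_def)
  ultimately have "\<psi> ?u = 0" using \<psi>_mult[OF g(1), of k] g(2) by simp
  then show False using \<psi>1 by simp
qed

lemma characters_eq: "characters FpA = ev ` units G"
  using ev_characters characters_ev by blast

lemma topspace_core_spectrum: "topspace (core_spectrum FpA) = characters FpA"
  by (auto simp: core_spectrum_def characters_def extensional_def)

lemma ev_inj: "inj_on ev (units G)"
proof (rule inj_onI, rule ccontr)
  fix x y assume xy: "x \<in> units G" "y \<in> units G" "ev x = ev y" "x \<noteq> y"
  have "closedin (unit_space G) {y}"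
    using closedin_Hausdorff_singleton[OF Hausdorff_unit_space] xy by (simp add: topspace_unit_space)
  moreover have "x \<notin> {y}" using xy by simp
  ultimately obtain f where f: "f \<in> Cu" "f x = 1" "\<And>z. z \<in> {y} \<Longrightarrow> f z = 0"
    by (rule separate_point_closed[OF xy(1)]) blast
  then show False using ev_emb[OF xy(1) f(1)] ev_emb[OF xy(2) f(1)] xy(3) by simp
qed

text \<open>A continuous bijection from a compact space onto a Hausdorff space is a
  homeomorphism.\<close>

lemma ev_homeomorphic: "homeomorphic_map (unit_space G) (core_spectrum FpA) ev"
proof (rule continuous_imp_homeomorphic_map)
  show "compact_space (unit_space G)" by (rule compact)
  show "Hausdorff_space (core_spectrum FpA)"
    unfolding core_spectrum_def by (intro Hausdorff_space_subtopology) (simp add: Hausdorff_space_product_topology)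
  show "inj_on ev (topspace (unit_space G))" using ev_inj by (simp add: topspace_unit_space)
  show "ev ` topspace (unit_space G) = topspace (core_spectrum FpA)"
    by (simp add: topspace_unit_space topspace_core_spectrum characters_eq)
  show "continuous_map (unit_space G) (core_spectrum FpA) ev"
    unfolding core_spectrum_def
  proof (rule continuous_map_into_subtopology)
    show "continuous_map (unit_space G) (product_topology (\<lambda>a. euclidean) (core FpA)) ev"
      unfolding continuous_map_componentwise
    proof (intro conjI ballI)
      show "ev ` topspace (unit_space G) \<subseteq> extensional (core FpA)" by (auto simp: ev_def)
      fix a assume a: "a \<in> core FpA"
      then have "a \<in> carrier FpA"
        by (auto simp: core_def hermitians_def intro: A.smult_closed)
      then have "continuous_map (unit_space G) euclidean (J a)"
        unfolding unit_space_def by (intro continuous_map_from_subtopology J_continuous)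
      then show "continuous_map (unit_space G) euclidean (\<lambda>x. ev x a)" using a by (simp add: ev_def)
    qed
    show "ev \<in> topspace (unit_space G) \<rightarrow> characters FpA"
      using ev_characters by (auto simp: topspace_unit_space)
  qed
qed

lemma ev_identification: "unit_space_identification p G ev"
  unfolding unit_space_identification_def
  using ev_homeomorphic ev_emb by (auto simp: Cu_def)

end

section \<open>Realizable partial homeomorphisms\<close>

lemma infsum_small_tail:
  fixes m :: "'a \<Rightarrow> complex"
  assumes "(\<lambda>i. norm (m i)) summable_on I" "e > 0"
  obtains F where "finite F" "F \<subseteq> I" "(\<Sum>\<^sub>\<infinity>i\<in>I - F. norm (m i)) \<le> e"
proof -
  obtain F where F: "finite F" "F \<subseteq> I" "dist (\<Sum>i\<in>F. norm (m i)) (\<Sum>\<^sub>\<infinity>i\<in>I. norm (m i)) \<le> e"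
    using infsum_finite_approximation[OF assms] by blast
  have "(\<Sum>\<^sub>\<infinity>i\<in>I - F. norm (m i)) = (\<Sum>\<^sub>\<infinity>i\<in>I. norm (m i)) - (\<Sum>i\<in>F. norm (m i))"
    using assms(1) F(1,2) by (subst infsum_Diff) (auto intro: summable_on_finite)
  then show thesis using that[OF F(1,2)] F(3) by (simp add: dist_real_def)
qed

text \<open>Since W is open, the part of D inside W is dense in W; two continuous maps into a
  Hausdorff space that agree on a dense set agree.\<close>

lemma continuous_maps_agree_dense:
  assumes "Hausdorff_space Z" "openin Y W" "Y closure_of D = topspace Y"
    and "continuous_map (subtopology Y W) Z f" "continuous_map (subtopology Y W) Z g"
    and "\<And>w. w \<in> W \<Longrightarrow> w \<in> D \<Longrightarrow> f w = g w" and "w \<in> W"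
  shows "f w = g w"
proof (rule forall_in_closure_of_eq[OF _ assms(1,4,5)])
  have "subtopology Y W closure_of (W \<inter> D) = W \<inter> Y closure_of (W \<inter> D)"
    by (rule closure_of_subtopology_open) simp
  also have "\<dots> = W \<inter> Y closure_of D" using openin_Int_closure_of_eq[OF assms(2)] by simp
  finally show "w \<in> subtopology Y W closure_of (W \<inter> D)"
    using assms(3,7) openin_subset[OF assms(2)] by auto
qed (use assms(6) in auto)

section \<open>Fibre sums as complex measures on the unit space\<close>

context reduced_groupoid_algebra
begin

lemma dense_Cc:
  assumes "P \<in> carrier FpA" "e > 0"
  obtains f where "f \<in> Cc G" "A.gap P (emb f) < e"
  using N.completion_dense[of P e] assms that
  by (auto simp: Fp_lambda_def emb_cls A.gap_def[unfolded Fp_lambda_def] CcA_simps)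

lemma J_minus:
  assumes "P \<in> carrier FpA" "Q \<in> carrier FpA" shows "J (P \<ominus>\<^bsub>FpA\<^esub> Q) \<gamma> = J P \<gamma> - J Q \<gamma>"
  using J_add[OF assms(1) A.a_inv_closed[OF assms(2)]] J_smult[OF assms(2), of "-1"] A.smult_minus_one[OF assms(2)]
  by (simp add: a_minus_def)

text \<open>\<open>quot x \<sigma>\<close> is \<open>ginv G \<sigma>\<close> and
  \<open>quot \<sigma> x\<close> is \<sigma>, so the sum pairs the row at x of P with the column at
  x of Q, and \<open>matrix_bounded_row_column\<close> applies.\<close>

lemma fibre_sum_bound:
  assumes "P \<in> carrier FpA" "Q \<in> carrier FpA" "x \<in> units G" "finite F" "F \<subseteq> dom_fibre G x"
  shows "(\<Sum>\<sigma>\<in>F. norm (J P (ginv G \<sigma>) * J Q \<sigma>)) \<le> nrm FpA P * nrm FpA Q"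
proof -
  have "(\<Sum>\<sigma>\<in>F. norm (J P (ginv G \<sigma>) * J Q \<sigma>)) = (\<Sum>\<sigma>\<in>F. norm (J P (quot x \<sigma>)) * norm (J Q (quot \<sigma> x)))"
    using assms(5) unit_quot[OF assms(3)] quot_unit[OF assms(3)] by (intro sum.cong) (auto simp: norm_mult)
  also have "\<dots> \<le> nrm FpA P * nrm FpA Q"
    using J_ker_bounded[OF assms(1)] J_ker_bounded[OF assms(2)] assms(3-5) dom_fibre_unit
    by (intro matrix_bounded_row_column[OF p, where I = "dom_fibre G x" and M = "\<lambda>\<gamma> \<sigma>. J P (quot \<gamma> \<sigma>)"
          and M' = "\<lambda>\<gamma> \<sigma>. J Q (quot \<gamma> \<sigma>)"]) (auto simp: ker_bounded_def)
  finally show ?thesis .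
qed

lemma fibre_abs_summable:
  assumes "P \<in> carrier FpA" "Q \<in> carrier FpA" "x \<in> units G"
  shows "(\<lambda>\<sigma>. norm (J P (ginv G \<sigma>) * J Q \<sigma>)) summable_on dom_fibre G x"
  by (rule nonneg_bounded_partial_sums_imp_summable_on[of _ _ "nrm FpA P * nrm FpA Q"])
    (auto intro!: eventually_finite_subsets_at_top_weakI fibre_sum_bound[OF assms])

text \<open>The integral of f against the measure that puts mass
  \<open>J P (ginv G \<sigma>) * J Q \<sigma>\<close> at the range of \<sigma>. For P, Q in the
  completion it replaces the finite convolution sum for the value of P f Q at x.\<close>

definition pairing where
  "pairing f x P Q = (\<Sum>\<^sub>\<infinity>\<sigma>\<in>dom_fibre G x. J P (ginv G \<sigma>) * J Q \<sigma> * f (gran G \<sigma>))"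

context
  fixes f :: "'g \<Rightarrow> complex" and C x
  assumes C: "\<And>y. norm (f y) \<le> C" and x: "x \<in> units G"
begin

lemma pairing_abs_summable:
  assumes "P \<in> carrier FpA" "Q \<in> carrier FpA"
  shows "(\<lambda>\<sigma>. norm (J P (ginv G \<sigma>) * J Q \<sigma> * f (gran G \<sigma>))) summable_on dom_fibre G x"
proof (rule Infinite_Sum.abs_summable_on_comparison_test')
  show "(\<lambda>\<sigma>. norm (J P (ginv G \<sigma>) * J Q \<sigma>) * C) summable_on dom_fibre G x"
    by (intro summable_on_cmult_left fibre_abs_summable assms x)
qed (auto simp: norm_mult intro!: mult_left_mono C)

lemma pairing_summable:
  assumes "P \<in> carrier FpA" "Q \<in> carrier FpA"
  shows "(\<lambda>\<sigma>. J P (ginv G \<sigma>) * J Q \<sigma> * f (gran G \<sigma>)) summable_on dom_fibre G x"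
  by (rule Infinite_Sum.abs_summable_summable[OF pairing_abs_summable[OF assms]])

lemma pairing_bound:
  assumes "P \<in> carrier FpA" "Q \<in> carrier FpA"
  shows "norm (pairing f x P Q) \<le> nrm FpA P * nrm FpA Q * C"
proof -
  have "norm (pairing f x P Q) \<le> (\<Sum>\<^sub>\<infinity>\<sigma>\<in>dom_fibre G x. norm (J P (ginv G \<sigma>) * J Q \<sigma> * f (gran G \<sigma>)))"
    unfolding pairing_def by (intro norm_infsum_bound pairing_abs_summable assms)
  also have "\<dots> \<le> nrm FpA P * nrm FpA Q * C"
  proof (rule infsum_le_finite_sums[OF pairing_abs_summable[OF assms]])
    fix F assume F: "finite F" "F \<subseteq> dom_fibre G x"
    have "(\<Sum>\<sigma>\<in>F. norm (J P (ginv G \<sigma>) * J Q \<sigma> * f (gran G \<sigma>))) \<le> (\<Sum>\<sigma>\<in>F. norm (J P (ginv G \<sigma>) * J Q \<sigma>) * C)"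
      by (intro sum_mono) (auto simp: norm_mult intro!: mult_left_mono C)
    also have "\<dots> = (\<Sum>\<sigma>\<in>F. norm (J P (ginv G \<sigma>) * J Q \<sigma>)) * C" by (simp add: sum_distrib_right)
    also have "\<dots> \<le> nrm FpA P * nrm FpA Q * C"
      using fibre_sum_bound[OF assms x F] order_trans[OF norm_ge_zero C[of x]] by (intro mult_right_mono)
    finally show "(\<Sum>\<sigma>\<in>F. norm (J P (ginv G \<sigma>) * J Q \<sigma> * f (gran G \<sigma>))) \<le> nrm FpA P * nrm FpA Q * C" .
  qed
  finally show ?thesis .
qed

lemma pairing_diff_left:
  assumes "P \<in> carrier FpA" "P' \<in> carrier FpA" "Q \<in> carrier FpA"
  shows "pairing f x P Q - pairing f x P' Q = pairing f x (P \<ominus>\<^bsub>FpA\<^esub> P') Q"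
proof -
  have "pairing f x P Q = (\<Sum>\<^sub>\<infinity>\<sigma>\<in>dom_fibre G x. J (P \<ominus>\<^bsub>FpA\<^esub> P') (ginv G \<sigma>) * J Q \<sigma> * f (gran G \<sigma>)
      + J P' (ginv G \<sigma>) * J Q \<sigma> * f (gran G \<sigma>))"
    unfolding pairing_def using assms by (intro infsum_cong) (simp add: J_minus algebra_simps)
  also have "\<dots> = pairing f x (P \<ominus>\<^bsub>FpA\<^esub> P') Q + pairing f x P' Q"
    unfolding pairing_def using assms by (intro infsum_add pairing_summable A.minus_closed)
  finally show ?thesis by simp
qed

lemma pairing_diff_right:
  assumes "P \<in> carrier FpA" "Q \<in> carrier FpA" "Q' \<in> carrier FpA"
  shows "pairing f x P Q - pairing f x P Q' = pairing f x P (Q \<ominus>\<^bsub>FpA\<^esub> Q')"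
proof -
  have "pairing f x P Q = (\<Sum>\<^sub>\<infinity>\<sigma>\<in>dom_fibre G x. J P (ginv G \<sigma>) * J (Q \<ominus>\<^bsub>FpA\<^esub> Q') \<sigma> * f (gran G \<sigma>)
      + J P (ginv G \<sigma>) * J Q' \<sigma> * f (gran G \<sigma>))"
    unfolding pairing_def using assms by (intro infsum_cong) (simp add: J_minus algebra_simps)
  also have "\<dots> = pairing f x P (Q \<ominus>\<^bsub>FpA\<^esub> Q') + pairing f x P Q'"
    unfolding pairing_def using assms by (intro infsum_add pairing_summable A.minus_closed)
  finally show ?thesis by simp
qed

end

lemma triple_product_Cc:
  assumes "b \<in> Cc G" "f \<in> Cu" "a \<in> Cc G" and x: "x \<in> units G"
  shows "J (emb b \<otimes>\<^bsub>FpA\<^esub> emb f \<otimes>\<^bsub>FpA\<^esub> emb a) x = pairing f x (emb b) (emb a)"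
proof -
  let ?S = "{\<sigma>\<in>dom_fibre G x. a \<sigma> \<noteq> 0}"
  have "J (emb b \<otimes>\<^bsub>FpA\<^esub> emb f \<otimes>\<^bsub>FpA\<^esub> emb a) x = convolution G (convolution G b f) a x"
    using assms by (simp add: emb_mult Cu_Cc convolution_Cc J_emb)
  also have "\<dots> = (\<Sum>\<sigma>\<in>?S. convolution G b f (quot x \<sigma>) * a \<sigma>)"
    using Cc_finite_fibre[OF assms(3)] x by (intro convolution_fibre_sum) (auto simp: units_arrows dom_unit)
  also have "\<dots> = (\<Sum>\<sigma>\<in>?S. b (ginv G \<sigma>) * a \<sigma> * f (gran G \<sigma>))"
  proof (rule sum.cong[OF refl])
    fix \<sigma> assume "\<sigma> \<in> ?S"
    then have \<sigma>: "\<sigma> \<in> dom_fibre G x" by blast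
    have "convolution G b f (quot x \<sigma>) = b (quot x \<sigma>) * f (gdom G (quot x \<sigma>))"
      by (rule convolution_right_units[OF quot_closed[OF dom_fibre_unit[OF x] \<sigma>]]) (use Cu_outside[OF assms(2)] in auto)
    then show "convolution G b f (quot x \<sigma>) * a \<sigma> = b (ginv G \<sigma>) * a \<sigma> * f (gran G \<sigma>)"
      using unit_quot[OF x \<sigma>] dom_quot[OF dom_fibre_unit[OF x] \<sigma>] by simp
  qed
  also have "\<dots> = (\<Sum>\<^sub>\<infinity>\<sigma>\<in>?S. b (ginv G \<sigma>) * a \<sigma> * f (gran G \<sigma>))"
    using Cc_finite_fibre[OF assms(3)] by simp
  also have "\<dots> = pairing f x (emb b) (emb a)"
    unfolding pairing_def J_emb[OF assms(1)] J_emb[OF assms(3)] by (rule infsum_cong_neutral) auto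
  finally show ?thesis .
qed

text \<open>Both sides are bilinear in b and a and bounded by a constant times the product of their
  norms; they agree on the dense image of \<open>Cc G\<close> by \<open>triple_product_Cc\<close>,
  hence everywhere.\<close>

lemma triple_product:
  assumes b: "b \<in> carrier FpA" and f: "f \<in> Cu" and a: "a \<in> carrier FpA" and x: "x \<in> units G"
  shows "J (b \<otimes>\<^bsub>FpA\<^esub> emb f \<otimes>\<^bsub>FpA\<^esub> a) x = pairing f x b a"
proof -
  obtain C where C: "0 \<le> C" "\<And>y. norm (f y) \<le> C" using Cc_bounded[OF Cu_Cc[OF f]] by blast
  note fA = emb_carrier[OF Cu_Cc[OF f]]
  define L where "L b a = J (b \<otimes>\<^bsub>FpA\<^esub> emb f \<otimes>\<^bsub>FpA\<^esub> a) x" for b a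
  define M where "M = nrm FpA (emb f) + C"
  define K where "K = 2 * (nrm FpA a + nrm FpA b + 1) * M"
  have nn: "0 \<le> nrm FpA (emb f)" "0 \<le> nrm FpA a" "0 \<le> nrm FpA b" using A.nrm_nonneg fA a b by auto
  \<comment> \<open>Replacing a and b by approximants within e changes each side by at most a
    constant times e. The restriction e \<le> 1 bounds the norm of the approximant of b by
    \<open>nrm FpA b + 1\<close>, so that K is independent of e.\<close>
  have bound: "norm (L b a - pairing f x b a) \<le> K * e" if e: "0 < e" "e \<le> 1" for e
  proof -
    obtain a' where a': "a' \<in> Cc G" "A.gap a (emb a') < e" using dense_Cc[OF a e(1)] by blast
    obtain b' where b': "b' \<in> Cc G" "A.gap b (emb b') < e" using dense_Cc[OF b e(1)] by blast
    note aA = emb_carrier[OF a'(1)] and bA = emb_carrier[OF b'(1)]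
    have nb: "nrm FpA (emb b') \<le> nrm FpA b + 1" using A.nrm_diff_le[OF b bA] b'(2) e by linarith
    have g0: "0 \<le> A.gap a (emb a')" "0 \<le> A.gap b (emb b')" using A.gap_nonneg a b aA bA by auto
    have "norm (L b a - L (emb b') (emb a')) = norm (J (b \<otimes>\<^bsub>FpA\<^esub> emb f \<otimes>\<^bsub>FpA\<^esub> a \<ominus>\<^bsub>FpA\<^esub> emb b' \<otimes>\<^bsub>FpA\<^esub> emb f \<otimes>\<^bsub>FpA\<^esub> emb a') x)"
      unfolding L_def by (subst J_minus) (auto intro: A.mult_closed a b fA aA bA)
    also have "\<dots> \<le> A.gap (b \<otimes>\<^bsub>FpA\<^esub> emb f \<otimes>\<^bsub>FpA\<^esub> a) (emb b' \<otimes>\<^bsub>FpA\<^esub> emb f \<otimes>\<^bsub>FpA\<^esub> emb a')"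
      unfolding A.gap_def by (intro J_norm_le A.minus_closed A.mult_closed a b fA aA bA)
    also have "\<dots> \<le> A.gap (b \<otimes>\<^bsub>FpA\<^esub> emb f) (emb b' \<otimes>\<^bsub>FpA\<^esub> emb f) * nrm FpA a
        + nrm FpA (emb b' \<otimes>\<^bsub>FpA\<^esub> emb f) * A.gap a (emb a')"
      by (intro A.gap_mult A.mult_closed a b fA aA bA)
    also have "\<dots> \<le> (e * nrm FpA (emb f)) * nrm FpA a + ((nrm FpA b + 1) * nrm FpA (emb f)) * e"
    proof (intro add_mono mult_mono)
      have "A.gap (b \<otimes>\<^bsub>FpA\<^esub> emb f) (emb b' \<otimes>\<^bsub>FpA\<^esub> emb f) \<le> A.gap b (emb b') * nrm FpA (emb f)"
        using A.gap_mult[OF b bA fA fA] A.gap_self[OF fA] by simp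
      also have "\<dots> \<le> e * nrm FpA (emb f)" using b'(2) nn by (intro mult_right_mono) auto
      finally show "A.gap (b \<otimes>\<^bsub>FpA\<^esub> emb f) (emb b' \<otimes>\<^bsub>FpA\<^esub> emb f) \<le> e * nrm FpA (emb f)" .
      show "nrm FpA (emb b' \<otimes>\<^bsub>FpA\<^esub> emb f) \<le> (nrm FpA b + 1) * nrm FpA (emb f)"
        using A.nrm_mult[OF bA fA] mult_right_mono[OF nb nn(1)] by linarith
    qed (use nn e a' b' g0 in auto)
    finally have 1: "norm (L b a - L (emb b') (emb a')) \<le> nrm FpA (emb f) * e * (nrm FpA a + nrm FpA b + 1)"
      by (simp add: algebra_simps)
    have "pairing f x b a - pairing f x (emb b') (emb a')
        = pairing f x (b \<ominus>\<^bsub>FpA\<^esub> emb b') a + pairing f x (emb b') (a \<ominus>\<^bsub>FpA\<^esub> emb a')"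
      unfolding pairing_diff_left[where f = f, OF C(2) x b bA a, symmetric]
        pairing_diff_right[where f = f, OF C(2) x bA a aA, symmetric] by simp
    also have "norm \<dots> \<le> A.gap b (emb b') * nrm FpA a * C + nrm FpA (emb b') * A.gap a (emb a') * C"
      unfolding A.gap_def
      by (intro norm_triangle_mono pairing_bound[where f = f, OF C(2) x] A.minus_closed a b aA bA)
    also have "\<dots> \<le> e * nrm FpA a * C + (nrm FpA b + 1) * e * C"
      using a'(2) b'(2) nb nn C(1) g0 by (intro add_mono mult_right_mono mult_mono) auto
    finally have 2: "norm (pairing f x b a - pairing f x (emb b') (emb a')) \<le> C * e * (nrm FpA a + nrm FpA b + 1)"
      by (simp add: algebra_simps)
    have "L (emb b') (emb a') = pairing f x (emb b') (emb a')"
      unfolding L_def by (rule triple_product_Cc[OF b'(1) f a'(1) x])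
    then have "norm (L b a - pairing f x b a) \<le> norm (L b a - L (emb b') (emb a')) + norm (pairing f x b a - pairing f x (emb b') (emb a'))"
      using norm_triangle_ineq4[of "L b a - L (emb b') (emb a')" "pairing f x b a - pairing f x (emb b') (emb a')"] by simp
    also have "\<dots> \<le> M * e * (nrm FpA a + nrm FpA b + 1)" using 1 2 by (simp add: M_def algebra_simps)
    also have "\<dots> \<le> 2 * (M * e * (nrm FpA a + nrm FpA b + 1))"
    proof -
      have "0 \<le> M * e * (nrm FpA a + nrm FpA b + 1)" using nn C(1) e by (auto simp: M_def)
      then show ?thesis by simp
    qed
    finally show ?thesis by (simp add: K_def mult_ac)
  qed
  have "(\<lambda>n. K * inverse (real (Suc n))) \<longlonglongrightarrow> K * 0"
    by (intro tendsto_mult_left LIMSEQ_inverse_real_of_nat)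
  then have "norm (L b a - pairing f x b a) \<le> K * 0"
    by (rule LIMSEQ_le_const) (use bound in \<open>auto simp: inverse_le_1_iff\<close>)
  then show ?thesis by (simp add: L_def)
qed

end

section \<open>From realizable maps to bisections\<close>

context reduced_groupoid_algebra_ne_2
begin

text \<open>Here \<open>m\<close> stands for the complex measure \<open>\<Sum>\<^sub>\<sigma> m(\<sigma>) \<delta>\<^bsub>ran \<sigma>\<^esub>\<close> on the unit space.\<close>

lemma fibre_measure_atoms:
  fixes m :: "'g \<Rightarrow> complex"
  assumes m: "(\<lambda>\<sigma>. norm (m \<sigma>)) summable_on dom_fibre G x"
    and V: "openin (unit_space G) V" "y \<in> V" "z \<in> V"
    and point: "\<And>f. f \<in> Cu \<Longrightarrow> (\<And>v. f v \<in> \<real>\<^sub>\<ge>\<^sub>0) \<Longrightarrow> (\<And>v. v \<notin> V \<Longrightarrow> f v = 0) \<Longrightarrow>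
      (\<Sum>\<^sub>\<infinity>\<sigma>\<in>dom_fibre G x. m \<sigma> * f (gran G \<sigma>)) = f z * c"
  shows "(\<Sum>\<^sub>\<infinity>\<sigma>\<in>{\<sigma>\<in>dom_fibre G x. gran G \<sigma> = y}. m \<sigma>) = (if y = z then c else 0)"
proof -
  let ?D = "dom_fibre G x"
  define s where "s = (\<Sum>\<^sub>\<infinity>\<sigma>\<in>{\<sigma>\<in>?D. gran G \<sigma> = y}. m \<sigma>)"
  have yz: "y \<in> units G" "z \<in> units G" using V openin_subset[OF V(1)] by (auto simp: topspace_unit_space)
  have est: "norm ((if y = z then c else 0) - s) \<le> e" if e: "e > 0" for e
  proof -
    obtain F where F: "finite F" "F \<subseteq> ?D" "(\<Sum>\<^sub>\<infinity>\<sigma>\<in>?D - F. norm (m \<sigma>)) \<le> e"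
      using infsum_small_tail[OF m e] by blast
    \<comment> \<open>Let f be 1 at y and 0 at every other range of an arrow in F, at z unless z =
      y, and off V. On F the function \<open>f (gran G \<sigma>)\<close> is then exactly the
      indicator of \<open>gran G \<sigma> = y\<close>, so only the tail outside F contributes an
      error.\<close>
    define S where "S = (units G - V) \<union> (insert z (gran G ` F) - {y})"
    have "closedin (unit_space G) (units G - V)" using V(1) by (metis openin_closedin_eq topspace_unit_space)
    moreover have "insert z (gran G ` F) - {y} \<subseteq> units G" using yz F(2) ran_units by (auto simp: dom_fibre_iff)
    then have "closedin (unit_space G) (insert z (gran G ` F) - {y})"
      using F(1) closedin_Hausdorff_finite[OF Hausdorff_unit_space] by (simp add: topspace_unit_space)
    ultimately have "closedin (unit_space G) S" unfolding S_def by (rule closedin_Un)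
    moreover have "y \<notin> S" using V(2) by (simp add: S_def)
    ultimately obtain f where f: "f \<in> Cu" "f y = 1" "\<And>v. v \<in> S \<Longrightarrow> f v = 0" "\<And>v. norm (f v) \<le> 1" "\<And>v. f v \<in> \<real>\<^sub>\<ge>\<^sub>0"
      using separate_point_closed[OF yz(1)] by metis
    have "f v = 0" if "v \<notin> V" for v
      using f(3)[of v] that Cu_outside[OF f(1)] by (cases "v \<in> units G") (auto simp: S_def)
    then have eq: "(\<Sum>\<^sub>\<infinity>\<sigma>\<in>?D. m \<sigma> * f (gran G \<sigma>)) = f z * c" by (rule point[OF f(1,5)])
    have fz: "f z = (if y = z then 1 else 0)" using f(2) f(3)[of z] by (auto simp: S_def)
    \<comment> \<open>The deviation of f from the indicator of y along ranges: it vanishes on F and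
      is at most 1 in modulus, so its integral is bounded by the tail of m.\<close>
    define q where "q \<sigma> = f (gran G \<sigma>) - (if gran G \<sigma> = y then 1 else 0)" for \<sigma>
    have q: "norm (q \<sigma>) \<le> 1" for \<sigma> using f(2,4) by (auto simp: q_def)
    have qF: "q \<sigma> = 0" if "\<sigma> \<in> F" for \<sigma> using f(2) f(3)[of "gran G \<sigma>"] that by (auto simp: q_def S_def)
    have sm: "(\<lambda>\<sigma>. norm (m \<sigma> * g \<sigma>)) summable_on ?D" if "\<And>\<sigma>. norm (g \<sigma>) \<le> 1" for g
      by (rule Infinite_Sum.abs_summable_on_comparison_test'[OF m]) (use that in \<open>auto simp: norm_mult mult_left_le\<close>)
    have s: "s = (\<Sum>\<^sub>\<infinity>\<sigma>\<in>?D. m \<sigma> * (if gran G \<sigma> = y then 1 else 0))"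
      unfolding s_def by (rule infsum_cong_neutral) auto
    have "f z * c = (\<Sum>\<^sub>\<infinity>\<sigma>\<in>?D. m \<sigma> * (if gran G \<sigma> = y then 1 else 0) + m \<sigma> * q \<sigma>)"
      unfolding eq[symmetric] by (intro infsum_cong) (simp add: q_def algebra_simps)
    also have "\<dots> = s + (\<Sum>\<^sub>\<infinity>\<sigma>\<in>?D. m \<sigma> * q \<sigma>)"
      unfolding s by (intro infsum_add Infinite_Sum.abs_summable_summable[OF sm] q) auto
    finally have "norm (f z * c - s) = norm (\<Sum>\<^sub>\<infinity>\<sigma>\<in>?D. m \<sigma> * q \<sigma>)" by simp
    also have "(\<Sum>\<^sub>\<infinity>\<sigma>\<in>?D. m \<sigma> * q \<sigma>) = (\<Sum>\<^sub>\<infinity>\<sigma>\<in>?D - F. m \<sigma> * q \<sigma>)"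
      by (rule infsum_cong_neutral) (use qF in auto)
    also have "norm \<dots> \<le> (\<Sum>\<^sub>\<infinity>\<sigma>\<in>?D - F. norm (m \<sigma> * q \<sigma>))"
      using summable_on_subset_banach[OF sm[OF q], of "?D - F"] by (intro norm_infsum_bound) auto
    also have "\<dots> \<le> (\<Sum>\<^sub>\<infinity>\<sigma>\<in>?D - F. norm (m \<sigma>))"
      using summable_on_subset_banach[OF sm[OF q], of "?D - F"] summable_on_subset_banach[OF m, of "?D - F"] q
      by (intro infsum_mono) (auto simp: norm_mult mult_left_le)
    finally show ?thesis using F(3) fz by (auto split: if_splits)
  qed
  have "norm ((if y = z then c else 0) - s) \<le> 0"
    by (rule field_le_epsilon) (use est in simp)
  then show ?thesis by (simp add: s_def)
qed

lemma core_pos_emb: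
  assumes "f \<in> Cu" "\<And>x. x \<in> units G \<Longrightarrow> f x \<in> \<real>\<^sub>\<ge>\<^sub>0" "units G \<noteq> {}"
  shows "emb f \<in> core_pos FpA"
  using assms emb_core ev_emb by (auto simp: core_pos_def characters_eq)

lemma core_pos_cases:
  assumes "P \<in> core_pos FpA" "units G \<noteq> {}"
  obtains f where "f \<in> Cu" "P = emb f" "\<And>x. x \<in> units G \<Longrightarrow> f x \<in> \<real>\<^sub>\<ge>\<^sub>0"
proof -
  obtain f where f: "f \<in> Cu" "P = emb f" using assms by (auto simp: core_pos_def core_eq)
  have "f x \<in> \<real>\<^sub>\<ge>\<^sub>0" if "x \<in> units G" for x
    using assms(1) ev_emb[OF that f(1)] that unfolding core_pos_def characters_eq f(2) by force
  then show thesis using that f by blast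
qed

lemma continuous_ev: "continuous_map (unit_space G) (core_spectrum FpA) ev"
  by (rule homeomorphic_imp_continuous_map[OF ev_homeomorphic])

lemma open_ev_preimage: "openin (core_spectrum FpA) U \<Longrightarrow> openin (unit_space G) {x \<in> units G. ev x \<in> U}"
  using openin_continuous_map_preimage[OF continuous_ev] by (simp add: topspace_unit_space)

text \<open>At a unit with trivial isotropy, an arrow \<open>\<gamma>\<close> is determined by its domain and range, so that the
  product \<open>b(\<gamma>\<^sup>-\<^sup>1) a(\<gamma>)\<close> is the mass of a single atom.\<close>

lemma realizable_locally_bisection:
  assumes principal: "topologically_principal G"
    and \<alpha>: "\<alpha> \<in> realizable_homeos FpA" and x0: "x0 \<in> units G" "ev x0 \<in> dom \<alpha>"
  obtains B \<sigma> where "open_bisection G B" "\<sigma> \<in> B" "gdom G \<sigma> = x0"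
    "\<And>\<beta>. \<beta> \<in> B \<Longrightarrow> \<alpha> (ev (gdom G \<beta>)) = Some (ev (gran G \<beta>))"
proof -
  have ne: "units G \<noteq> {}" using x0 by blast
  have ph: "\<alpha> \<in> partial_homeos (core_spectrum FpA)" using \<alpha> by (simp add: realizable_homeos_def)
  obtain a b where a: "a \<in> carrier FpA" and b: "b \<in> carrier FpA" and r: "realized_by FpA \<alpha> a b"
    using \<alpha> by (auto simp: realizable_homeos_def)
  have r_pos: "b \<otimes>\<^bsub>FpA\<^esub> f \<otimes>\<^bsub>FpA\<^esub> a \<in> core_pos FpA" if "f \<in> core_pos FpA" for f
    using r that unfolding realized_by_def by (elim conjE) (drule bspec, assumption, elim conjE, assumption)
  have r_dom: "dom \<alpha> = {\<phi> \<in> characters FpA. Re (\<phi> (b \<otimes>\<^bsub>FpA\<^esub> a)) > 0}"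
    using r unfolding realized_by_def by (elim conjE)
  have r_eq: "the (\<alpha> \<phi>) f * \<phi> (b \<otimes>\<^bsub>FpA\<^esub> a) = \<phi> (b \<otimes>\<^bsub>FpA\<^esub> f \<otimes>\<^bsub>FpA\<^esub> a)"
    if "\<phi> \<in> dom \<alpha>" "f \<in> core_C0 FpA (ran \<alpha>)" for \<phi> f
    using r that unfolding realized_by_def by (elim conjE) (drule bspec, assumption)+
  define V where "V = {x \<in> units G. ev x \<in> ran \<alpha>}"
  define U where "U = {x \<in> units G. ev x \<in> dom \<alpha>}"
  have UV: "openin (unit_space G) U" "openin (unit_space G) V"
    using ph open_ev_preimage by (auto simp: partial_homeos_def U_def V_def)
  have "\<exists>z. z \<in> V \<and> \<alpha> (ev x) = Some (ev z)" if "x \<in> U" for x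
  proof -
    have "ev x \<in> dom \<alpha>" using that by (simp add: U_def)
    then obtain \<phi> where \<phi>: "\<alpha> (ev x) = Some \<phi>" by (elim domD[elim_format] exE)
    then have "\<phi> \<in> ran \<alpha>" by (auto simp: ran_def)
    moreover have "ran \<alpha> \<subseteq> characters FpA"
      using ph openin_subset[of "core_spectrum FpA" "ran \<alpha>"] by (simp add: partial_homeos_def topspace_core_spectrum)
    ultimately show ?thesis using \<phi> by (auto simp: characters_eq V_def)
  qed
  then obtain z where z: "\<And>x. x \<in> U \<Longrightarrow> z x \<in> V \<and> \<alpha> (ev x) = Some (ev (z x))" by metis
  define m where "m \<sigma> = J b (ginv G \<sigma>) * J a \<sigma>" for \<sigma>
  define c where "c x = ev x (b \<otimes>\<^bsub>FpA\<^esub> a)" for x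
  have c: "c x \<noteq> 0" if "x \<in> U" for x
  proof -
    have "ev x \<in> dom \<alpha>" using that by (simp add: U_def)
    then have "Re (c x) > 0" unfolding c_def r_dom by blast
    then show ?thesis by auto
  qed
  \<comment> \<open>Valid at every x in U, with or without isotropy: the masses of all arrows from x
    to y are added up. Only for trivial isotropy does the sum reduce to a single product.\<close>
  have atoms: "(\<Sum>\<^sub>\<infinity>\<sigma>\<in>{\<sigma>\<in>dom_fibre G x. gran G \<sigma> = y}. m \<sigma>) = (if y = z x then c x else 0)"
    if x: "x \<in> U" and y: "y \<in> V" for x y
  proof (rule fibre_measure_atoms[OF _ UV(2) y])
    have xu: "x \<in> units G" using x by (simp add: U_def)
    show "(\<lambda>\<sigma>. norm (m \<sigma>)) summable_on dom_fibre G x" unfolding m_def by (rule fibre_abs_summable[OF b a xu])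
    show zV: "z x \<in> V" using z[OF x] by blast
    fix f assume f: "f \<in> Cu" "\<And>v. f v \<in> \<real>\<^sub>\<ge>\<^sub>0" "\<And>v. v \<notin> V \<Longrightarrow> f v = 0"
    \<comment> \<open>Positivity of f is what places b f a in the core, and only there is
      \<open>ev x\<close> the evaluation of the associated function; this is why
      \<open>fibre_measure_atoms\<close> tests with nonnegative functions.\<close>
    have "emb f \<in> core_pos FpA" using core_pos_emb f ne by blast
    then have "b \<otimes>\<^bsub>FpA\<^esub> emb f \<otimes>\<^bsub>FpA\<^esub> a \<in> core FpA" using r_pos by (simp add: core_pos_def)
    then have "ev x (b \<otimes>\<^bsub>FpA\<^esub> emb f \<otimes>\<^bsub>FpA\<^esub> a) = pairing f x b a"
      using triple_product[OF b f(1) a xu] by (simp add: ev_def)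
    moreover have "emb f \<in> core_C0 FpA (ran \<alpha>)"
      using emb_core[OF ne f(1)] ev_emb[OF _ f(1)] f(3) by (auto simp: core_C0_def characters_eq V_def)
    then have "ev (z x) (emb f) * c x = ev x (b \<otimes>\<^bsub>FpA\<^esub> emb f \<otimes>\<^bsub>FpA\<^esub> a)"
      using r_eq[of "ev x" "emb f"] z[OF x] x by (simp add: U_def c_def)
    moreover have "ev (z x) (emb f) = f (z x)" using zV ev_emb[OF _ f(1)] by (simp add: V_def)
    ultimately show "(\<Sum>\<^sub>\<infinity>\<sigma>\<in>dom_fibre G x. m \<sigma> * f (gran G \<sigma>)) = f (z x) * c x"
      by (simp add: pairing_def m_def)
  qed
  have x0U: "x0 \<in> U" using x0 by (simp add: U_def)
  have "(\<Sum>\<^sub>\<infinity>\<sigma>\<in>{\<sigma>\<in>dom_fibre G x0. gran G \<sigma> = z x0}. m \<sigma>) \<noteq> 0"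
    using atoms[OF x0U, of "z x0"] z[OF x0U] c[OF x0U] by simp
  then obtain \<sigma> where \<sigma>: "\<sigma> \<in> dom_fibre G x0" "gran G \<sigma> = z x0" "m \<sigma> \<noteq> 0"
    using infsum_0[of "{\<sigma>\<in>dom_fibre G x0. gran G \<sigma> = z x0}" m] by auto
  \<comment> \<open>The open set on which the product m is nonzero and \<open>atoms\<close> can be
    applied: domains in U, ranges in V.\<close>
  define W where "W = {\<gamma> \<in> arrows G. J b (ginv G \<gamma>) \<in> - {0}} \<inter> {\<gamma> \<in> arrows G. J a \<gamma> \<in> - {0}}
    \<inter> ({\<gamma> \<in> arrows G. gdom G \<gamma> \<in> U} \<inter> {\<gamma> \<in> arrows G. gran G \<gamma> \<in> V})"
  have "openin (gtop G) W"
    unfolding W_def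
  proof (intro openin_Int openin_continuous_map_preimage[OF _ _, where Y = "gtop G"]
      openin_continuous_map_preimage[OF _ _, where Y = euclidean])
    show "continuous_map (gtop G) euclidean (\<lambda>\<gamma>. J b (ginv G \<gamma>))"
      using continuous_map_compose[OF continuous_inv J_continuous[OF b]] by (simp add: o_def)
  qed (use UV continuous_dom continuous_ran J_continuous[OF a] in \<open>auto simp: openin_unit_space open_Compl\<close>)
  moreover have "\<sigma> \<in> W" using \<sigma> x0U z[OF x0U] by (auto simp: W_def m_def dom_fibre_iff)
  ultimately obtain B where B: "open_bisection G B" "\<sigma> \<in> B" "B \<subseteq> W" by (rule bisection_basis)
  let ?D = "gdom G ` B" and ?X = "subtopology (unit_space G) (gdom G ` B)"
  have D: "openin (unit_space G) ?D"
    using open_dom[OF bisection_open[OF B(1)]] dom_units bisection_arrows[OF B(1)] by (auto simp: openin_unit_space)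
  have DU: "?D \<subseteq> U" using B(3) by (auto simp: W_def)
  have tX: "topspace ?X = ?D" using openin_subset[OF D] by auto
  define f where "f = (\<lambda>x. ev (gran G (sec B x)))"
  have cf: "continuous_map ?X (core_spectrum FpA) f"
  proof -
    have "continuous_map ?X (gtop G) (sec B)"
      using continuous_map_from_subtopology[OF continuous_sec[OF B(1)], of "units G"]
      by (simp add: unit_space_def subtopology_subtopology Int_commute)
    then have "continuous_map ?X (gtop G) (gran G \<circ> sec B)" by (rule continuous_map_compose[OF _ continuous_ran])
    then have "continuous_map ?X (unit_space G) (gran G \<circ> sec B)"
      unfolding unit_space_def[of G] using ran_units bisection_arrows[OF B(1)] sec_in tX[unfolded unit_space_def]
      by (intro continuous_map_into_subtopology) auto
    from continuous_map_compose[OF this continuous_ev] show ?thesis by (simp add: f_def o_def)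
  qed
  have cg: "continuous_map ?X (core_spectrum FpA) (\<lambda>x. the (\<alpha> (ev x)))"
  proof -
    have "homeomorphic_map (subtopology (core_spectrum FpA) (dom \<alpha>)) (subtopology (core_spectrum FpA) (ran \<alpha>)) (the \<circ> \<alpha>)"
      using ph by (simp add: partial_homeos_def)
    then have 1: "continuous_map (subtopology (core_spectrum FpA) (dom \<alpha>)) (core_spectrum FpA) (the \<circ> \<alpha>)"
      using homeomorphic_imp_continuous_map continuous_map_into_fulltopology by blast
    have "continuous_map ?X (subtopology (core_spectrum FpA) (dom \<alpha>)) ev"
      using DU by (intro continuous_map_into_subtopology continuous_map_from_subtopology continuous_ev) (auto simp: U_def)
    from continuous_map_compose[OF this 1] show ?thesis by (simp add: o_def)
  qed
  have agree: "f x = the (\<alpha> (ev x))" if "x \<in> ?D" for x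
  proof (rule continuous_maps_agree_dense[OF _ D _ cf cg _ that])
    show "Hausdorff_space (core_spectrum FpA)"
      using homeomorphic_Hausdorff_space[OF homeomorphic_map_imp_homeomorphic_space[OF ev_homeomorphic]] Hausdorff_unit_space by blast
    show "unit_space G closure_of {x \<in> units G. isotropy G x = {x}} = topspace (unit_space G)"
      using principal by (simp add: topologically_principal_def topspace_unit_space)
    fix x assume x: "x \<in> ?D" "x \<in> {x \<in> units G. isotropy G x = {x}}"
    let ?s = "sec B x"
    have s: "?s \<in> W" "?s \<in> dom_fibre G x"
      using sec_in[OF x(1)] dom_sec[OF x(1)] B(3) bisection_arrows[OF B(1)] by (auto simp: dom_fibre_iff)
    \<comment> \<open>The atom at \<open>gran G ?s\<close> has mass \<open>m ?s\<close>, which is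
      nonzero on W; by \<open>atoms\<close> the only point of V with nonzero mass is
      \<open>z x\<close>.\<close>
    have "{\<sigma> \<in> dom_fibre G x. gran G \<sigma> = gran G ?s} = {?s}"
      using trivial_isotropy_unique[OF _ _ s(2)] s(2) x(2) by auto
    moreover have "m ?s \<noteq> 0" "gran G ?s \<in> V" using s(1) by (auto simp: W_def m_def)
    ultimately have "gran G ?s = z x"
      using atoms[of x "gran G ?s"] x(1) DU by (auto split: if_splits)
    then show "f x = the (\<alpha> (ev x))" using z[of x] x(1) DU by (auto simp: f_def)
  qed
  show thesis
  proof (rule that[OF B(1,2)])
    show "gdom G \<sigma> = x0" using \<sigma>(1) by (simp add: dom_fibre_iff)
    fix \<beta> assume \<beta>: "\<beta> \<in> B"
    then have "the (\<alpha> (ev (gdom G \<beta>))) = ev (gran G \<beta>)"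
      using agree[of "gdom G \<beta>"] sec_dom[OF B(1) \<beta>] by (simp add: f_def)
    moreover have "gdom G \<beta> \<in> U" using \<beta> DU by blast
    ultimately show "\<alpha> (ev (gdom G \<beta>)) = Some (ev (gran G \<beta>))" using z[of "gdom G \<beta>"] by auto
  qed
qed

end

section \<open>Bisections as partial homeomorphisms\<close>

context etale_groupoid
begin

lemma inv_bisection:
  assumes B: "open_bisection G B" shows "open_bisection G (ginv G ` B)"
  unfolding open_bisection_def
proof (intro conjI)
  have "ginv G ` B = {\<gamma> \<in> arrows G. ginv G \<gamma> \<in> B}"
    using bisection_arrows[OF B] inv_closed inv_inv by (auto simp: image_iff) metis
  then show "openin (gtop G) (ginv G ` B)"
    using openin_continuous_map_preimage[OF continuous_inv bisection_open[OF B]] by simp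
  have *: "inj_on (gdom G) B" "inj_on (gran G) B" using B by (auto simp: open_bisection_def)
  show "inj_on (gdom G) (ginv G ` B)"
    using inj_onD[OF *(2)] bisection_arrows[OF B] dom_inv by (auto simp: inj_on_def)
  show "inj_on (gran G) (ginv G ` B)"
    using inj_onD[OF *(1)] bisection_arrows[OF B] ran_inv by (auto simp: inj_on_def)
qed

lemma bisection_map_dom:
  "open_bisection G B \<Longrightarrow> \<beta> \<in> B \<Longrightarrow> bisection_map G B (gdom G \<beta>) = Some (gran G \<beta>)"
  using sec_dom by (auto simp: bisection_map_def sec_def)

lemma bisection_homeomorphic:
  assumes B: "open_bisection G B" and q: "q = gdom G \<or> q = gran G"
  shows "homeomorphic_map (subtopology (gtop G) B) (subtopology (unit_space G) (q ` B)) q"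
proof (rule bijective_open_imp_homeomorphic_map)
  note Bo = bisection_open[OF B]
  have tB: "topspace (subtopology (gtop G) B) = B" using openin_subset[OF Bo] by auto
  have qu: "q ` B \<subseteq> units G" using q bisection_arrows[OF B] dom_units ran_units by auto
  have qo: "openin (gtop G) (q ` U)" if "openin (gtop G) U" for U using q that open_dom open_ran by auto
  have tq: "topspace (subtopology (unit_space G) (q ` B)) = q ` B" using qu by (auto simp: topspace_unit_space)
  show "continuous_map (subtopology (gtop G) B) (subtopology (unit_space G) (q ` B)) q"
    unfolding unit_space_def using q qu tB continuous_dom continuous_ran
    by (intro continuous_map_into_subtopology continuous_map_from_subtopology) auto
  show "open_map (subtopology (gtop G) B) (subtopology (unit_space G) (q ` B)) q"
    unfolding open_map_def
  proof (intro allI impI)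
    fix U assume "openin (subtopology (gtop G) B) U"
    then have U: "openin (gtop G) U" "U \<subseteq> B" using openin_open_subtopology[OF Bo] by auto
    have "openin (unit_space G) (q ` B)" using qo[OF Bo] qu by (simp add: openin_unit_space)
    moreover have "openin (unit_space G) (q ` U)" using qo[OF U(1)] qu U(2) by (auto simp: openin_unit_space)
    ultimately show "openin (subtopology (unit_space G) (q ` B)) (q ` U)"
      using U(2) openin_open_subtopology by blast
  qed
  show "q ` topspace (subtopology (gtop G) B) = topspace (subtopology (unit_space G) (q ` B))"
    unfolding tB tq ..
  show "inj_on q (topspace (subtopology (gtop G) B))"
    unfolding tB using B q by (auto simp: open_bisection_def)
qed

end

text \<open>Abstracts from the spectrum: X and h will be the core spectrum and \<open>ev\<close>.
  What follows about bisections and germs is thereby pure topology.\<close>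

locale unit_space_chart = etale_groupoid G for G :: "'g topgroupoid" +
  fixes X :: "'x topology" and h :: "'g \<Rightarrow> 'x"
  assumes h: "homeomorphic_map (unit_space G) X h"
begin

lemma h_inj: "x \<in> units G \<Longrightarrow> y \<in> units G \<Longrightarrow> h x = h y \<longleftrightarrow> x = y"
  using homeomorphic_imp_injective_map[OF h] by (auto simp: topspace_unit_space dest: inj_onD)

lemma topspace_X: "topspace X = h ` units G"
  using homeomorphic_imp_surjective_map[OF h] by (simp add: topspace_unit_space)

lemma h_open: "openin (gtop G) U \<Longrightarrow> U \<subseteq> units G \<Longrightarrow> openin X (h ` U)"
  using homeomorphic_imp_open_map[OF h] by (simp add: open_map_def openin_unit_space)

lemma h_open_preimage: "openin X U \<Longrightarrow> openin (gtop G) {x \<in> units G. h x \<in> U}"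
  using openin_continuous_map_preimage[OF homeomorphic_imp_continuous_map[OF h]] openin_unit_space
  by (simp add: topspace_unit_space)

definition \<tau> :: "'g set \<Rightarrow> 'x \<rightharpoonup> 'x" where
  "\<tau> B = transport (units G) h (bisection_map G B)"

context
  fixes B assumes B: "open_bisection G B"
begin

lemma bisection_dom_units: "\<beta> \<in> B \<Longrightarrow> gdom G \<beta> \<in> units G"
  and bisection_ran_units: "\<beta> \<in> B \<Longrightarrow> gran G \<beta> \<in> units G"
  using bisection_arrows[OF B] dom_units ran_units by auto

lemma inv_into_h: "x \<in> units G \<Longrightarrow> inv_into (units G) h (h x) = x"
  using homeomorphic_imp_injective_map[OF h] by (simp add: topspace_unit_space)

lemma \<tau>_apply: "\<beta> \<in> B \<Longrightarrow> \<tau> B (h (gdom G \<beta>)) = Some (h (gran G \<beta>))"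
  using bisection_dom_units bisection_map_dom[OF B] by (simp add: \<tau>_def transport_def inv_into_h)

lemma \<tau>_SomeD:
  assumes "\<tau> B \<phi> = Some \<psi>" obtains \<beta> where "\<beta> \<in> B" "\<phi> = h (gdom G \<beta>)" "\<psi> = h (gran G \<beta>)"
proof -
  obtain x where x: "x \<in> units G" "\<phi> = h x" using assms by (auto simp: \<tau>_def transport_def split: if_splits)
  then have "map_option h (bisection_map G B x) = Some \<psi>"
    using assms by (simp add: \<tau>_def transport_def inv_into_h)
  then obtain \<beta> where "\<beta> \<in> B" "x = gdom G \<beta>" by (auto simp: bisection_map_def split: if_splits)
  then show thesis using that x \<tau>_apply assms by auto
qed

lemma dom_\<tau>: "dom (\<tau> B) = h ` gdom G ` B"
  using \<tau>_apply by (auto elim: \<tau>_SomeD)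

lemma ran_\<tau>: "ran (\<tau> B) = h ` gran G ` B"
  using \<tau>_apply by (force simp: ran_def elim: \<tau>_SomeD)

lemma pinv_\<tau>:
  assumes "\<beta> \<in> B" shows "pinv (\<tau> B) (h (gran G \<beta>)) = Some (h (gdom G \<beta>))"
proof -
  have "(THE \<phi>. \<tau> B \<phi> = Some (h (gran G \<beta>))) = h (gdom G \<beta>)"
  proof (rule the_equality[where P = "\<lambda>\<phi>. \<tau> B \<phi> = Some (h (gran G \<beta>))", OF \<tau>_apply[OF assms]])
    fix \<phi> assume "\<tau> B \<phi> = Some (h (gran G \<beta>))"
    then obtain \<beta>' where "\<beta>' \<in> B" "\<phi> = h (gdom G \<beta>')" "h (gran G \<beta>) = h (gran G \<beta>')" by (rule \<tau>_SomeD)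
    moreover from this have "\<beta>' = \<beta>"
      using h_inj bisection_ran_units assms B by (auto simp: open_bisection_def dest: inj_onD)
    ultimately show "\<phi> = h (gdom G \<beta>)" by simp
  qed
  then show ?thesis using assms by (simp add: pinv_def ran_\<tau>)
qed

text \<open>Both \<open>gdom\<close> and \<open>gran\<close> map B homeomorphically onto open sets
  of units, and \<tau> B is the composite that goes back along \<open>gdom\<close> and forward along
  \<open>gran\<close>, carried over by h.\<close>

lemma \<tau>_partial_homeo: "\<tau> B \<in> partial_homeos X"
proof -
  have open_dom': "openin X (dom (\<tau> B))" and open_ran': "openin X (ran (\<tau> B))"
    unfolding dom_\<tau> ran_\<tau> using bisection_dom_units bisection_ran_units open_dom open_ran bisection_open[OF B]
    by (auto intro!: h_open)
  have sub: "homeomorphic_map (subtopology (unit_space G) U) (subtopology X (h ` U)) h" if "U \<subseteq> units G" for U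
    by (rule homeomorphic_map_subtopologies[OF h]) (use that in \<open>auto simp: topspace_X topspace_unit_space\<close>)
  have d: "homeomorphic_map (subtopology (gtop G) B) (subtopology X (dom (\<tau> B))) (h \<circ> gdom G)"
    unfolding dom_\<tau> using bisection_dom_units
    by (intro homeomorphic_map_compose[OF bisection_homeomorphic[OF B] sub]) auto
  have r: "homeomorphic_map (subtopology (gtop G) B) (subtopology X (ran (\<tau> B))) (h \<circ> gran G)"
    unfolding ran_\<tau> using bisection_ran_units
    by (intro homeomorphic_map_compose[OF bisection_homeomorphic[OF B] sub]) auto
  obtain g where g: "homeomorphic_maps (subtopology (gtop G) B) (subtopology X (dom (\<tau> B))) (h \<circ> gdom G) g"
    using d by (auto simp: homeomorphic_map_maps)
  then have "homeomorphic_map (subtopology X (dom (\<tau> B))) (subtopology (gtop G) B) g"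
    using homeomorphic_maps_sym homeomorphic_maps_map by blast
  then have "homeomorphic_map (subtopology X (dom (\<tau> B))) (subtopology X (ran (\<tau> B))) ((h \<circ> gran G) \<circ> g)"
    using r by (rule homeomorphic_map_compose)
  moreover have "((h \<circ> gran G) \<circ> g) \<phi> = (the \<circ> \<tau> B) \<phi>" if "\<phi> \<in> topspace (subtopology X (dom (\<tau> B)))" for \<phi>
  proof -
    have "\<phi> \<in> dom (\<tau> B)" using that by simp
    then obtain \<beta> where \<beta>: "\<beta> \<in> B" "\<phi> = h (gdom G \<beta>)" by (auto simp: dom_\<tau>)
    then have "g \<phi> = \<beta>" using g bisection_arrows[OF B] by (auto simp: homeomorphic_maps_def)
    then show ?thesis using \<beta> \<tau>_apply by simp
  qed
  ultimately have "homeomorphic_map (subtopology X (dom (\<tau> B))) (subtopology X (ran (\<tau> B))) (the \<circ> \<tau> B)"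
    by (rule homeomorphic_map_eq)
  then show ?thesis using open_dom' open_ran' by (simp add: partial_homeos_def)
qed

end

end

section \<open>Realizing bisections by bump functions\<close>

context reduced_groupoid_algebra_ne_2
begin

sublocale chart: unit_space_chart G "core_spectrum FpA" ev
  by unfold_locales (rule ev_homeomorphic)

text \<open>The usual involution without complex conjugation. It is applied to functions that are
  nonnegative on a bisection, so the products below have the nonnegative values
  \<open>(a \<beta>)\<^sup>2\<close>.\<close>

definition adj :: "('g \<Rightarrow> complex) \<Rightarrow> 'g \<Rightarrow> complex" where
  "adj a \<gamma> = (if \<gamma> \<in> arrows G then a (ginv G \<gamma>) else 0)"

lemma adj_Cc:
  assumes a: "a \<in> Cc G" shows "adj a \<in> Cc G"
proof -
  obtain K where K: "compactin (gtop G) K" "\<And>\<gamma>. a \<gamma> \<noteq> 0 \<Longrightarrow> \<gamma> \<in> K" using Cc_support[OF a] by blast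
  show ?thesis
  proof (rule CcI)
    show "compactin (gtop G) (ginv G ` K)" by (rule image_compactin[OF K(1) continuous_inv])
    show "\<gamma> \<in> ginv G ` K" if "adj a \<gamma> \<noteq> 0" for \<gamma>
      using that K(2)[of "ginv G \<gamma>"] inv_inv by (auto simp: adj_def image_iff split: if_splits) metis
    have "continuous_map (gtop G) euclidean (a \<circ> ginv G)"
      by (rule continuous_map_compose[OF continuous_inv Cc_continuous[OF a]])
    then show "continuous_map (gtop G) euclidean (adj a)"
      by (rule continuous_map_eq) (auto simp: adj_def)
  qed (simp add: adj_def)
qed

lemma adj_adj: "a \<in> Cc G \<Longrightarrow> adj (adj a) = a"
  by (rule ext) (auto simp: adj_def inv_inv inv_closed Cc_outside)

context
  fixes B a f
  assumes B: "open_bisection G B" and a: "a \<in> Cc G" "\<And>\<gamma>. \<gamma> \<notin> B \<Longrightarrow> a \<gamma> = 0" and f: "f \<in> Cu"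
begin

text \<open>A nonzero term at \<eta> requires \<sigma> and \<open>quot \<sigma> \<eta>\<close> to
  lie both in B. They have the same range, so they coincide, and \<eta> is the unit
  \<open>gdom G \<sigma>\<close>.\<close>

lemma conjugate_bisection_zero:
  assumes "\<eta> \<notin> gdom G ` B" shows "convolution G (convolution G (adj a) f) a \<eta> = 0"
proof (cases "\<eta> \<in> arrows G")
  case \<eta>: True
  let ?u = "convolution G (adj a) f"
  have \<eta>f: "\<eta> \<in> dom_fibre G (gdom G \<eta>)" using \<eta> by (simp add: dom_fibre_iff)
  have "convolution G ?u a \<eta> = (\<Sum>\<sigma>\<in>{}. ?u (quot \<eta> \<sigma>) * a \<sigma>)"
  proof (rule convolution_eq_sum[OF \<eta>])
    fix \<sigma> assume \<sigma>: "\<sigma> \<in> dom_fibre G (gdom G \<eta>)"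
    show "?u (quot \<eta> \<sigma>) * a \<sigma> = 0"
    proof (rule ccontr)
      assume nz: "?u (quot \<eta> \<sigma>) * a \<sigma> \<noteq> 0"
      then have \<sigma>B: "\<sigma> \<in> B" using a(2) by auto
      have "?u (quot \<eta> \<sigma>) = adj a (quot \<eta> \<sigma>) * f (gdom G (quot \<eta> \<sigma>))"
        by (rule convolution_right_units[OF quot_closed[OF \<eta>f \<sigma>]]) (use Cu_outside[OF f] in auto)
      then have "a (quot \<sigma> \<eta>) \<noteq> 0" using nz inv_quot[OF \<eta>f \<sigma>] by (auto simp: adj_def split: if_splits)
      then have "quot \<sigma> \<eta> \<in> B" using a(2) by blast
      then have "quot \<sigma> \<eta> = \<sigma>"
        using \<sigma>B B ran_quot[OF \<sigma> \<eta>f] by (auto simp: open_bisection_def dest: inj_onD)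
      then have "gmult G \<sigma> \<eta> = \<sigma>" "gran G \<eta> = gdom G \<sigma>" using quot_mult[OF \<sigma> \<eta>f] dom_quot[OF \<sigma> \<eta>f] by auto
      then have "\<eta> = gdom G \<sigma>"
        using inv_mult_cancel[of \<sigma> \<eta>] \<sigma> \<eta> by (simp add: composable_iff dom_fibre_iff gdom_def)
      then show False using assms \<sigma>B by blast
    qed
  qed auto
  then show ?thesis by simp
qed (simp add: convolution_outside)

text \<open>In the fibre over the domain of \<beta> only \<beta> lies in B, so the convolution has a
  single term.\<close>

lemma conjugate_bisection:
  assumes \<beta>: "\<beta> \<in> B"
  shows "convolution G (convolution G (adj a) f) a (gdom G \<beta>) = (a \<beta>)\<^sup>2 * f (gran G \<beta>)"
proof -
  let ?u = "convolution G (adj a) f" and ?x = "gdom G \<beta>"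
  have \<beta>A: "\<beta> \<in> arrows G" using bisection_arrows[OF B \<beta>] .
  have x: "?x \<in> units G" using dom_units[OF \<beta>A] .
  have f': "\<beta> \<in> dom_fibre G ?x" "?x \<in> dom_fibre G ?x" using \<beta>A dom_fibre_unit[OF x] by (auto simp: dom_fibre_iff)
  have "convolution G ?u a ?x = (\<Sum>\<sigma>\<in>{\<beta>}. ?u (quot ?x \<sigma>) * a \<sigma>)"
  proof (rule convolution_eq_sum[OF units_arrows[OF x]])
    fix \<sigma> assume \<sigma>: "\<sigma> \<in> dom_fibre G (gdom G ?x)" "\<sigma> \<notin> {\<beta>}"
    then have "\<sigma> \<notin> B" using \<beta> B dom_unit[OF x] by (auto simp: open_bisection_def dom_fibre_iff dest: inj_onD)
    then show "?u (quot ?x \<sigma>) * a \<sigma> = 0" using a(2) by simp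
  qed (use f' dom_unit[OF x] in auto)
  moreover have "?u (ginv G \<beta>) = adj a (ginv G \<beta>) * f (gdom G (ginv G \<beta>))"
    by (rule convolution_right_units[OF inv_closed[OF \<beta>A]]) (use Cu_outside[OF f] in auto)
  ultimately show ?thesis
    using unit_quot[OF x f'(1)] \<beta>A by (simp add: adj_def inv_inv inv_closed dom_inv power2_eq_square)
qed

lemma conjugate_bisection_Cu: "convolution G (convolution G (adj a) f) a \<in> Cu"
  unfolding Cu_def
proof (intro CollectI conjI convolution_Cc adj_Cc a Cu_Cc f allI impI)
  fix \<gamma> assume nz: "convolution G (convolution G (adj a) f) a \<gamma> \<noteq> 0"
  have "\<gamma> \<in> gdom G ` B"
    by (rule ccontr) (use conjugate_bisection_zero[of \<gamma>] nz in simp)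
  then show "\<gamma> \<in> units G" using chart.bisection_dom_units[OF B] by blast
qed

end

lemma bisection_realizable:
  assumes B: "open_bisection G B" "B \<noteq> {}" and a: "a \<in> Cc G" "\<And>\<gamma>. a \<gamma> \<in> \<real>\<^sub>\<ge>\<^sub>0" "\<And>\<gamma>. a \<gamma> \<noteq> 0 \<longleftrightarrow> \<gamma> \<in> B"
  shows "chart.\<tau> B \<in> realizable_homeos FpA"
proof -
  define b where "b = adj a"
  have b: "b \<in> Cc G" and ab: "adj b = a" using adj_Cc[OF a(1)] adj_adj[OF a(1)] by (simp_all add: b_def)
  let ?B = "ginv G ` B"
  have B': "open_bisection G ?B" by (rule inv_bisection[OF B(1)])
  have BA: "\<beta> \<in> arrows G" if "\<beta> \<in> B" for \<beta> using bisection_arrows[OF B(1) that] .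
  have b_inv: "b (ginv G \<beta>) = a \<beta>" if "\<beta> \<in> B" for \<beta> using BA[OF that] by (simp add: b_def adj_def inv_closed inv_inv)
  have aB: "\<gamma> \<notin> B \<Longrightarrow> a \<gamma> = 0" for \<gamma> using a(3) by blast
  have bB: "b \<gamma> = 0" if "\<gamma> \<notin> ?B" for \<gamma>
    using that aB[of "ginv G \<gamma>"] inv_inv by (auto simp: b_def adj_def image_iff) metis
  have ne: "units G \<noteq> {}" using B BA dom_units by blast
  have domB: "gdom G ` ?B = gran G ` B" using BA dom_inv by (auto simp: image_iff)
  define P where "P f = convolution G (convolution G b f) a" for f
  \<comment> \<open>Q is the conjugation P for the inverse bisection, since
    \<open>adj b = a\<close>; every fact about Q is the corresponding one about P with domain and
    range exchanged.\<close>
  define Q where "Q f = convolution G (convolution G a f) b" for f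
  have P: "P f \<in> Cu" "\<And>\<beta>. \<beta> \<in> B \<Longrightarrow> P f (gdom G \<beta>) = (a \<beta>)\<^sup>2 * f (gran G \<beta>)"
    "\<And>\<eta>. \<eta> \<notin> gdom G ` B \<Longrightarrow> P f \<eta> = 0" if f: "f \<in> Cu" for f
    using conjugate_bisection_Cu[OF B(1) a(1) aB f] conjugate_bisection[OF B(1) a(1) aB f]
      conjugate_bisection_zero[OF B(1) a(1) aB f] by (auto simp: P_def b_def)
  have Q: "Q f \<in> Cu" "\<And>\<beta>. \<beta> \<in> B \<Longrightarrow> Q f (gran G \<beta>) = (a \<beta>)\<^sup>2 * f (gdom G \<beta>)"
    "\<And>\<eta>. \<eta> \<notin> gran G ` B \<Longrightarrow> Q f \<eta> = 0" if f: "f \<in> Cu" for f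
  proof -
    show "Q f \<in> Cu" using conjugate_bisection_Cu[OF B' b bB f] by (simp add: Q_def ab)
    show "Q f (gran G \<beta>) = (a \<beta>)\<^sup>2 * f (gdom G \<beta>)" if "\<beta> \<in> B" for \<beta>
      using conjugate_bisection[OF B' b bB f, of "ginv G \<beta>"] that BA[OF that] b_inv[OF that]
      by (simp add: Q_def ab dom_inv ran_inv)
    show "Q f \<eta> = 0" if "\<eta> \<notin> gran G ` B" for \<eta>
      using conjugate_bisection_zero[OF B' b bB f, of \<eta>] that domB by (simp add: Q_def ab)
  qed
  have embP: "emb b \<otimes>\<^bsub>FpA\<^esub> emb f \<otimes>\<^bsub>FpA\<^esub> emb a = emb (P f)"
    and embQ: "emb a \<otimes>\<^bsub>FpA\<^esub> emb f \<otimes>\<^bsub>FpA\<^esub> emb b = emb (Q f)" if "f \<in> Cu" for f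
    using a(1) b that by (simp_all add: emb_mult Cu_Cc convolution_Cc P_def Q_def)
  let ?o = "\<lambda>\<gamma>. if \<gamma> \<in> units G then 1 else 0 :: complex"
  \<comment> \<open>The products b a and a b are the conjugates of the unit function, which reduces
    the description of domain and range to P and Q at 1.\<close>
  have ba: "emb b \<otimes>\<^bsub>FpA\<^esub> emb a = emb (P ?o)" and ba': "emb a \<otimes>\<^bsub>FpA\<^esub> emb b = emb (Q ?o)"
    using embP[OF Cu_one] embQ[OF Cu_one] A.r_one[OF emb_carrier[OF b]] A.r_one[OF emb_carrier[OF a(1)]]
    by (simp_all add: one_FpA)
  have a2: "Re ((a \<beta>)\<^sup>2) > 0" "(a \<beta>)\<^sup>2 \<in> \<real>\<^sub>\<ge>\<^sub>0" if \<beta>: "\<beta> \<in> B" for \<beta>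
    using a(2)[of \<beta>] a(3)[of \<beta>] \<beta> by (auto simp: power2_eq_square elim!: nonneg_Reals_cases)
  have du: "gdom G \<beta> \<in> units G" "gran G \<beta> \<in> units G" if "\<beta> \<in> B" for \<beta>
    using BA[OF that] dom_units ran_units by auto
  have posP: "P f x \<in> \<real>\<^sub>\<ge>\<^sub>0" if "f \<in> Cu" "\<And>x. x \<in> units G \<Longrightarrow> f x \<in> \<real>\<^sub>\<ge>\<^sub>0" for f x
    using P[OF that(1)] a2 that(2) du by (cases "x \<in> gdom G ` B") (auto intro: nonneg_Reals_mult_I)
  have posQ: "Q f x \<in> \<real>\<^sub>\<ge>\<^sub>0" if "f \<in> Cu" "\<And>x. x \<in> units G \<Longrightarrow> f x \<in> \<real>\<^sub>\<ge>\<^sub>0" for f x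
    using Q[OF that(1)] a2 that(2) du by (cases "x \<in> gran G ` B") (auto intro: nonneg_Reals_mult_I)
  have Po: "P ?o (gdom G \<beta>) = (a \<beta>)\<^sup>2" "Q ?o (gran G \<beta>) = (a \<beta>)\<^sup>2" if "\<beta> \<in> B" for \<beta>
    using P(2)[OF Cu_one that] Q(2)[OF Cu_one that] du[OF that] by auto
  have "realized_by FpA (chart.\<tau> B) (emb a) (emb b)"
    unfolding realized_by_def
  proof (intro conjI ballI)
    fix F assume "F \<in> core_pos FpA"
    then obtain f where f: "f \<in> Cu" "F = emb f" "\<And>x. x \<in> units G \<Longrightarrow> f x \<in> \<real>\<^sub>\<ge>\<^sub>0"
      using core_pos_cases[OF _ ne] by metis
    show "emb a \<otimes>\<^bsub>FpA\<^esub> F \<otimes>\<^bsub>FpA\<^esub> emb b \<in> core_pos FpA"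
      unfolding f(2) embQ[OF f(1)] using Q(1) posQ f ne by (intro core_pos_emb) auto
    show "emb b \<otimes>\<^bsub>FpA\<^esub> F \<otimes>\<^bsub>FpA\<^esub> emb a \<in> core_pos FpA"
      unfolding f(2) embP[OF f(1)] using P(1) posP f ne by (intro core_pos_emb) auto
  next
    show "dom (chart.\<tau> B) = {\<phi> \<in> characters FpA. 0 < Re (\<phi> (emb b \<otimes>\<^bsub>FpA\<^esub> emb a))}"
      unfolding chart.dom_\<tau>[OF B(1)] ba characters_eq
    proof (intro subset_antisym subsetI)
      fix \<phi> assume "\<phi> \<in> {\<phi> \<in> ev ` units G. 0 < Re (\<phi> (emb (P ?o)))}"
      then obtain x where x: "x \<in> units G" "\<phi> = ev x" "0 < Re (P ?o x)" using ev_emb P(1)[OF Cu_one] by auto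
      then have "x \<in> gdom G ` B" using P(3)[OF Cu_one, of x] by force
      then show "\<phi> \<in> ev ` gdom G ` B" using x(2) by blast
    qed (use du ev_emb P(1)[OF Cu_one] Po a2 in auto)
    show "ran (chart.\<tau> B) = {\<phi> \<in> characters FpA. 0 < Re (\<phi> (emb a \<otimes>\<^bsub>FpA\<^esub> emb b))}"
      unfolding chart.ran_\<tau>[OF B(1)] ba' characters_eq
    proof (intro subset_antisym subsetI)
      fix \<phi> assume "\<phi> \<in> {\<phi> \<in> ev ` units G. 0 < Re (\<phi> (emb (Q ?o)))}"
      then obtain x where x: "x \<in> units G" "\<phi> = ev x" "0 < Re (Q ?o x)" using ev_emb Q(1)[OF Cu_one] by auto
      then have "x \<in> gran G ` B" using Q(3)[OF Cu_one, of x] by force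
      then show "\<phi> \<in> ev ` gran G ` B" using x(2) by blast
    qed (use du ev_emb Q(1)[OF Cu_one] Po a2 in auto)
  next
    fix \<phi> F assume "\<phi> \<in> dom (chart.\<tau> B)" and F: "F \<in> core_C0 FpA (ran (chart.\<tau> B))"
    then obtain \<beta> where \<beta>: "\<beta> \<in> B" "\<phi> = ev (gdom G \<beta>)" by (auto simp: chart.dom_\<tau>[OF B(1)])
    obtain f where f: "f \<in> Cu" "F = emb f" using F by (auto simp: core_C0_def core_eq[OF ne])
    show "the (chart.\<tau> B \<phi>) F * \<phi> (emb b \<otimes>\<^bsub>FpA\<^esub> emb a) = \<phi> (emb b \<otimes>\<^bsub>FpA\<^esub> F \<otimes>\<^bsub>FpA\<^esub> emb a)"
      unfolding \<beta>(2) f(2) ba embP[OF f(1)] chart.\<tau>_apply[OF B(1) \<beta>(1)]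
      using ev_emb[OF du(1)[OF \<beta>(1)] P(1)[OF Cu_one]] ev_emb[OF du(1)[OF \<beta>(1)] P(1)[OF f(1)]]
        ev_emb[OF du(2)[OF \<beta>(1)] f(1)] Po[OF \<beta>(1)] P(2)[OF f(1) \<beta>(1)] by simp
  next
    fix \<phi> F assume "\<phi> \<in> ran (chart.\<tau> B)" and F: "F \<in> core_C0 FpA (dom (chart.\<tau> B))"
    then obtain \<beta> where \<beta>: "\<beta> \<in> B" "\<phi> = ev (gran G \<beta>)" by (auto simp: chart.ran_\<tau>[OF B(1)])
    obtain f where f: "f \<in> Cu" "F = emb f" using F by (auto simp: core_C0_def core_eq[OF ne])
    show "the (pinv (chart.\<tau> B) \<phi>) F * \<phi> (emb a \<otimes>\<^bsub>FpA\<^esub> emb b) = \<phi> (emb a \<otimes>\<^bsub>FpA\<^esub> F \<otimes>\<^bsub>FpA\<^esub> emb b)"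
      unfolding \<beta>(2) f(2) ba' embQ[OF f(1)] chart.pinv_\<tau>[OF B(1) \<beta>(1)]
      using ev_emb[OF du(2)[OF \<beta>(1)] Q(1)[OF Cu_one]] ev_emb[OF du(2)[OF \<beta>(1)] Q(1)[OF f(1)]]
        ev_emb[OF du(1)[OF \<beta>(1)] f(1)] Po[OF \<beta>(1)] Q(2)[OF f(1) \<beta>(1)] by simp
  qed
  then show ?thesis
    using chart.\<tau>_partial_homeo[OF B(1)] emb_carrier[OF a(1)] emb_carrier[OF b] by (auto simp: realizable_homeos_def)
qed

text \<open>An arbitrary bisection may carry no compactly supported function that is nonzero on all
  of it. A bump function at the domain of \<gamma>, transferred to B along \<open>gdom\<close>, has
  a nonvanishing set B' around \<gamma>, and B' is realizable.\<close>

lemma bisection_locally_realizable: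
  assumes B: "open_bisection G B" and \<gamma>: "\<gamma> \<in> B"
  obtains B' where "open_bisection G B'" "\<gamma> \<in> B'" "B' \<subseteq> B" "chart.\<tau> B' \<in> realizable_homeos FpA"
proof -
  let ?D = "gdom G ` B"
  have x: "gdom G \<gamma> \<in> units G" using chart.bisection_dom_units[OF B \<gamma>] .
  have Du: "?D \<subseteq> units G" using chart.bisection_dom_units[OF B] by blast
  have "openin (unit_space G) ?D" using open_dom[OF bisection_open[OF B]] Du by (simp add: openin_unit_space)
  then have "closedin (unit_space G) (units G - ?D)" by (metis openin_closedin_eq topspace_unit_space)
  then obtain f where f: "f \<in> Cu" "f (gdom G \<gamma>) = 1" "\<And>y. y \<in> units G - ?D \<Longrightarrow> f y = 0"
    using separate_point_closed[OF x] \<gamma> by (metis DiffD2 imageI)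
  \<comment> \<open>The value at the domain of \<gamma> is 1, and k vanishes where
    \<open>Re (f y) < 1/2\<close>. So its support lies in the closed set K, which is compact and
    contained in ?D because f is 0 off ?D; f itself would be nonzero up to the boundary.\<close>
  define k where "k y = max (2 * Re (f y) - 1) 0" for y
  have "continuous_map (unit_space G) euclidean f" by (rule Cu_continuous[OF f(1)])
  then have Ref: "continuous_map (unit_space G) euclideanreal (\<lambda>y. Re (f y))"
    by (simp add: continuous_map_atin tendsto_Re)
  then have ck: "continuous_map (unit_space G) euclideanreal k"
    unfolding k_def by (intro continuous_map_real_max continuous_map_diff continuous_map_real_mult_left) auto
  define K where "K = {y \<in> units G. Re (f y) \<in> {1/2..}}"
  have "closedin (unit_space G) K"
    unfolding K_def using closedin_continuous_map_preimage[OF Ref, of "{1/2..}"] by (simp add: topspace_unit_space)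
  then have "compactin (unit_space G) K" by (rule closedin_compact_space[OF compact])
  then have "compactin (gtop G) K" by (simp add: unit_space_def compactin_subtopology)
  moreover have KD: "K \<subseteq> ?D" using f(3) by (force simp: K_def)
  ultimately have "compactin (subtopology (gtop G) ?D) K" by (simp add: compactin_subtopology)
  then have K': "compactin (gtop G) (sec B ` K)" by (rule image_compactin[OF _ continuous_sec[OF B]])
  define a where "a \<beta> = (if \<beta> \<in> B then complex_of_real (k (gdom G \<beta>)) else 0)" for \<beta>
  have supp: "\<beta> \<in> sec B ` K" if "a \<beta> \<noteq> 0" for \<beta>
  proof -
    have \<beta>: "\<beta> \<in> B" "k (gdom G \<beta>) \<noteq> 0" using that by (auto simp: a_def split: if_splits)
    then have "gdom G \<beta> \<in> K" using Du by (auto simp: K_def k_def)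
    then show ?thesis using sec_dom[OF B \<beta>(1)] by (metis imageI)
  qed
  have aCc: "a \<in> Cc G"
  proof (rule CcI[OF _ _ K' supp])
    show "continuous_map (gtop G) euclidean a"
    proof (rule continuous_map_locally)
      fix \<beta> assume \<beta>: "\<beta> \<in> arrows G"
      have "continuous_map (gtop G) (unit_space G) (gdom G)"
        unfolding unit_space_def using dom_units by (intro continuous_map_into_subtopology continuous_dom) auto
      from continuous_map_compose[OF this ck] have "continuous_map (gtop G) euclideanreal (\<lambda>\<beta>. k (gdom G \<beta>))"
        by (simp add: o_def)
      then have "continuous_map (gtop G) euclidean (\<lambda>\<beta>. complex_of_real (k (gdom G \<beta>)))"
        by (simp add: continuous_map_atin tendsto_of_real)
      then have 1: "continuous_map (subtopology (gtop G) B) euclidean a"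
        by (rule continuous_map_eq[OF continuous_map_from_subtopology]) (auto simp: a_def)
      have 2: "continuous_map (subtopology (gtop G) (arrows G - sec B ` K)) euclidean a"
        by (rule continuous_map_eq[of _ _ "\<lambda>_. 0"]) (use supp in auto)
      have 3: "openin (gtop G) (arrows G - sec B ` K)"
        using compactin_imp_closedin[OF Hausdorff K'] by (simp add: closedin_def)
      show "\<exists>U. openin (gtop G) U \<and> \<beta> \<in> U \<and> continuous_map (subtopology (gtop G) U) euclidean a"
      proof (cases "\<beta> \<in> B")
        case True
        then show ?thesis using 1 bisection_open[OF B] by blast
      next
        case False
        then have "\<beta> \<notin> sec B ` K" using sec_in KD by blast
        then show ?thesis using 2 3 \<beta> by blast
      qed
    qed
    show "a \<beta> = 0" if "\<beta> \<notin> arrows G" for \<beta> using that bisection_arrows[OF B] by (auto simp: a_def)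
  qed
  define B' where "B' = B \<inter> {\<beta> \<in> arrows G. a \<beta> \<in> - {0}}"
  have B': "open_bisection G B'"
    unfolding B'_def using openin_continuous_map_preimage[OF Cc_continuous[OF aCc], of "- {0}"]
    by (intro bisection_Int[OF B]) (simp add: open_Compl)
  have \<gamma>': "\<gamma> \<in> B'" using \<gamma> f(2) bisection_arrows[OF B \<gamma>] by (simp add: B'_def a_def k_def)
  have "chart.\<tau> B' \<in> realizable_homeos FpA"
  proof (rule bisection_realizable[OF B' _ aCc])
    show "B' \<noteq> {}" using \<gamma>' by blast
    show "a \<beta> \<in> \<real>\<^sub>\<ge>\<^sub>0" for \<beta> by (simp add: a_def k_def)
    show "a \<beta> \<noteq> 0 \<longleftrightarrow> \<beta> \<in> B'" for \<beta> using bisection_arrows[OF B] by (auto simp: B'_def a_def)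
  qed
  then show thesis using that[OF B' \<gamma>'] by (auto simp: B'_def)
qed

end

section \<open>Germs of bisections\<close>

lemma germ_cong:
  assumes "openin X W" "x \<in> W" "\<And>w. w \<in> W \<Longrightarrow> s w = s' w"
  shows "germ X S s x = germ X S s' x"
proof -
  have sub: "germ X S u x \<subseteq> germ X S v x" if uv: "\<And>w. w \<in> W \<Longrightarrow> u w = v w" for u v
  proof
    fix z assume "z \<in> germ X S u x"
    then obtain t W' where z: "z = (t, x)" "t \<in> S" "x \<in> dom t" "openin X W'" "x \<in> W'" "\<forall>w\<in>W'. u w = t w"
      by (auto simp: germ_def)
    have "openin X (W \<inter> W')" "x \<in> W \<inter> W'" "\<forall>w\<in>W \<inter> W'. v w = t w"
      using z assms(1,2) uv by auto
    then show "z \<in> germ X S v x" using z unfolding germ_def by blast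
  qed
  show ?thesis using sub[of s s'] sub[of s' s] assms(3) by auto
qed

text \<open>\<open>S_local\<close> and \<open>S_cover\<close> are the two outcomes of the analysis
  of the algebra; the rest concerns germs only. \<open>S_cover\<close> asks for a smaller bisection
  because realizability is obtained after shrinking to the nonvanishing set of a bump
  function.\<close>

locale realizable_chart = unit_space_chart +
  fixes S
  assumes S_partial_homeos: "S \<subseteq> partial_homeos X"
    and S_local: "s \<in> S \<Longrightarrow> x \<in> units G \<Longrightarrow> h x \<in> dom s \<Longrightarrow> \<exists>B \<sigma>. open_bisection G B \<and> \<sigma> \<in> B \<and>
      gdom G \<sigma> = x \<and> (\<forall>\<beta>\<in>B. s (h (gdom G \<beta>)) = Some (h (gran G \<beta>)))"
    and S_cover: "open_bisection G B \<Longrightarrow> \<gamma> \<in> B \<Longrightarrow>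
      \<exists>B'. open_bisection G B' \<and> \<gamma> \<in> B' \<and> B' \<subseteq> B \<and> \<tau> B' \<in> S"
    and principal: "topologically_principal G"
begin

text \<open>\<open>germ\<close> is defined for every partial map, so the chosen bisection may well
  induce a map outside S; by \<open>germ_bisection\<close> the choice does not affect the
  value.\<close>

definition \<Phi> :: "'a \<Rightarrow> (('b \<rightharpoonup> 'b) \<times> 'b) set" where
  "\<Phi> \<gamma> = germ X S (\<tau> (SOME B. open_bisection G B \<and> \<gamma> \<in> B)) (h (gdom G \<gamma>))"

lemma h_open_image_dom: "open_bisection G B \<Longrightarrow> openin X (h ` gdom G ` B)"
  using open_dom[OF bisection_open] bisection_dom_units by (intro h_open) auto

lemma bisection_exists: "\<gamma> \<in> arrows G \<Longrightarrow> \<exists>B. open_bisection G B \<and> \<gamma> \<in> B"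
  using bisection_basis[OF openin_topspace] by metis

text \<open>t and the map of the chosen bisection agree on the image of the intersection of both
  bisections. Stating this for arbitrary t makes it apply to composites and inverses of members of
  S.\<close>

lemma germ_bisection:
  assumes B: "open_bisection G B" "\<gamma> \<in> B" and t: "\<And>\<beta>. \<beta> \<in> B \<Longrightarrow> t (h (gdom G \<beta>)) = Some (h (gran G \<beta>))"
  shows "germ X S t (h (gdom G \<gamma>)) = \<Phi> \<gamma>"
proof -
  define B' where "B' = (SOME B. open_bisection G B \<and> \<gamma> \<in> B)"
  have B': "open_bisection G B'" "\<gamma> \<in> B'"
    using someI[of "\<lambda>B. open_bisection G B \<and> \<gamma> \<in> B" B] B by (auto simp: B'_def)
  have BB: "open_bisection G (B \<inter> B')" by (rule bisection_Int[OF B(1) bisection_open[OF B'(1)]])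
  show ?thesis unfolding \<Phi>_def B'_def[symmetric]
  proof (rule germ_cong[OF h_open_image_dom[OF BB]])
    show "h (gdom G \<gamma>) \<in> h ` gdom G ` (B \<inter> B')" using B(2) B'(2) by blast
    fix w assume "w \<in> h ` gdom G ` (B \<inter> B')"
    then show "t w = \<tau> B' w" using t \<tau>_apply[OF B'(1)] by auto
  qed
qed

lemma \<Phi>_bisection: "open_bisection G B \<Longrightarrow> \<gamma> \<in> B \<Longrightarrow> \<Phi> \<gamma> = germ X S (\<tau> B) (h (gdom G \<gamma>))"
  using germ_bisection[of B \<gamma> "\<tau> B"] \<tau>_apply by simp

text \<open>Agreement of t with \<tau> B on a neighbourhood in X is pulled back along
  \<open>gdom\<close> and h; shrinking B accordingly yields a bisection on which t acts
  exactly.\<close>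

lemma \<Phi>_memD:
  assumes \<gamma>: "\<gamma> \<in> arrows G" and t: "(t, y) \<in> \<Phi> \<gamma>"
  obtains B where "t \<in> S" "y = h (gdom G \<gamma>)" "open_bisection G B" "\<gamma> \<in> B"
    "\<And>\<beta>. \<beta> \<in> B \<Longrightarrow> t (h (gdom G \<beta>)) = Some (h (gran G \<beta>))"
proof -
  obtain B where B: "open_bisection G B" "\<gamma> \<in> B" using bisection_exists[OF \<gamma>] by blast
  then obtain W where tS: "t \<in> S" and y: "y = h (gdom G \<gamma>)"
    and W: "openin X W" "y \<in> W" "\<And>w. w \<in> W \<Longrightarrow> \<tau> B w = t w"
    using t by (auto simp: \<Phi>_bisection germ_def)
  define B' where "B' = B \<inter> {\<beta> \<in> arrows G. gdom G \<beta> \<in> {x \<in> units G. h x \<in> W}}"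
  have B': "open_bisection G B'" unfolding B'_def
    by (intro bisection_Int[OF B(1)] openin_continuous_map_preimage[OF continuous_dom] h_open_preimage W)
  show thesis
  proof (rule that[OF tS y B'])
    show "\<gamma> \<in> B'" using B(2) \<gamma> dom_units W(2) y by (auto simp: B'_def)
    fix \<beta> assume "\<beta> \<in> B'"
    then show "t (h (gdom G \<beta>)) = Some (h (gran G \<beta>))"
      using W(3) \<tau>_apply[OF B(1), of \<beta>] by (auto simp: B'_def)
  qed
qed

text \<open>Products and inverses in the germ groupoid are computed from \<open>rep\<close>, an
  arbitrary member of the class. The class is nonempty by \<open>S_cover\<close>, and any member is
  described near \<gamma> by a bisection.\<close>

lemma \<Phi>_rep:
  assumes \<gamma>: "\<gamma> \<in> arrows G"
  obtains t B where "rep (\<Phi> \<gamma>) = (t, h (gdom G \<gamma>))" "t \<in> S" "open_bisection G B" "\<gamma> \<in> B"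
    "\<And>\<beta>. \<beta> \<in> B \<Longrightarrow> t (h (gdom G \<beta>)) = Some (h (gran G \<beta>))"
proof -
  obtain B0 where "open_bisection G B0" "\<gamma> \<in> B0" using bisection_exists[OF \<gamma>] by blast
  then obtain B where B: "open_bisection G B" "\<gamma> \<in> B" "\<tau> B \<in> S" using S_cover by blast
  have "(\<tau> B, h (gdom G \<gamma>)) \<in> \<Phi> \<gamma>"
    unfolding \<Phi>_bisection[OF B(1,2)] germ_def using B h_open_image_dom[OF B(1)] dom_\<tau>[OF B(1)] by blast
  then have "rep (\<Phi> \<gamma>) \<in> \<Phi> \<gamma>" unfolding rep_def by (rule someI[where P = "\<lambda>z. z \<in> \<Phi> \<gamma>"])
  then obtain t y where ty: "rep (\<Phi> \<gamma>) = (t, y)" "(t, y) \<in> \<Phi> \<gamma>" by (metis surj_pair)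
  show thesis
    by (rule \<Phi>_memD[OF \<gamma> ty(2)]) (rule that, use ty(1) in auto)
qed

section \<open>Compatibility with the groupoid operations\<close>

abbreviation "H \<equiv> germ_groupoid X S"

lemma \<Phi>_inv:
  assumes \<gamma>: "\<gamma> \<in> arrows G" shows "ginv H (\<Phi> \<gamma>) = \<Phi> (ginv G \<gamma>)"
proof -
  obtain t B where t: "rep (\<Phi> \<gamma>) = (t, h (gdom G \<gamma>))" "t \<in> S" and B: "open_bisection G B" "\<gamma> \<in> B"
    and tB: "\<And>\<beta>. \<beta> \<in> B \<Longrightarrow> t (h (gdom G \<beta>)) = Some (h (gran G \<beta>))" using \<Phi>_rep[OF \<gamma>] by blast
  have "homeomorphic_map (subtopology X (dom t)) (subtopology X (ran t)) (the \<circ> t)" "openin X (dom t)"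
    using t(2) S_partial_homeos by (auto simp: partial_homeos_def)
  \<comment> \<open>\<open>pinv\<close> is a definite description over all of \<open>dom t\<close>,
    so injectivity of t on its whole domain is used, not only near \<gamma>.\<close>
  then have inj: "inj_on (the \<circ> t) (dom t)"
    using homeomorphic_imp_injective_map openin_subset by (metis inf.absorb2 topspace_subtopology)
  have pinv: "pinv t (h (gran G \<beta>)) = Some (h (gdom G \<beta>))" if "\<beta> \<in> B" for \<beta>
  proof -
    have "(THE x. t x = Some (h (gran G \<beta>))) = h (gdom G \<beta>)"
    proof (rule the_equality[where P = "\<lambda>x. t x = Some (h (gran G \<beta>))", OF tB[OF that]])
      fix x assume x: "t x = Some (h (gran G \<beta>))"
      show "x = h (gdom G \<beta>)" by (rule inj_onD[OF inj]) (use x tB[OF that] in \<open>auto simp: dom_def\<close>)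
    qed
    then show ?thesis using tB[OF that] by (auto simp: pinv_def ran_def)
  qed
  have "ginv H (\<Phi> \<gamma>) = germ X S (pinv t) (h (gdom G (ginv G \<gamma>)))"
    using t(1) tB[OF B(2)] dom_inv[OF \<gamma>] by (simp add: germ_groupoid_def)
  also have "\<dots> = \<Phi> (ginv G \<gamma>)"
  proof (rule germ_bisection[OF inv_bisection[OF B(1)]])
    fix \<beta>' assume "\<beta>' \<in> ginv G ` B"
    then show "pinv t (h (gdom G \<beta>')) = Some (h (gran G \<beta>'))"
      using pinv bisection_arrows[OF B(1)] by (auto simp: dom_inv ran_inv)
  qed (use B(2) in blast)
  finally show ?thesis .
qed

text \<open>Arrows \<zeta>' near the product factor continuously as \<open>q \<zeta>'\<close> times
  the arrow of B' over the domain of \<zeta>'. Where \<open>q \<zeta>'\<close> lies in B, the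
  composite of s and t sends domain to range of \<zeta>', so it acts like a bisection through the
  product.\<close>

lemma \<Phi>_mult:
  assumes "(\<gamma>, \<eta>) \<in> composable G" shows "gmult H (\<Phi> \<gamma>) (\<Phi> \<eta>) = \<Phi> (gmult G \<gamma> \<eta>)"
proof -
  have A: "\<gamma> \<in> arrows G" "\<eta> \<in> arrows G" "gdom G \<gamma> = gran G \<eta>" using assms by (auto simp: composable_iff)
  obtain s B where s: "rep (\<Phi> \<gamma>) = (s, h (gdom G \<gamma>))" "s \<in> S" and B: "open_bisection G B" "\<gamma> \<in> B"
    and sB: "\<And>\<beta>. \<beta> \<in> B \<Longrightarrow> s (h (gdom G \<beta>)) = Some (h (gran G \<beta>))" using \<Phi>_rep[OF A(1)] by blast
  obtain t B' where t: "rep (\<Phi> \<eta>) = (t, h (gdom G \<eta>))" "t \<in> S" and B': "open_bisection G B'" "\<eta> \<in> B'"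
    and tB: "\<And>\<beta>. \<beta> \<in> B' \<Longrightarrow> t (h (gdom G \<beta>)) = Some (h (gran G \<beta>))" using \<Phi>_rep[OF A(2)] by blast
  let ?\<zeta> = "gmult G \<gamma> \<eta>"
  have \<zeta>: "?\<zeta> \<in> arrows G" "gdom G ?\<zeta> = gdom G \<eta>" using mult_closed[OF assms] dom_mult[OF assms] by auto
  define D where "D = {\<zeta> \<in> arrows G. gdom G \<zeta> \<in> gdom G ` B'}"
  have D: "openin (gtop G) D" unfolding D_def
    by (rule openin_continuous_map_preimage[OF continuous_dom open_dom[OF bisection_open[OF B'(1)]]])
  have tD: "topspace (subtopology (gtop G) D) = D" by (auto simp: D_def)
  define q where "q \<zeta> = quot \<zeta> (sec B' (gdom G \<zeta>))" for \<zeta>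
  have fib: "\<zeta> \<in> dom_fibre G (gdom G \<zeta>)" "sec B' (gdom G \<zeta>) \<in> dom_fibre G (gdom G \<zeta>)" "sec B' (gdom G \<zeta>) \<in> B'"
    if "\<zeta> \<in> D" for \<zeta>
    using that sec_in[of "gdom G \<zeta>" B'] dom_sec[of "gdom G \<zeta>" B'] bisection_arrows[OF B'(1)]
    by (auto simp: D_def dom_fibre_iff)
  have "continuous_map (subtopology (gtop G) D) (gtop G) q"
    unfolding q_def quot_def
  proof (rule continuous_mult_pair)
    show "continuous_map (subtopology (gtop G) D) (gtop G) (\<lambda>\<zeta>. \<zeta>)"
      by (rule continuous_map_from_subtopology) simp
    have "continuous_map (subtopology (gtop G) D) (subtopology (gtop G) (gdom G ` B')) (gdom G)"
      by (intro continuous_map_into_subtopology continuous_map_from_subtopology continuous_dom) (auto simp: D_def)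
    from continuous_map_compose[OF continuous_map_compose[OF this continuous_sec[OF B'(1)]] continuous_inv]
    show "continuous_map (subtopology (gtop G) D) (gtop G) (\<lambda>\<zeta>. ginv G (sec B' (gdom G \<zeta>)))" by (simp add: o_def)
    show "gdom G \<zeta> = gran G (ginv G (sec B' (gdom G \<zeta>)))" if "\<zeta> \<in> topspace (subtopology (gtop G) D)" for \<zeta>
      using fib(2)[of \<zeta>] that by (auto simp: tD dom_fibre_iff ran_inv)
  qed
  then have "openin (subtopology (gtop G) D) {\<zeta> \<in> D. q \<zeta> \<in> B}"
    using openin_continuous_map_preimage[OF _ bisection_open[OF B(1)]] tD by fastforce
  then have "openin (gtop G) {\<zeta> \<in> D. q \<zeta> \<in> B}" using openin_open_subtopology[OF D] by blast
  moreover have "?\<zeta> \<in> {\<zeta> \<in> D. q \<zeta> \<in> B}"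
    using \<zeta> B B' sec_dom[OF B'] mult_inv_cancel[OF assms] by (auto simp: D_def q_def quot_def)
  ultimately obtain C where C: "open_bisection G C" "?\<zeta> \<in> C" "C \<subseteq> {\<zeta> \<in> D. q \<zeta> \<in> B}" by (rule bisection_basis)
  have "gmult H (\<Phi> \<gamma>) (\<Phi> \<eta>) = germ X S (s \<circ>\<^sub>m t) (h (gdom G ?\<zeta>))"
    using s(1) t(1) \<zeta>(2) by (simp add: germ_groupoid_def)
  also have "\<dots> = \<Phi> ?\<zeta>"
  proof (rule germ_bisection[OF C(1,2)])
    fix \<zeta>' assume "\<zeta>' \<in> C"
    then have \<zeta>': "\<zeta>' \<in> D" "q \<zeta>' \<in> B" using C(3) by auto
    note f = fib[OF \<zeta>'(1)]
    have "t (h (gdom G \<zeta>')) = Some (h (gran G (sec B' (gdom G \<zeta>'))))"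
      using tB[OF f(3)] f(2) by (simp add: dom_fibre_iff)
    moreover have "s (h (gran G (sec B' (gdom G \<zeta>')))) = Some (h (gran G \<zeta>'))"
      using sB[OF \<zeta>'(2)] dom_quot[OF f(1,2)] ran_quot[OF f(1,2)] by (simp add: q_def)
    ultimately show "(s \<circ>\<^sub>m t) (h (gdom G \<zeta>')) = Some (h (gran G \<zeta>'))" by (simp add: map_comp_def)
  qed
  finally show ?thesis .
qed

lemma \<Phi>_inj: "inj_on \<Phi> (arrows G)"
proof (rule inj_onI)
  fix \<gamma> \<eta> assume \<gamma>: "\<gamma> \<in> arrows G" and \<eta>: "\<eta> \<in> arrows G" and eq: "\<Phi> \<gamma> = \<Phi> \<eta>"
  obtain t B where t: "rep (\<Phi> \<gamma>) = (t, h (gdom G \<gamma>))" "t \<in> S" and B: "open_bisection G B" "\<gamma> \<in> B"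
    and tB: "\<And>\<beta>. \<beta> \<in> B \<Longrightarrow> t (h (gdom G \<beta>)) = Some (h (gran G \<beta>))" using \<Phi>_rep[OF \<gamma>] by blast
  obtain t' B' where t': "rep (\<Phi> \<eta>) = (t', h (gdom G \<eta>))" "t' \<in> S" and B': "open_bisection G B'" "\<eta> \<in> B'"
    and tB': "\<And>\<beta>. \<beta> \<in> B' \<Longrightarrow> t' (h (gdom G \<beta>)) = Some (h (gran G \<beta>))" using \<Phi>_rep[OF \<eta>] by blast
  \<comment> \<open>Equal classes have the same \<open>rep\<close>, so one partial map describes
    both arrows and the two bisections induce the same map wherever both are defined.\<close>
  have "t' = t" and "h (gdom G \<gamma>) = h (gdom G \<eta>)" using t(1) t'(1) eq by auto
  then have x: "gdom G \<gamma> = gdom G \<eta>" using h_inj dom_units \<gamma> \<eta> by blast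
  let ?W = "gdom G ` B \<inter> gdom G ` B'"
  have W: "openin (unit_space G) ?W"
    using open_dom bisection_open B(1) B'(1) bisection_dom_units[OF B(1)] by (auto simp: openin_unit_space)
  have c: "continuous_map (subtopology (unit_space G) ?W) (gtop G) (sec C)"
    if "open_bisection G C" "?W \<subseteq> gdom G ` C" for C
    using continuous_map_from_subtopology_mono[OF continuous_sec[OF that(1)], of "units G \<inter> ?W"] that(2)
    by (simp add: unit_space_def subtopology_subtopology le_infI2)
  \<comment> \<open>Over a unit with trivial isotropy an arrow is determined by its range, which t
    prescribes; density and continuity of both sections extend the equality to the domain of
    \<gamma>.\<close>
  have "sec B (gdom G \<gamma>) = sec B' (gdom G \<gamma>)"
  proof (rule continuous_maps_agree_dense[OF Hausdorff W _ c[OF B(1)] c[OF B'(1)]])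
    show "unit_space G closure_of {x \<in> units G. isotropy G x = {x}} = topspace (unit_space G)"
      using principal by (simp add: topologically_principal_def topspace_unit_space)
    show "gdom G \<gamma> \<in> ?W" using imageI[OF B(2), of "gdom G"] imageI[OF B'(2), of "gdom G"] x by simp
    fix w assume w: "w \<in> ?W" "w \<in> {x \<in> units G. isotropy G x = {x}}"
    have s: "sec B w \<in> B" "gdom G (sec B w) = w" "sec B' w \<in> B'" "gdom G (sec B' w) = w"
      using w sec_in dom_sec by auto
    then have "h (gran G (sec B w)) = h (gran G (sec B' w))"
      using tB[of "sec B w"] tB'[of "sec B' w"] \<open>t' = t\<close> by simp
    then have "gran G (sec B w) = gran G (sec B' w)"
      using h_inj s bisection_ran_units[OF B(1)] bisection_ran_units[OF B'(1)] by blast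
    then show "sec B w = sec B' w"
      using trivial_isotropy_unique[of w] w(2) s bisection_arrows[OF B(1)] bisection_arrows[OF B'(1)]
      by (simp add: dom_fibre_iff)
  qed auto
  then show "\<gamma> = \<eta>" using sec_dom[OF B] sec_dom[OF B'] x by metis
qed

section \<open>The topology of germs\<close>

definition basic_germs where
  "basic_germs s U V = {germ X S s x | x. x \<in> dom s \<and> x \<in> U \<and> the (s x) \<in> V}"

lemma gtop_H: "gtop H = topology_generated_by {basic_germs s U V | s U V. s \<in> S \<and> openin X U \<and> openin X V}"
  by (simp add: germ_groupoid_def basic_germs_def)

lemma S_image:
  assumes "s \<in> S" "x \<in> dom s" shows "x \<in> topspace X" "the (s x) \<in> topspace X"
proof -
  have ph: "openin X (dom s)" "openin X (ran s)" using assms(1) S_partial_homeos by (auto simp: partial_homeos_def)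
  show "x \<in> topspace X" using openin_subset[OF ph(1)] assms(2) by blast
  have "the (s x) \<in> ran s" using assms(2) by (auto simp: ran_def)
  then show "the (s x) \<in> topspace X" using openin_subset[OF ph(2)] by blast
qed

lemma germ_in_range:
  assumes "s \<in> S" "x \<in> dom s" shows "\<exists>\<sigma>\<in>arrows G. \<Phi> \<sigma> = germ X S s x"
proof -
  obtain u where u: "u \<in> units G" "x = h u" using S_image(1)[OF assms] topspace_X by blast
  then obtain B \<sigma> where B: "open_bisection G B" "\<sigma> \<in> B" "gdom G \<sigma> = u"
    "\<And>\<beta>. \<beta> \<in> B \<Longrightarrow> s (h (gdom G \<beta>)) = Some (h (gran G \<beta>))"
    using S_local[OF assms(1), of u] assms(2) by auto
  then show ?thesis using germ_bisection[of B \<sigma> s] bisection_arrows[OF B(1,2)] u(2) by auto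
qed

text \<open>For \<tau> B in S the right-hand side is one of the generating open sets. Since such
  bisections form a basis by \<open>S_cover\<close>, this makes \<Phi> an open map.\<close>

lemma \<Phi>_image_bisection:
  assumes B: "open_bisection G B" shows "\<Phi> ` B = basic_germs (\<tau> B) (topspace X) (topspace X)"
proof (intro subset_antisym subsetI)
  fix z assume "z \<in> \<Phi> ` B"
  then obtain \<beta> where \<beta>: "\<beta> \<in> B" "z = \<Phi> \<beta>" by blast
  then show "z \<in> basic_germs (\<tau> B) (topspace X) (topspace X)"
    unfolding basic_germs_def \<beta>(2) \<Phi>_bisection[OF B \<beta>(1)]
    using dom_\<tau>[OF B] \<tau>_apply[OF B \<beta>(1)] bisection_dom_units[OF B \<beta>(1)] bisection_ran_units[OF B \<beta>(1)]
    by (intro CollectI exI[of _ "h (gdom G \<beta>)"]) (auto simp: topspace_X)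
next
  fix z assume "z \<in> basic_germs (\<tau> B) (topspace X) (topspace X)"
  then obtain \<phi> where "\<phi> \<in> dom (\<tau> B)" "z = germ X S (\<tau> B) \<phi>" by (auto simp: basic_germs_def)
  then obtain \<beta> where "\<beta> \<in> B" "z = germ X S (\<tau> B) (h (gdom G \<beta>))" by (auto simp: dom_\<tau>[OF B])
  then show "z \<in> \<Phi> ` B" using \<Phi>_bisection[OF B] by blast
qed

lemma arrows_H: "arrows H = \<Phi> ` arrows G"
proof -
  have "arrows H = {germ X S s x | s x. s \<in> S \<and> x \<in> dom s}"
    unfolding gtop_H topology_generated_by_topspace
  proof (intro subset_antisym subsetI)
    fix z assume "z \<in> {germ X S s x | s x. s \<in> S \<and> x \<in> dom s}"
    then obtain s x where s: "z = germ X S s x" "s \<in> S" "x \<in> dom s" by blast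
    then have "z \<in> basic_germs s (topspace X) (topspace X)" using S_image unfolding basic_germs_def by blast
    then show "z \<in> \<Union> {basic_germs s U V | s U V. s \<in> S \<and> openin X U \<and> openin X V}"
      using s(2) openin_topspace by blast
  qed (auto simp: basic_germs_def)
  also have "\<dots> = \<Phi> ` arrows G"
  proof (intro subset_antisym subsetI)
    fix z assume "z \<in> {germ X S s x | s x. s \<in> S \<and> x \<in> dom s}"
    then show "z \<in> \<Phi> ` arrows G" using germ_in_range by fastforce
  next
    fix z assume "z \<in> \<Phi> ` arrows G"
    then obtain \<gamma> where \<gamma>: "\<gamma> \<in> arrows G" "z = \<Phi> \<gamma>" by blast
    obtain t B where "rep (\<Phi> \<gamma>) = (t, h (gdom G \<gamma>))" and t: "t \<in> S" "open_bisection G B" "\<gamma> \<in> B"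
      "\<And>\<beta>. \<beta> \<in> B \<Longrightarrow> t (h (gdom G \<beta>)) = Some (h (gran G \<beta>))"
      using \<Phi>_rep[OF \<gamma>(1)] by blast
    then have "z = germ X S t (h (gdom G \<gamma>))" "h (gdom G \<gamma>) \<in> dom t"
      using germ_bisection[OF t(2-4)] \<gamma>(2) by (auto simp: dom_def)
    then show "z \<in> {germ X S s x | s x. s \<in> S \<and> x \<in> dom s}" using t(1) by blast
  qed
  finally show ?thesis .
qed

lemma \<Phi>_continuous: "continuous_map (gtop G) (gtop H) \<Phi>"
  unfolding gtop_H
proof (rule continuous_on_generated_topo)
  fix Z assume "Z \<in> {basic_germs s U V | s U V. s \<in> S \<and> openin X U \<and> openin X V}"
  then obtain s U V where Z: "Z = basic_germs s U V" "s \<in> S" "openin X U" "openin X V" by blast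
  show "openin (gtop G) (\<Phi> -` Z \<inter> arrows G)"
  proof (subst openin_subopen, intro ballI)
    fix \<gamma> assume "\<gamma> \<in> \<Phi> -` Z \<inter> arrows G"
    then obtain x where \<gamma>: "\<gamma> \<in> arrows G" and x: "\<Phi> \<gamma> = germ X S s x" "x \<in> dom s" "x \<in> U" "the (s x) \<in> V"
      by (auto simp: Z(1) basic_germs_def)
    \<comment> \<open>s is itself a member of its germ at x, so \<open>\<Phi>_memD\<close> describes
      s by a bisection around \<gamma>.\<close>
    have "openin X (dom s)" using Z(2) S_partial_homeos by (auto simp: partial_homeos_def)
    then have "(s, x) \<in> \<Phi> \<gamma>" unfolding x(1) germ_def using Z(2) x(2) by blast
    then obtain B where B: "x = h (gdom G \<gamma>)" "open_bisection G B" "\<gamma> \<in> B"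
      "\<And>\<beta>. \<beta> \<in> B \<Longrightarrow> s (h (gdom G \<beta>)) = Some (h (gran G \<beta>))" by (rule \<Phi>_memD[OF \<gamma>]) blast
    define B' where "B' = B \<inter> ({\<beta> \<in> arrows G. gdom G \<beta> \<in> {u \<in> units G. h u \<in> U}}
        \<inter> {\<beta> \<in> arrows G. gran G \<beta> \<in> {u \<in> units G. h u \<in> V}})"
    have B': "open_bisection G B'" unfolding B'_def
      by (intro bisection_Int[OF B(2)] openin_Int openin_continuous_map_preimage[OF continuous_dom]
          openin_continuous_map_preimage[OF continuous_ran] h_open_preimage Z)
    have "\<gamma> \<in> B'" using \<gamma> x B dom_units ran_units by (auto simp: B'_def)
    moreover have "\<beta> \<in> \<Phi> -` Z \<inter> arrows G" if "\<beta> \<in> B'" for \<beta>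
    proof -
      have \<beta>: "\<beta> \<in> B" "\<beta> \<in> arrows G" "h (gdom G \<beta>) \<in> U" "h (gran G \<beta>) \<in> V" using that by (auto simp: B'_def)
      have "\<Phi> \<beta> = germ X S s (h (gdom G \<beta>))" using germ_bisection[OF B(2) \<beta>(1) B(4)] by simp
      then show ?thesis using \<beta> B(4)[OF \<beta>(1)] by (auto simp: Z(1) basic_germs_def)
    qed
    ultimately show "\<exists>T. openin (gtop G) T \<and> \<gamma> \<in> T \<and> T \<subseteq> \<Phi> -` Z \<inter> arrows G"
      using bisection_open[OF B'] by blast
  qed
next
  show "\<Phi> ` arrows G \<subseteq> \<Union> {basic_germs s U V | s U V. s \<in> S \<and> openin X U \<and> openin X V}"
    using arrows_H unfolding gtop_H topology_generated_by_topspace by simp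
qed

lemma \<Phi>_open: "open_map (gtop G) (gtop H) \<Phi>"
  unfolding open_map_def
proof (intro allI impI)
  fix U assume U: "openin (gtop G) U"
  show "openin (gtop H) (\<Phi> ` U)"
  proof (subst openin_subopen, intro ballI)
    fix z assume "z \<in> \<Phi> ` U"
    then obtain \<gamma> where \<gamma>: "\<gamma> \<in> U" "z = \<Phi> \<gamma>" by blast
    obtain B0 where "open_bisection G B0" "\<gamma> \<in> B0" "B0 \<subseteq> U" using bisection_basis[OF U \<gamma>(1)] .
    then obtain B where B: "open_bisection G B" "\<gamma> \<in> B" "B \<subseteq> U" "\<tau> B \<in> S" using S_cover[of B0 \<gamma>] by blast
    have "basic_germs (\<tau> B) (topspace X) (topspace X) \<in> {basic_germs s U V | s U V. s \<in> S \<and> openin X U \<and> openin X V}"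
      using B(4) openin_topspace by blast
    then have "openin (gtop H) (\<Phi> ` B)"
      unfolding gtop_H \<Phi>_image_bisection[OF B(1)] by (rule topology_generated_by_Basis)
    then show "\<exists>T. openin (gtop H) T \<and> z \<in> T \<and> T \<subseteq> \<Phi> ` U" using B \<gamma>(2) by blast
  qed
qed

lemma \<Phi>_iso: "topgroupoid_iso G H \<Phi>"
  unfolding topgroupoid_iso_def
proof (intro conjI ballI)
  show "homeomorphic_map (gtop G) (gtop H) \<Phi>"
    using \<Phi>_continuous \<Phi>_open \<Phi>_inj arrows_H by (intro bijective_open_imp_homeomorphic_map) auto
  show "\<Phi> (ginv G \<gamma>) = ginv H (\<Phi> \<gamma>)" if "\<gamma> \<in> arrows G" for \<gamma> using \<Phi>_inv[OF that] by simp
  have d: "gdom H (\<Phi> \<gamma>) = \<Phi> (gdom G \<gamma>)" and r: "gran H (\<Phi> \<gamma>) = \<Phi> (gran G \<gamma>)" if "\<gamma> \<in> arrows G" for \<gamma>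
    using \<Phi>_mult[OF inv_composable[OF that]] \<Phi>_mult[OF composable_inv[OF that]] \<Phi>_inv[OF that]
    by (simp_all add: gdom_def gran_def)
  \<comment> \<open>Domains and ranges in H are products with inverses, so \<Phi> carries them over
    by \<open>\<Phi>_mult\<close> and \<open>\<Phi>_inv\<close>. Injectivity of \<Phi> on units
    gives the direction from H back to G.\<close>
  show "(\<gamma>, \<eta>) \<in> composable G \<longleftrightarrow> (\<Phi> \<gamma>, \<Phi> \<eta>) \<in> composable H" if "\<gamma> \<in> arrows G" "\<eta> \<in> arrows G" for \<gamma> \<eta>
    using that arrows_H inj_onD[OF \<Phi>_inj _ dom_closed ran_closed, of \<gamma> \<eta>] d r
    by (auto simp: composable_def)
  show "case z of (\<gamma>, \<eta>) \<Rightarrow> \<Phi> (gmult G \<gamma> \<eta>) = gmult H (\<Phi> \<gamma>) (\<Phi> \<eta>)" if "z \<in> composable G" for z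
    using \<Phi>_mult that by (cases z) auto
qed

end

theorem theorem5p5:
  fixes G :: "'g topgroupoid" and p :: real
  assumes "topological_groupoid G"
    and "Hausdorff_space (gtop G)"
    and "etale G"
    and "topologically_principal G"
    and "compact_space (unit_space G)"
    and "1 \<le> p" and "p \<noteq> 2"
  shows "\<exists>\<Phi>. topgroupoid_iso G (weyl_groupoid (Fp_lambda p G)) \<Phi> \<and> natural_weyl_map p G \<Phi>"
proof -
  interpret topological_groupoid G by fact
  interpret reduced_groupoid_algebra_ne_2 G p by unfold_locales (use assms in auto)
  interpret germs: realizable_chart G "core_spectrum FpA" ev "realizable_homeos FpA"
  proof
    show "realizable_homeos FpA \<subseteq> partial_homeos (core_spectrum FpA)" by (auto simp: realizable_homeos_def)
    show "topologically_principal G" by fact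
    show "\<exists>B \<sigma>. open_bisection G B \<and> \<sigma> \<in> B \<and> gdom G \<sigma> = x \<and> (\<forall>\<beta>\<in>B. s (ev (gdom G \<beta>)) = Some (ev (gran G \<beta>)))"
      if "s \<in> realizable_homeos FpA" "x \<in> units G" "ev x \<in> dom s" for s x
      using realizable_locally_bisection[OF assms(4) that] by metis
    show "\<exists>B'. open_bisection G B' \<and> \<gamma> \<in> B' \<and> B' \<subseteq> B \<and> chart.\<tau> B' \<in> realizable_homeos FpA"
      if "open_bisection G B" "\<gamma> \<in> B" for B \<gamma>
      using bisection_locally_realizable[OF that] by metis
  qed
  have "topgroupoid_iso G (weyl_groupoid FpA) germs.\<Phi>"
    unfolding weyl_groupoid_def by (rule germs.\<Phi>_iso)
  moreover have "natural_weyl_map p G germs.\<Phi>"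
    unfolding natural_weyl_map_def
    using ev_identification germs.\<Phi>_bisection by (auto simp: chart.\<tau>_def)
  ultimately show ?thesis by blast
qed

end
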